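(* Let $R$ be a commutative noetherian local ring with maximal ideal $\mathfrak{m}$ and let $M$ be a non-zero finitely generated $R$-module. Then the following statements are equivalent: (i) $M$ is a generalized Cohen-Macaulay module. (ii) There exists a proper ideal $\mathfrak{a}$ of $R$ such that $H^i_{\mathfrak{a}}(M)$ is of finite length for all $i$, $0\leq i<\dim_R(M)$.
   Context: $H^i_{\mathfrak{a}}$ denotes the $i$th local cohomology functor, i.e. the $i$th right derived functor of the $\mathfrak{a}$-torsion functor $\Gamma_{\mathfrak{a}}$. A finitely generated module $M$ over a local ring $(R,\mathfrak{m})$ is called generalized Cohen-Macaulay if $H^i_{\mathfrak{m}}(M)$ is of finite length for all $i<\dim_R(M)$. *)

theory Defs
  imports "HOL-Algebra.Module" "HOL-Algebra.QuotRing" "HOL-Algebra.Ideal_Product"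
    "HOL-Algebra.Ring_Divisibility" "HOL-Library.Extended_Nat"
begin

section \<open>Local rings and dimension\<close>

definition local_ring :: "('a, 'r) ring_scheme \<Rightarrow> 'a set \<Rightarrow> bool" where
  "local_ring R \<mm> \<longleftrightarrow>
     cring R \<and> maximalideal \<mm> R \<and> (\<forall>\<nn>. maximalideal \<nn> R \<longrightarrow> \<nn> = \<mm>)"

primrec ideal_power :: "('a, 'r) ring_scheme \<Rightarrow> 'a set \<Rightarrow> nat \<Rightarrow> 'a set" where
  "ideal_power R I 0 = carrier R"
| "ideal_power R I (Suc n) = ideal_prod R I (ideal_power R I n)"

definition krull_dim :: "('a, 'r) ring_scheme \<Rightarrow> enat" where
  "krull_dim R = Sup {enat n | n. \<exists>p :: nat \<Rightarrow> 'a set.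
     (\<forall>i\<le>n. primeideal (p i) R) \<and> (\<forall>i<n. p i \<subset> p (Suc i))}"

definition annihilator ::
  "('a, 'r) ring_scheme \<Rightarrow> ('a, 'b, 'm) module_scheme \<Rightarrow> 'a set" where
  "annihilator R M = {r \<in> carrier R. \<forall>x \<in> carrier M. r \<odot>\<^bsub>M\<^esub> x = \<zero>\<^bsub>M\<^esub>}"

text \<open>The dimension of a finitely generated module. The zero module gets the value
  \<open>Sup {} = 0\<close>, not \<open>-\<infinity>\<close>.\<close>

definition module_dim ::
  "('a, 'r) ring_scheme \<Rightarrow> ('a, 'b, 'm) module_scheme \<Rightarrow> enat" where
  "module_dim R M = krull_dim (R Quot annihilator R M)"


section \<open>Modules\<close>

definition finitely_generated_module ::
  "('a, 'r) ring_scheme \<Rightarrow> ('a, 'b, 'm) module_scheme \<Rightarrow> bool" where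
  "finitely_generated_module R M \<longleftrightarrow> module R M \<and>
     (\<exists>S. finite S \<and> S \<subseteq> carrier M \<and>
        carrier M = {(\<Oplus>\<^bsub>M\<^esub>x\<in>S. c x \<odot>\<^bsub>M\<^esub> x) | c. c \<in> S \<rightarrow> carrier R})"

definition module_length ::
  "('a, 'r) ring_scheme \<Rightarrow> ('a, 'b, 'm) module_scheme \<Rightarrow> enat" where
  "module_length R M = Sup {enat n | n. \<exists>N :: nat \<Rightarrow> 'b set.
     N 0 = {\<zero>\<^bsub>M\<^esub>} \<and> N n = carrier M \<and>
     (\<forall>i\<le>n. submodule (N i) R M) \<and> (\<forall>i<n. N i \<subset> N (Suc i))}"

definition finite_length ::
  "('a, 'r) ring_scheme \<Rightarrow> ('a, 'b, 'm) module_scheme \<Rightarrow> bool" where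
  "finite_length R M \<longleftrightarrow> module R M \<and> module_length R M < \<infinity>"

definition mod_hom ::
  "('a, 'r) ring_scheme \<Rightarrow> ('a, 'b, 'm) module_scheme \<Rightarrow> ('a, 'c, 'n) module_scheme
     \<Rightarrow> ('b \<Rightarrow> 'c) set" where
  "mod_hom R M N = {f \<in> carrier M \<rightarrow> carrier N.
     (\<forall>x\<in>carrier M. \<forall>y\<in>carrier M. f (x \<oplus>\<^bsub>M\<^esub> y) = f x \<oplus>\<^bsub>N\<^esub> f y) \<and>
     (\<forall>r\<in>carrier R. \<forall>x\<in>carrier M. f (r \<odot>\<^bsub>M\<^esub> x) = r \<odot>\<^bsub>N\<^esub> f x)}"

definition hom_ker ::
  "('a, 'b, 'm) module_scheme \<Rightarrow> ('a, 'c, 'n) module_scheme \<Rightarrow> ('b \<Rightarrow> 'c) \<Rightarrow> 'b set" where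
  "hom_ker M N f = {x \<in> carrier M. f x = \<zero>\<^bsub>N\<^esub>}"

text \<open>The quotient of a module by a submodule. The type of modules extends that of rings;
  the multiplicative fields carry no information about a module.\<close>

definition quot_module ::
  "('a, 'b, 'm) module_scheme \<Rightarrow> 'b set \<Rightarrow> ('a, 'b set) module" where
  "quot_module M N =
     \<lparr>carrier = a_rcosets\<^bsub>M\<^esub> N, monoid.mult = undefined, one = undefined,
      zero = N, add = set_add M,
      smult = (\<lambda>r C. \<Union>x\<in>C. N +>\<^bsub>M\<^esub> (r \<odot>\<^bsub>M\<^esub> x))\<rparr>"


section \<open>Injective resolutions and right derived functors\<close>

text \<open>Injective objects among the \<open>R\<close>-modules whose elements lie in the type \<open>'u\<close>. If \<open>'u\<close> is
  infinite and has room for \<open>R\<close>, then the ideals of \<open>R\<close> have copies in \<open>'u\<close> and, by Baer's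
  criterion, these are exactly the injective \<open>R\<close>-modules (with elements in \<open>'u\<close>).\<close>

definition injective_module ::
  "('a, 'r) ring_scheme \<Rightarrow> ('a, 'u) module \<Rightarrow> bool" where
  "injective_module R E \<longleftrightarrow> module R E \<and>
     (\<forall>(A :: ('a, 'u) module) (B :: ('a, 'u) module) f g.
        module R A \<and> module R B \<and> f \<in> mod_hom R A B \<and> inj_on f (carrier A) \<and>
        g \<in> mod_hom R A E
        \<longrightarrow> (\<exists>h \<in> mod_hom R B E. \<forall>x\<in>carrier A. h (f x) = g x))"

text \<open>An exact sequence \<open>0 \<rightarrow> M \<rightarrow> E 0 \<rightarrow> E 1 \<rightarrow> \<dots>\<close> with augmentation \<open>\<epsilon>\<close>.\<close>

definition injective_resolution ::
  "('a, 'r) ring_scheme \<Rightarrow> ('a, 'b, 'm) module_scheme \<Rightarrow> (nat \<Rightarrow> ('a, 'u) module)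
     \<Rightarrow> (nat \<Rightarrow> 'u \<Rightarrow> 'u) \<Rightarrow> ('b \<Rightarrow> 'u) \<Rightarrow> bool" where
  "injective_resolution R M E d \<epsilon> \<longleftrightarrow>
     (\<forall>i. injective_module R (E i)) \<and>
     (\<forall>i. d i \<in> mod_hom R (E i) (E (Suc i))) \<and>
     \<epsilon> \<in> mod_hom R M (E 0) \<and> inj_on \<epsilon> (carrier M) \<and>
     \<epsilon> ` carrier M = hom_ker (E 0) (E 1) (d 0) \<and>
     (\<forall>i. d i ` carrier (E i) = hom_ker (E (Suc i)) (E (Suc (Suc i))) (d (Suc i)))"

text \<open>A type in which every \<open>R\<close>-module \<open>M\<close> (with \<open>R\<close> in \<open>'a\<close> and \<open>M\<close> in \<open>'b\<close>) has an injective
  resolution. Its cardinality \<open>\<kappa>\<close> is two to the power of an infinite cardinal that is at least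
  the cardinality of \<open>'a\<close>, so that \<open>\<kappa>\<close> to the power of the cardinality of \<open>'a\<close> is again \<open>\<kappa>\<close>.
  Hence, if \<open>N\<close> has at most \<open>\<kappa>\<close> elements and \<open>D\<close> is a divisible hull of the abelian group
  \<open>N\<close>, then the injective module \<open>Hom\<^sub>\<int>(R, D)\<close>, which contains \<open>N\<close>, and all its quotients
  have at most \<open>\<kappa>\<close> elements.\<close>

type_synonym ('a, 'b) res_univ = "(nat + 'a + 'b) set"

definition chosen_resolution ::
  "('a, 'r) ring_scheme \<Rightarrow> ('a, 'b, 'm) module_scheme
     \<Rightarrow> (nat \<Rightarrow> ('a, ('a, 'b) res_univ) module) \<times>
        (nat \<Rightarrow> ('a, 'b) res_univ \<Rightarrow> ('a, 'b) res_univ)" where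
  "chosen_resolution R M = (SOME (E, d). \<exists>\<epsilon>. injective_resolution R M E d \<epsilon>)"

text \<open>The \<open>i\<close>-th cohomology module of a complex \<open>C 0 \<rightarrow> C 1 \<rightarrow> \<dots>\<close>.\<close>

definition cohomology ::
  "(nat \<Rightarrow> ('a, 'u) module) \<Rightarrow> (nat \<Rightarrow> 'u \<Rightarrow> 'u) \<Rightarrow> nat \<Rightarrow> ('a, 'u set) module" where
  "cohomology C d i =
     quot_module ((C i)\<lparr>carrier := hom_ker (C i) (C (Suc i)) (d i)\<rparr>)
       (case i of 0 \<Rightarrow> {\<zero>\<^bsub>C 0\<^esub>} | Suc j \<Rightarrow> d j ` carrier (C j))"

text \<open>The right derived functors of a covariant additive functor, which is given by its action
  \<open>Fo\<close> on modules and its action \<open>Fm A B\<close> on homomorphisms \<open>A \<rightarrow> B\<close>.\<close>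

definition right_derived ::
  "(('a, ('a, 'b) res_univ) module \<Rightarrow> ('a, ('a, 'b) res_univ) module)
     \<Rightarrow> (('a, ('a, 'b) res_univ) module \<Rightarrow> ('a, ('a, 'b) res_univ) module
          \<Rightarrow> (('a, 'b) res_univ \<Rightarrow> ('a, 'b) res_univ)
          \<Rightarrow> ('a, 'b) res_univ \<Rightarrow> ('a, 'b) res_univ)
     \<Rightarrow> ('a, 'r) ring_scheme \<Rightarrow> ('a, 'b, 'm) module_scheme \<Rightarrow> nat
     \<Rightarrow> ('a, ('a, 'b) res_univ set) module" where
  "right_derived Fo Fm R M i =
     (case chosen_resolution R M of (E, d) \<Rightarrow>
        cohomology (\<lambda>j. Fo (E j)) (\<lambda>j. Fm (E j) (E (Suc j)) (d j)) i)"


section \<open>Local cohomology\<close>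

definition torsion_module ::
  "('a, 'r) ring_scheme \<Rightarrow> 'a set \<Rightarrow> ('a, 'b, 'm) module_scheme \<Rightarrow> ('a, 'b, 'm) module_scheme"
  where
  "torsion_module R \<aa> M =
     M\<lparr>carrier := {x \<in> carrier M. \<exists>n. \<forall>r \<in> ideal_power R \<aa> n. r \<odot>\<^bsub>M\<^esub> x = \<zero>\<^bsub>M\<^esub>}\<rparr>"

definition torsion_map ::
  "('a, 'r) ring_scheme \<Rightarrow> 'a set \<Rightarrow> ('a, 'b, 'm) module_scheme \<Rightarrow> ('a, 'c, 'n) module_scheme
     \<Rightarrow> ('b \<Rightarrow> 'c) \<Rightarrow> 'b \<Rightarrow> 'c" where
  "torsion_map R \<aa> A B f = restrict f (carrier (torsion_module R \<aa> A))"

definition local_cohomology ::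
  "('a, 'r) ring_scheme \<Rightarrow> 'a set \<Rightarrow> ('a, 'b, 'm) module_scheme \<Rightarrow> nat
     \<Rightarrow> ('a, ('a, 'b) res_univ set) module" where
  "local_cohomology R \<aa> M i = right_derived (torsion_module R \<aa>) (torsion_map R \<aa>) R M i"

definition generalized_Cohen_Macaulay ::
  "('a, 'r) ring_scheme \<Rightarrow> 'a set \<Rightarrow> ('a, 'b, 'm) module_scheme \<Rightarrow> bool" where
  "generalized_Cohen_Macaulay R \<mm> M \<longleftrightarrow>
     finitely_generated_module R M \<and>
     (\<forall>i. enat i < module_dim R M \<longrightarrow> finite_length R (local_cohomology R \<mm> M i))"

end

theory Submission
  imports Defs "HOL-Algebra.Free_Abelian_Groups"
begin

text \<open>
  A proper ideal \<open>\<aa>\<close> is contained in \<open>\<mm>\<close>, and \<open>\<mm>\<close> is itself a proper ideal; the point is therefore to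
  compare \<open>H\<^sup>i\<^sub>\<mm>(M)\<close> with \<open>H\<^sup>i\<^sub>\<aa>(M)\<close>. Both are cohomology modules of subcomplexes
  \<open>\<Gamma>\<^sub>\<mm>(E) \<subseteq> \<Gamma>\<^sub>\<aa>(E)\<close> of one injective resolution \<open>E\<close> of \<open>M\<close>. The claim is that the map
  \<open>H\<^sup>i\<^sub>\<mm>(M) \<rightarrow> H\<^sup>i\<^sub>\<aa>(M)\<close> is injective as soon as \<open>H\<^sup>j\<^sub>\<aa>(M)\<close> has finite length for all \<open>j \<le> i\<close>; finite length
  then passes to \<open>H\<^sup>i\<^sub>\<mm>(M)\<close>. A spectral sequence for \<open>\<Gamma>\<^sub>\<mm> = \<Gamma>\<^sub>\<mm> \<circ> \<Gamma>\<^sub>\<aa>\<close> would show this; the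
  proof below is a direct computation with elements.

  In a module of finite length over the local ring \<open>R\<close>, every element is killed by a power of every
  \<open>x \<in> \<mm>\<close> (\<open>finite_length_imp_torsion\<close>). So the classes in \<open>H\<^sup>j(\<Gamma>\<^sub>\<aa>(E))\<close> are \<open>x\<close>-torsion
  for \<open>j \<le> i\<close>. One passes from \<open>\<Gamma>\<^sub>\<aa>(E)\<close> to \<open>\<Gamma>\<^sub>\<mm>(E)\<close> by treating finitely many generators \<open>x\<close> of \<open>\<mm>\<close> one
  after another, each time restricting to the elements killed by a power of \<open>x\<close>
  (\<open>power_torsion_boundaries\<close>). In a single step there is a subcomplex \<open>C\<close> whose cohomology is \<open>x\<close>-torsion
  in the degrees considered, and an element \<open>y\<close> of \<open>C\<close> with \<open>d y\<close> killed by a power of \<open>x\<close>; one wants \<open>d y = d y'\<close> for some \<open>y'\<close> in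
  \<open>C\<close> that is killed by a power of \<open>x\<close>. A multiple \<open>x\<^sup>m y\<close> is a cycle, and, for larger \<open>m\<close>, a
  boundary \<open>d u\<close>. If \<open>u\<close> can be divided by \<open>x\<^sup>m\<close> up to \<open>x\<close>-torsion, say \<open>x\<^sup>m z - u\<close> is
  \<open>x\<close>-torsion, then \<open>y' = y - d z\<close> does it (\<open>torsion_boundary_has_torsion_preimage\<close>). Such a \<open>z\<close> exists
  because \<open>R\<close> is noetherian and the terms of \<open>E\<close> are injective, and \<open>z\<close> can be chosen with
  \<open>ann u \<subseteq> ann z\<close>, so that it stays inside every torsion submodule that contains \<open>u\<close>
  (\<open>injective_division\<close>).

  Local cohomology is computed from a chosen injective resolution with elements in a fixed type, so
  one has to know that a resolution exists there (\<open>injective_resolution_exists\<close>). A module \<open>N\<close> embeds in the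
  injective module \<open>Hom\<^sub>\<int>(R, D)\<close>, where \<open>D\<close> is the divisible group obtained from the free rational
  vector space on \<open>N\<close> by dividing out the relations of \<open>N\<close>; the type is large enough to hold
  all functions from \<open>R\<close> to that vector space, hence the terms of the resolution and their quotients.
\<close>

section \<open>Homomorphisms, quotients and copies of modules\<close>

lemma (in abelian_group) diff_add_diff:
  assumes "a \<in> carrier G" "b \<in> carrier G" "c \<in> carrier G"
  shows "(a \<ominus> b) \<oplus> (b \<ominus> c) = a \<ominus> c"
proof -
  have "(a \<ominus> b) \<oplus> (b \<ominus> c) = (a \<ominus> c) \<oplus> (b \<oplus> \<ominus> b)" using assms by (simp add: minus_eq a_ac)
  then show ?thesis using assms by (simp add: r_neg)
qed

lemma (in abelian_group) diff_zero:
  assumes "a \<in> carrier G"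
  shows "a \<ominus> \<zero> = a"
proof -
  have "\<ominus> \<zero> = \<zero>" using r_neg[OF zero_closed] l_zero[OF a_inv_closed[OF zero_closed]] by simp
  then show ?thesis using assms by (simp add: minus_eq)
qed

lemma (in abelian_group) eq_if_diff_zero:
  assumes "a \<in> carrier G" "b \<in> carrier G" "a \<ominus> b = \<zero>"
  shows "a = b"
proof -
  have "(a \<ominus> b) \<oplus> b = a" using assms(1,2) by (simp add: minus_eq a_assoc l_neg)
  then show ?thesis using assms by simp
qed

lemma (in abelian_group) diff_diff_left:
  assumes "a \<in> carrier G" "b \<in> carrier G" "c \<in> carrier G"
  shows "(a \<ominus> c) \<ominus> (a \<ominus> b) = b \<ominus> c"
proof -
  have "(a \<ominus> c) \<ominus> (a \<ominus> b) = (b \<ominus> c) \<oplus> (a \<oplus> \<ominus> a)" using assms by (simp add: minus_eq minus_add a_ac)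
  then show ?thesis using assms by (simp add: r_neg)
qed

lemma (in abelian_group) diff_diff_right:
  assumes "a \<in> carrier G" "b \<in> carrier G" "c \<in> carrier G"
  shows "(a \<ominus> c) \<ominus> (b \<ominus> c) = a \<ominus> b"
proof -
  have "(a \<ominus> c) \<ominus> (b \<ominus> c) = (a \<ominus> b) \<oplus> (c \<oplus> \<ominus> c)" using assms by (simp add: minus_eq minus_add a_ac)
  then show ?thesis using assms by (simp add: r_neg)
qed

lemma mod_homD:
  assumes "f \<in> mod_hom R M N"
  shows "x \<in> carrier M \<Longrightarrow> f x \<in> carrier N"
    and "\<lbrakk>x \<in> carrier M; y \<in> carrier M\<rbrakk> \<Longrightarrow> f (x \<oplus>\<^bsub>M\<^esub> y) = f x \<oplus>\<^bsub>N\<^esub> f y"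
    and "\<lbrakk>r \<in> carrier R; x \<in> carrier M\<rbrakk> \<Longrightarrow> f (r \<odot>\<^bsub>M\<^esub> x) = r \<odot>\<^bsub>N\<^esub> f x"
  using assms by (auto simp: mod_hom_def)

lemma mod_homI:
  assumes "\<And>x. x \<in> carrier M \<Longrightarrow> f x \<in> carrier N"
    and "\<And>x y. \<lbrakk>x \<in> carrier M; y \<in> carrier M\<rbrakk> \<Longrightarrow> f (x \<oplus>\<^bsub>M\<^esub> y) = f x \<oplus>\<^bsub>N\<^esub> f y"
    and "\<And>r x. \<lbrakk>r \<in> carrier R; x \<in> carrier M\<rbrakk> \<Longrightarrow> f (r \<odot>\<^bsub>M\<^esub> x) = r \<odot>\<^bsub>N\<^esub> f x"
  shows "f \<in> mod_hom R M N"
  using assms by (auto simp: mod_hom_def)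

lemma mod_hom_zero:
  assumes "module R M" and "module R N" and f: "f \<in> mod_hom R M N"
  shows "f \<zero>\<^bsub>M\<^esub> = \<zero>\<^bsub>N\<^esub>"
proof -
  interpret M: module R M by fact
  interpret N: module R N by fact
  have "\<zero>\<^bsub>R\<^esub> \<odot>\<^bsub>N\<^esub> f \<zero>\<^bsub>M\<^esub> = \<zero>\<^bsub>N\<^esub>" using mod_homD(1)[OF f] by simp
  then show ?thesis using mod_homD(3)[OF f, of "\<zero>\<^bsub>R\<^esub>" "\<zero>\<^bsub>M\<^esub>"] by simp
qed

lemma mod_hom_minus:
  assumes "module R M" and "module R N" and f: "f \<in> mod_hom R M N"
    and x: "x \<in> carrier M" and y: "y \<in> carrier M"
  shows "f (x \<ominus>\<^bsub>M\<^esub> y) = f x \<ominus>\<^bsub>N\<^esub> f y"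
proof -
  interpret M: module R M by fact
  interpret N: module R N by fact
  have "f (x \<ominus>\<^bsub>M\<^esub> y) \<oplus>\<^bsub>N\<^esub> f y = f x"
    using mod_homD(2)[OF f, of "x \<ominus>\<^bsub>M\<^esub> y" y] x y by (simp add: M.minus_eq M.a_assoc M.l_neg)
  then show ?thesis
    using mod_homD(1)[OF f] x y by (metis M.minus_closed N.add.inv_solve_right' N.minus_eq)
qed

text \<open>The module axioms are equations, so they pass to any structure that is the image of a module under a
  map respecting the operations. Quotients and copies of modules become modules in this way.\<close>

lemma module_hom_image:
  assumes "module R Z" and p: "p \<in> mod_hom R Z Q"
    and surj: "p ` carrier Z = carrier Q" and zero: "p \<zero>\<^bsub>Z\<^esub> = \<zero>\<^bsub>Q\<^esub>"
  shows "module R Q"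
proof -
  interpret Z: module R Z by fact
  note h = mod_homD[OF p]
  have ex: "\<exists>z \<in> carrier Z. q = p z" if "q \<in> carrier Q" for q
    using that surj by blast
  show ?thesis
  proof (rule moduleI)
    show "cring R" by (rule Z.R.is_cring)
    show "abelian_group Q"
    proof (rule abelian_groupI)
      fix x y z assume "x \<in> carrier Q" "y \<in> carrier Q" "z \<in> carrier Q"
      then obtain a b c where abc: "a \<in> carrier Z" "b \<in> carrier Z" "c \<in> carrier Z"
          "x = p a" "y = p b" "z = p c"
        using ex by metis
      have "x \<oplus>\<^bsub>Q\<^esub> y = p (a \<oplus>\<^bsub>Z\<^esub> b)" "y \<oplus>\<^bsub>Q\<^esub> z = p (b \<oplus>\<^bsub>Z\<^esub> c)"
        using abc by (simp_all add: h(2))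
      then have "x \<oplus>\<^bsub>Q\<^esub> y \<oplus>\<^bsub>Q\<^esub> z = p (a \<oplus>\<^bsub>Z\<^esub> b \<oplus>\<^bsub>Z\<^esub> c)"
          "x \<oplus>\<^bsub>Q\<^esub> (y \<oplus>\<^bsub>Q\<^esub> z) = p (a \<oplus>\<^bsub>Z\<^esub> (b \<oplus>\<^bsub>Z\<^esub> c))"
        using abc by (simp_all add: h(2))
      then show "x \<oplus>\<^bsub>Q\<^esub> y \<oplus>\<^bsub>Q\<^esub> z = x \<oplus>\<^bsub>Q\<^esub> (y \<oplus>\<^bsub>Q\<^esub> z)"
        using abc by (simp add: Z.a_assoc)
    next
      fix x y assume "x \<in> carrier Q" "y \<in> carrier Q"
      then obtain a b where ab: "a \<in> carrier Z" "b \<in> carrier Z" "x = p a" "y = p b"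
        using ex by metis
      show "x \<oplus>\<^bsub>Q\<^esub> y \<in> carrier Q" "x \<oplus>\<^bsub>Q\<^esub> y = y \<oplus>\<^bsub>Q\<^esub> x"
        using ab h(1)[of "a \<oplus>\<^bsub>Z\<^esub> b"] by (simp_all add: h(2)[symmetric] Z.a_comm)
    next
      show "\<zero>\<^bsub>Q\<^esub> \<in> carrier Q" using h(1)[of "\<zero>\<^bsub>Z\<^esub>"] zero by simp
    next
      fix x assume "x \<in> carrier Q"
      then obtain a where a: "a \<in> carrier Z" "x = p a" using ex by metis
      then show "\<zero>\<^bsub>Q\<^esub> \<oplus>\<^bsub>Q\<^esub> x = x"
        using h(2)[of "\<zero>\<^bsub>Z\<^esub>" a] zero by simp
      show "\<exists>y\<in>carrier Q. y \<oplus>\<^bsub>Q\<^esub> x = \<zero>\<^bsub>Q\<^esub>"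
        using h(2)[of "\<ominus>\<^bsub>Z\<^esub> a" a] h(1)[of "\<ominus>\<^bsub>Z\<^esub> a"] zero a by (auto simp: Z.l_neg)
    qed
  next
    fix r s x y assume rs: "r \<in> carrier R" "s \<in> carrier R" and "x \<in> carrier Q" "y \<in> carrier Q"
    then obtain a b where ab: "a \<in> carrier Z" "b \<in> carrier Z" "x = p a" "y = p b"
      using ex by metis
    show "r \<odot>\<^bsub>Q\<^esub> x \<in> carrier Q"
      using rs ab h(1)[of "r \<odot>\<^bsub>Z\<^esub> a"] by (simp add: h(3))
    have "(r \<oplus>\<^bsub>R\<^esub> s) \<odot>\<^bsub>Q\<^esub> x = p (r \<odot>\<^bsub>Z\<^esub> a \<oplus>\<^bsub>Z\<^esub> s \<odot>\<^bsub>Z\<^esub> a)"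
      using rs ab h(3)[of "r \<oplus>\<^bsub>R\<^esub> s" a] by (simp add: Z.smult_l_distr)
    then show "(r \<oplus>\<^bsub>R\<^esub> s) \<odot>\<^bsub>Q\<^esub> x = r \<odot>\<^bsub>Q\<^esub> x \<oplus>\<^bsub>Q\<^esub> s \<odot>\<^bsub>Q\<^esub> x"
      using rs ab by (simp add: h)
    have "r \<odot>\<^bsub>Q\<^esub> (x \<oplus>\<^bsub>Q\<^esub> y) = p (r \<odot>\<^bsub>Z\<^esub> (a \<oplus>\<^bsub>Z\<^esub> b))"
      using rs ab by (simp add: h)
    then show "r \<odot>\<^bsub>Q\<^esub> (x \<oplus>\<^bsub>Q\<^esub> y) = r \<odot>\<^bsub>Q\<^esub> x \<oplus>\<^bsub>Q\<^esub> r \<odot>\<^bsub>Q\<^esub> y"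
      using rs ab by (simp add: h Z.smult_r_distr)
    have "(r \<otimes>\<^bsub>R\<^esub> s) \<odot>\<^bsub>Q\<^esub> x = p (r \<odot>\<^bsub>Z\<^esub> (s \<odot>\<^bsub>Z\<^esub> a))"
      using rs ab h(3)[of "r \<otimes>\<^bsub>R\<^esub> s" a] by (simp add: Z.smult_assoc1)
    then show "(r \<otimes>\<^bsub>R\<^esub> s) \<odot>\<^bsub>Q\<^esub> x = r \<odot>\<^bsub>Q\<^esub> (s \<odot>\<^bsub>Q\<^esub> x)"
      using rs ab by (simp add: h)
  next
    fix x assume "x \<in> carrier Q"
    then obtain a where a: "a \<in> carrier Z" "x = p a" using ex by metis
    then show "\<one>\<^bsub>R\<^esub> \<odot>\<^bsub>Q\<^esub> x = x" using h(3)[of "\<one>\<^bsub>R\<^esub>" a] by simp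
  qed
qed

lemma submoduleD:
  assumes "module R M" and "submodule H R M"
  shows "\<And>x. x \<in> H \<Longrightarrow> x \<in> carrier M" and "\<zero>\<^bsub>M\<^esub> \<in> H"
    and "\<And>x y. \<lbrakk>x \<in> H; y \<in> H\<rbrakk> \<Longrightarrow> x \<oplus>\<^bsub>M\<^esub> y \<in> H"
    and "\<And>x y. \<lbrakk>x \<in> H; y \<in> H\<rbrakk> \<Longrightarrow> x \<ominus>\<^bsub>M\<^esub> y \<in> H"
    and "\<And>x. x \<in> H \<Longrightarrow> \<ominus>\<^bsub>M\<^esub> x \<in> H"
    and "\<And>r x. \<lbrakk>r \<in> carrier R; x \<in> H\<rbrakk> \<Longrightarrow> r \<odot>\<^bsub>M\<^esub> x \<in> H"
proof -
  interpret module R M by fact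
  note e = submoduleE[OF assms(2)]
  show "\<And>x. x \<in> H \<Longrightarrow> x \<in> carrier M" using e(1) by blast
  show "\<zero>\<^bsub>M\<^esub> \<in> H" using subgroup.one_closed[OF submodule.axioms(1)[OF assms(2)]] by simp
  show "\<And>x y. \<lbrakk>x \<in> H; y \<in> H\<rbrakk> \<Longrightarrow> x \<oplus>\<^bsub>M\<^esub> y \<in> H" using e(5) by blast
  show "\<And>x y. \<lbrakk>x \<in> H; y \<in> H\<rbrakk> \<Longrightarrow> x \<ominus>\<^bsub>M\<^esub> y \<in> H" using e(3,5) by (simp add: minus_eq)
  show "\<And>x. x \<in> H \<Longrightarrow> \<ominus>\<^bsub>M\<^esub> x \<in> H" using e(3) by blast
  show "\<And>r x. \<lbrakk>r \<in> carrier R; x \<in> H\<rbrakk> \<Longrightarrow> r \<odot>\<^bsub>M\<^esub> x \<in> H" using e(4) by blast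
qed

text \<open>Cosets live in a larger type than elements. To keep quotients in a prescribed type, each
  coset is represented by one of its elements, and that element is moved by \<open>\<phi>\<close>.\<close>

lemma quotient_in_type:
  fixes Z :: "('a, 'c, 'm) module_scheme" and \<phi> :: "'c \<Rightarrow> 'u"
  assumes Z: "module R Z" and I: "submodule I R Z" and inj: "inj_on \<phi> (carrier Z)"
  obtains Q :: "('a, 'u) module" and p where "module R Q" and "p \<in> mod_hom R Z Q"
    and "p ` carrier Z = carrier Q" and "hom_ker Z Q p = I"
proof -
  interpret Z: module R Z by fact
  note I = submoduleD[OF Z I]
  define rep where "rep x = (SOME y. y \<in> carrier Z \<and> y \<ominus>\<^bsub>Z\<^esub> x \<in> I)" for x
  have rep: "rep x \<in> carrier Z \<and> rep x \<ominus>\<^bsub>Z\<^esub> x \<in> I" if "x \<in> carrier Z" for x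
    unfolding rep_def by (rule someI[of _ x]) (use that I(2) in \<open>simp add: Z.minus_eq Z.r_neg\<close>)
  have rep_eq: "rep x = rep y \<longleftrightarrow> x \<ominus>\<^bsub>Z\<^esub> y \<in> I" if x: "x \<in> carrier Z" and y: "y \<in> carrier Z" for x y
  proof
    assume eq: "rep x = rep y"
    have "x \<ominus>\<^bsub>Z\<^esub> y = (rep x \<ominus>\<^bsub>Z\<^esub> y) \<ominus>\<^bsub>Z\<^esub> (rep x \<ominus>\<^bsub>Z\<^esub> x)"
      using rep[OF x] x y Z.diff_diff_left by simp
    then show "x \<ominus>\<^bsub>Z\<^esub> y \<in> I" using I(4) rep[OF x] rep[OF y] eq by simp
  next
    assume xy: "x \<ominus>\<^bsub>Z\<^esub> y \<in> I"
    have "w \<ominus>\<^bsub>Z\<^esub> x \<in> I \<longleftrightarrow> w \<ominus>\<^bsub>Z\<^esub> y \<in> I" if w: "w \<in> carrier Z" for w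
    proof -
      have "w \<ominus>\<^bsub>Z\<^esub> y = (w \<ominus>\<^bsub>Z\<^esub> x) \<oplus>\<^bsub>Z\<^esub> (x \<ominus>\<^bsub>Z\<^esub> y)"
          "w \<ominus>\<^bsub>Z\<^esub> x = (w \<ominus>\<^bsub>Z\<^esub> y) \<ominus>\<^bsub>Z\<^esub> (x \<ominus>\<^bsub>Z\<^esub> y)"
        using w x y by (simp_all add: Z.diff_add_diff Z.diff_diff_right)
      then show ?thesis using I(3,4) xy by metis
    qed
    then show "rep x = rep y" unfolding rep_def by metis
  qed
  define p where "p x = \<phi> (rep x)" for x
  have p_eq: "p x = p y \<longleftrightarrow> x \<ominus>\<^bsub>Z\<^esub> y \<in> I" if "x \<in> carrier Z" "y \<in> carrier Z" for x y
    unfolding p_def using rep_eq[OF that] rep that inj by (auto dest: inj_onD)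
  define s where "s = inv_into (carrier Z) p"
  have s: "s (p x) \<in> carrier Z" "s (p x) \<ominus>\<^bsub>Z\<^esub> x \<in> I" if "x \<in> carrier Z" for x
  proof -
    show c: "s (p x) \<in> carrier Z" unfolding s_def by (rule inv_into_into) (use that in blast)
    have "p (s (p x)) = p x" unfolding s_def by (rule f_inv_into_f) (use that in blast)
    then show "s (p x) \<ominus>\<^bsub>Z\<^esub> x \<in> I" using p_eq c that by blast
  qed
  define Q :: "('a, 'u) module" where
    "Q = \<lparr>carrier = p ` carrier Z, monoid.mult = undefined, one = undefined, ring.zero = p \<zero>\<^bsub>Z\<^esub>,
          add = (\<lambda>a b. p (s a \<oplus>\<^bsub>Z\<^esub> s b)), smult = (\<lambda>r a. p (r \<odot>\<^bsub>Z\<^esub> s a))\<rparr>"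
  have hom: "p \<in> mod_hom R Z Q"
  proof (rule mod_homI)
    show "p x \<in> carrier Q" if "x \<in> carrier Z" for x using that by (simp add: Q_def)
    fix x y assume x: "x \<in> carrier Z" and y: "y \<in> carrier Z"
    have "(x \<oplus>\<^bsub>Z\<^esub> y) \<ominus>\<^bsub>Z\<^esub> (s (p x) \<oplus>\<^bsub>Z\<^esub> s (p y)) = \<ominus>\<^bsub>Z\<^esub> ((s (p x) \<ominus>\<^bsub>Z\<^esub> x) \<oplus>\<^bsub>Z\<^esub> (s (p y) \<ominus>\<^bsub>Z\<^esub> y))"
      using x y s by (simp add: Z.minus_eq Z.minus_add Z.a_ac)
    then have "(x \<oplus>\<^bsub>Z\<^esub> y) \<ominus>\<^bsub>Z\<^esub> (s (p x) \<oplus>\<^bsub>Z\<^esub> s (p y)) \<in> I" using s x y I(3,5) by simp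
    then show "p (x \<oplus>\<^bsub>Z\<^esub> y) = p x \<oplus>\<^bsub>Q\<^esub> p y"
      using x y s by (simp add: Q_def p_eq)
  next
    fix r x assume r: "r \<in> carrier R" and x: "x \<in> carrier Z"
    have "(r \<odot>\<^bsub>Z\<^esub> x) \<ominus>\<^bsub>Z\<^esub> (r \<odot>\<^bsub>Z\<^esub> s (p x)) = \<ominus>\<^bsub>Z\<^esub> (r \<odot>\<^bsub>Z\<^esub> (s (p x) \<ominus>\<^bsub>Z\<^esub> x))"
      using r x s by (simp add: Z.minus_eq Z.minus_add Z.a_ac Z.smult_r_distr Z.smult_r_minus)
    then have "(r \<odot>\<^bsub>Z\<^esub> x) \<ominus>\<^bsub>Z\<^esub> (r \<odot>\<^bsub>Z\<^esub> s (p x)) \<in> I" using s r x I(5,6) by simp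
    then show "p (r \<odot>\<^bsub>Z\<^esub> x) = r \<odot>\<^bsub>Q\<^esub> p x"
      using r x s by (simp add: Q_def p_eq)
  qed
  have surj: "p ` carrier Z = carrier Q" by (simp add: Q_def)
  have zero: "p \<zero>\<^bsub>Z\<^esub> = \<zero>\<^bsub>Q\<^esub>" by (simp add: Q_def)
  have "x \<ominus>\<^bsub>Z\<^esub> \<zero>\<^bsub>Z\<^esub> = x" if "x \<in> carrier Z" for x using that by (rule Z.diff_zero)
  then have "hom_ker Z Q p = I"
    unfolding hom_ker_def using p_eq[of _ "\<zero>\<^bsub>Z\<^esub>"] I(1) zero by auto
  then show thesis using that module_hom_image[OF Z hom surj zero] hom surj by blast
qed

lemma inj_on_if_trivial_kernel:
  assumes M: "module R M" and N: "module R N" and f: "f \<in> mod_hom R M N"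
    and ker: "hom_ker M N f = {\<zero>\<^bsub>M\<^esub>}"
  shows "inj_on f (carrier M)"
proof (rule inj_onI)
  interpret M: module R M by fact
  interpret N: module R N by fact
  fix x y assume x: "x \<in> carrier M" and y: "y \<in> carrier M" and eq: "f x = f y"
  have "f (x \<ominus>\<^bsub>M\<^esub> y) = \<zero>\<^bsub>N\<^esub>"
    using mod_hom_minus[OF M N f x y] eq mod_homD(1)[OF f y] by (simp add: N.M.minus_eq N.M.r_neg)
  then have "x \<ominus>\<^bsub>M\<^esub> y = \<zero>\<^bsub>M\<^esub>" using ker x y by (auto simp: hom_ker_def)
  then show "x = y" by (rule M.M.eq_if_diff_zero[OF x y])
qed

lemma copy_in_type:
  fixes Z :: "('a, 'c, 'm) module_scheme" and \<phi> :: "'c \<Rightarrow> 'u"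
  assumes Z: "module R Z" and inj: "inj_on \<phi> (carrier Z)"
  obtains Q :: "('a, 'u) module" and p where "module R Q" and "p \<in> mod_hom R Z Q"
    and "p ` carrier Z = carrier Q" and "inj_on p (carrier Z)"
proof -
  interpret Z: module R Z by fact
  have "submodule {\<zero>\<^bsub>Z\<^esub>} R Z" by (rule Z.submoduleI) auto
  then obtain Q :: "('a, 'u) module" and p where "module R Q" "p \<in> mod_hom R Z Q"
    "p ` carrier Z = carrier Q" "hom_ker Z Q p = {\<zero>\<^bsub>Z\<^esub>}"
    using quotient_in_type[OF Z _ inj] by blast
  then show thesis using that inj_on_if_trivial_kernel[OF Z] by blast
qed

lemma quot_module:
  assumes Z: "module R Z" and B: "submodule B R Z"
  defines "p \<equiv> \<lambda>z. B +>\<^bsub>Z\<^esub> z"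
  shows "module R (quot_module Z B)"
    and "p \<in> mod_hom R Z (quot_module Z B)"
    and "p ` carrier Z = carrier (quot_module Z B)"
    and "hom_ker Z (quot_module Z B) p = B"
proof -
  interpret Z: module R Z by fact
  interpret B: abelian_subgroup B Z
    using B Z.abelian_group_axioms
    by (auto intro!: abelian_subgroupI3 additive_subgroup.intro dest: submodule.axioms(1))
  note I = submoduleD[OF Z B]
  have coset_eq: "p x = p y \<longleftrightarrow> x \<ominus>\<^bsub>Z\<^esub> y \<in> B" if "x \<in> carrier Z" "y \<in> carrier Z" for x y
    using that B.a_rcos_self[of x] B.a_repr_independence'[of x y] B.a_rcos_module[of y x]
    unfolding p_def Z.minus_eq by auto
  show surj: "p ` carrier Z = carrier (quot_module Z B)"
    by (auto simp: quot_module_def p_def A_RCOSETS_def')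
  show hom: "p \<in> mod_hom R Z (quot_module Z B)"
  proof (rule mod_homI)
    show "p x \<in> carrier (quot_module Z B)" if "x \<in> carrier Z" for x using that surj by blast
    show "p (x \<oplus>\<^bsub>Z\<^esub> y) = p x \<oplus>\<^bsub>quot_module Z B\<^esub> p y" if "x \<in> carrier Z" "y \<in> carrier Z" for x y
      using that B.a_rcos_sum by (simp add: quot_module_def p_def)
    fix r x assume r: "r \<in> carrier R" and x: "x \<in> carrier Z"
    have "B +>\<^bsub>Z\<^esub> (r \<odot>\<^bsub>Z\<^esub> w) = p (r \<odot>\<^bsub>Z\<^esub> x)" if "w \<in> p x" for w
    proof -
      obtain b where b: "b \<in> B" "w = b \<oplus>\<^bsub>Z\<^esub> x"
        using \<open>w \<in> p x\<close> by (auto simp: p_def a_r_coset_def')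
      have "r \<odot>\<^bsub>Z\<^esub> w \<ominus>\<^bsub>Z\<^esub> r \<odot>\<^bsub>Z\<^esub> x = r \<odot>\<^bsub>Z\<^esub> b"
        using b r x I(1) by (simp add: Z.minus_eq Z.smult_r_distr Z.a_assoc Z.r_neg)
      then show ?thesis
        using coset_eq[of "r \<odot>\<^bsub>Z\<^esub> w" "r \<odot>\<^bsub>Z\<^esub> x"] b r x I by (simp add: p_def)
    qed
    then have "(\<Union>w\<in>p x. B +>\<^bsub>Z\<^esub> (r \<odot>\<^bsub>Z\<^esub> w)) = (\<Union>w\<in>p x. p (r \<odot>\<^bsub>Z\<^esub> x))"
      by (rule SUP_cong[OF refl])
    also have "\<dots> = p (r \<odot>\<^bsub>Z\<^esub> x)"
      using B.a_rcos_self[OF x] by (auto simp: p_def)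
    finally show "p (r \<odot>\<^bsub>Z\<^esub> x) = r \<odot>\<^bsub>quot_module Z B\<^esub> p x"
      by (simp add: quot_module_def)
  qed
  have zero: "p \<zero>\<^bsub>Z\<^esub> = B"
    unfolding p_def using B.a_rcos_const[OF I(2)] .
  then show "module R (quot_module Z B)"
    using module_hom_image[OF Z hom surj] by (simp add: quot_module_def)
  have "p x = B \<longleftrightarrow> x \<in> B" if "x \<in> carrier Z" for x
    using coset_eq[of x "\<zero>\<^bsub>Z\<^esub>"] zero that by (simp add: Z.diff_zero)
  then have "{x \<in> carrier Z. p x = B} = B" using I(1) by blast
  then show "hom_ker Z (quot_module Z B) p = B" by (simp add: hom_ker_def quot_module_def)
qed

text \<open>For \<open>Z\<close> the cycles of a subcomplex, this turns the inclusion of cycles into an injective map between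
  cohomology modules.\<close>

lemma injective_factorization:
  assumes Z: "module R Z" and Q: "module R Q" and N: "module R N"
    and p: "p \<in> mod_hom R Z Q" and surj: "p ` carrier Z = carrier Q"
    and g: "g \<in> mod_hom R Z N" and ker: "hom_ker Z N g = hom_ker Z Q p"
  shows "\<exists>f \<in> mod_hom R Q N. inj_on f (carrier Q)"
proof -
  interpret Z: module R Z by fact
  interpret Q: module R Q by fact
  interpret N: module R N by fact
  note hp = mod_homD[OF p] and hg = mod_homD[OF g]
  have eq_iff: "p x = p y \<longleftrightarrow> g x = g y" if x: "x \<in> carrier Z" and y: "y \<in> carrier Z" for x y
  proof -
    have "p x = p y \<longleftrightarrow> p x \<ominus>\<^bsub>Q\<^esub> p y = \<zero>\<^bsub>Q\<^esub>"
      using Q.M.eq_if_diff_zero[OF hp(1)[OF x] hp(1)[OF y]] hp(1)[OF y] by (auto simp: Q.M.minus_eq Q.M.r_neg)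
    also have "\<dots> \<longleftrightarrow> x \<ominus>\<^bsub>Z\<^esub> y \<in> hom_ker Z Q p"
      using x y mod_hom_minus[OF Z Q p x y] by (simp add: hom_ker_def)
    also have "\<dots> \<longleftrightarrow> g x \<ominus>\<^bsub>N\<^esub> g y = \<zero>\<^bsub>N\<^esub>"
      unfolding ker[symmetric] using x y mod_hom_minus[OF Z N g x y] by (simp add: hom_ker_def)
    also have "\<dots> \<longleftrightarrow> g x = g y"
      using N.M.eq_if_diff_zero[OF hg(1)[OF x] hg(1)[OF y]] hg(1)[OF y] by (auto simp: N.M.minus_eq N.M.r_neg)
    finally show ?thesis .
  qed
  define f where "f q = g (inv_into (carrier Z) p q)" for q
  have f: "f (p z) = g z" if z: "z \<in> carrier Z" for z
  proof -
    have "p z \<in> p ` carrier Z" using z by blast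
    then have "inv_into (carrier Z) p (p z) \<in> carrier Z" "p (inv_into (carrier Z) p (p z)) = p z"
      by (rule inv_into_into, rule f_inv_into_f)
    then show ?thesis using eq_iff z by (simp add: f_def)
  qed
  have ex: "\<exists>z\<in>carrier Z. q = p z" if "q \<in> carrier Q" for q using that surj by blast
  have "f \<in> mod_hom R Q N"
  proof (rule mod_homI)
    show "f q \<in> carrier N" if "q \<in> carrier Q" for q using ex[OF that] f hg(1) by auto
    show "f (q \<oplus>\<^bsub>Q\<^esub> q') = f q \<oplus>\<^bsub>N\<^esub> f q'" if "q \<in> carrier Q" "q' \<in> carrier Q" for q q'
    proof -
      obtain z z' where "z \<in> carrier Z" "q = p z" "z' \<in> carrier Z" "q' = p z'"
        using ex \<open>q \<in> carrier Q\<close> \<open>q' \<in> carrier Q\<close> by metis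
      then show ?thesis by (simp add: f hg(2) flip: hp(2))
    qed
    show "f (r \<odot>\<^bsub>Q\<^esub> q) = r \<odot>\<^bsub>N\<^esub> f q" if r: "r \<in> carrier R" and "q \<in> carrier Q" for r q
    proof -
      obtain z where "z \<in> carrier Z" "q = p z" using ex \<open>q \<in> carrier Q\<close> by metis
      then show ?thesis using r by (simp add: f hg(3) flip: hp(3))
    qed
  qed
  moreover have "inj_on f (carrier Q)"
    using ex f eq_iff unfolding inj_on_def by metis
  ultimately show ?thesis by blast
qed

lemma submodule_restrict:
  assumes M: "module R M" and Z: "submodule Z R M" and B: "submodule B R M" and sub: "B \<subseteq> Z"
  shows "submodule B R (M\<lparr>carrier := Z\<rparr>)"
proof -
  interpret M: module R M by fact
  interpret Z: module R "M\<lparr>carrier := Z\<rparr>" by (rule submodule.submodule_is_module[OF Z M])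
  note b = submoduleD[OF M B]
  show ?thesis
  proof (rule Z.submoduleI)
    show "\<ominus>\<^bsub>M\<lparr>carrier := Z\<rparr>\<^esub> a \<in> B" if a: "a \<in> B" for a
    proof -
      have "\<ominus>\<^bsub>M\<^esub> a \<oplus>\<^bsub>M\<^esub> a = \<zero>\<^bsub>M\<^esub>" using b(1)[OF a] by (rule M.M.l_neg)
      then have "\<ominus>\<^bsub>M\<lparr>carrier := Z\<rparr>\<^esub> a = \<ominus>\<^bsub>M\<^esub> a"
        using Z.M.minus_equality[of "\<ominus>\<^bsub>M\<^esub> a" a] a b(5)[OF a] sub by auto
      then show ?thesis using b(5)[OF a] by simp
    qed
  qed (use b sub in auto)
qed

section \<open>Modules of finite length\<close>

text \<open>A chain that does not reach \<open>0\<close> or the whole module still bounds the length from below: its ends may be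
  replaced by these two submodules.\<close>

lemma chain_le_module_length:
  assumes M: "module R M" and sub: "\<And>i. i \<le> n \<Longrightarrow> submodule (N i) R M"
    and strict: "\<And>i. i < n \<Longrightarrow> N i \<subset> N (Suc i)"
  shows "enat n \<le> module_length R M"
proof (cases "n = 0")
  case True
  then show ?thesis by (simp add: zero_enat_def[symmetric])
next
  case False
  interpret M: module R M by fact
  define N' where "N' i = (if i = 0 then {\<zero>\<^bsub>M\<^esub>} else if i = n then carrier M else N i)" for i
  have "submodule {\<zero>\<^bsub>M\<^esub>} R M" by (rule M.submoduleI) auto
  then have "submodule (N' i) R M" if "i \<le> n" for i
    using that sub M.carrier_is_submodule by (simp add: N'_def)
  moreover have "N' i \<subset> N' (Suc i)" if i: "i < n" for i
  proof -
    have "N' i \<subseteq> N i" using submoduleD(2)[OF M sub[of i]] i by (auto simp: N'_def)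
    moreover have "N (Suc i) \<subseteq> N' (Suc i)"
      using submoduleD(1)[OF M sub[of "Suc i"]] i by (auto simp: N'_def)
    ultimately show ?thesis using strict[OF i] by blast
  qed
  moreover have "N' 0 = {\<zero>\<^bsub>M\<^esub>}" "N' n = carrier M" using False by (auto simp: N'_def)
  ultimately show ?thesis
    unfolding module_length_def by (intro Sup_upper) blast
qed

lemma submodule_image:
  assumes M: "module R M" and N: "module R N" and f: "f \<in> mod_hom R M N" and H: "submodule H R M"
  shows "submodule (f ` H) R N"
proof -
  interpret M: module R M by fact
  interpret N: module R N by fact
  note H = submoduleD[OF M H] and h = mod_homD[OF f]
  show ?thesis
  proof (rule N.submoduleI)
    show "f ` H \<subseteq> carrier N" using H(1) h(1) by blast
    show "\<zero>\<^bsub>N\<^esub> \<in> f ` H" using mod_hom_zero[OF M N f] H(2) by force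
    show "\<ominus>\<^bsub>N\<^esub> a \<in> f ` H" if a: "a \<in> f ` H" for a
    proof -
      obtain x where x: "x \<in> H" "a = f x" using a by blast
      have "f (\<ominus>\<^bsub>M\<^esub> x) \<oplus>\<^bsub>N\<^esub> f x = \<zero>\<^bsub>N\<^esub>"
        using h(2)[of "\<ominus>\<^bsub>M\<^esub> x" x] x H mod_hom_zero[OF M N f] by (simp add: M.l_neg)
      then have "\<ominus>\<^bsub>N\<^esub> a = f (\<ominus>\<^bsub>M\<^esub> x)" using x H(1,5) h(1) N.minus_equality by simp
      then show ?thesis using H(5) x by blast
    qed
  next
    fix a b assume "a \<in> f ` H" "b \<in> f ` H"
    then obtain x y where "x \<in> H" "a = f x" "y \<in> H" "b = f y" by blast
    then have "a \<oplus>\<^bsub>N\<^esub> b = f (x \<oplus>\<^bsub>M\<^esub> y)" "x \<oplus>\<^bsub>M\<^esub> y \<in> H" using H(1,3) h(2) by auto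
    then show "a \<oplus>\<^bsub>N\<^esub> b \<in> f ` H" by blast
  next
    fix r a assume "r \<in> carrier R" "a \<in> f ` H"
    moreover then obtain x where "x \<in> H" "a = f x" by blast
    ultimately have "r \<odot>\<^bsub>N\<^esub> a = f (r \<odot>\<^bsub>M\<^esub> x)" "r \<odot>\<^bsub>M\<^esub> x \<in> H" using H(1,6) h(3) by auto
    then show "r \<odot>\<^bsub>N\<^esub> a \<in> f ` H" by blast
  qed
qed

lemma finite_length_inj:
  assumes M: "module R M" and f: "f \<in> mod_hom R M N" and inj: "inj_on f (carrier M)"
    and fin: "finite_length R N"
  shows "finite_length R M"
proof -
  have N: "module R N" using fin by (simp add: finite_length_def)
  have "module_length R M \<le> module_length R N"
    unfolding module_length_def[of R M]
  proof (intro Sup_least, clarify)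
    fix n S assume S: "\<forall>i\<le>n. submodule (S i) R M" "\<forall>i<n. S i \<subset> S (Suc i)"
    show "enat n \<le> module_length R N"
    proof (rule chain_le_module_length[OF N])
      show "submodule (f ` S i) R N" if "i \<le> n" for i
        using submodule_image[OF M N f] S that by blast
      show "f ` S i \<subset> f ` S (Suc i)" if "i < n" for i
      proof (rule image_strict_mono)
        have "S (Suc i) \<subseteq> carrier M" using S that submoduleD(1)[OF M] by (metis Suc_leI subsetI)
        then show "inj_on f (S (Suc i))" using inj inj_on_subset by blast
        show "S i \<subset> S (Suc i)" using S that by blast
      qed
    qed
  qed
  then show ?thesis using M fin unfolding finite_length_def by (blast intro: order.strict_trans1)
qed

text \<open>A proper ideal lies in a maximal one, and \<open>\<mm>\<close> is the only maximal ideal.\<close>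

lemma proper_ideal_subset:
  assumes noeth: "noetherian_ring R" and loc: "local_ring R \<mm>"
    and \<aa>: "ideal \<aa> R" "\<aa> \<noteq> carrier R"
  shows "\<aa> \<subseteq> \<mm>"
proof -
  interpret noetherian_ring R by fact
  define P where "P = {I. ideal I R \<and> \<aa> \<subseteq> I \<and> I \<noteq> carrier R}"
  have "\<exists>I\<in>P. \<forall>J\<in>P. I \<subseteq> J \<longrightarrow> J = I"
  proof (rule subset_Zorn)
    fix C assume C: "subset.chain P C"
    show "\<exists>U\<in>P. \<forall>X\<in>C. X \<subseteq> U"
    proof (cases "C = {}")
      case True
      then show ?thesis using \<aa> by (auto simp: P_def)
    next
      case False
      have "\<Union>C \<in> C"
        using C by (intro ideal_chain_is_trivial[OF False]) (auto simp: P_def subset_chain_def)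
      then show ?thesis using C by (auto simp: subset_chain_def)
    qed
  qed
  then obtain I where I: "I \<in> P" and max: "\<And>J. J \<in> P \<Longrightarrow> I \<subseteq> J \<Longrightarrow> J = I" by blast
  have "maximalideal I R"
  proof (rule maximalidealI)
    show "ideal I R" "carrier R \<noteq> I" using I by (auto simp: P_def)
    show "J = I \<or> J = carrier R" if "ideal J R" "I \<subseteq> J" for J
      using max[of J] that I unfolding P_def by blast
  qed
  then show ?thesis using loc I by (auto simp: local_ring_def P_def)
qed

lemma local_ring_one_minus_unit:
  assumes noeth: "noetherian_ring R" and loc: "local_ring R \<mm>"
    and x: "x \<in> \<mm>" and r: "r \<in> carrier R"
  obtains u where "u \<in> carrier R" and "u \<otimes>\<^bsub>R\<^esub> (\<one>\<^bsub>R\<^esub> \<ominus>\<^bsub>R\<^esub> r \<otimes>\<^bsub>R\<^esub> x) = \<one>\<^bsub>R\<^esub>"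
proof -
  interpret cring R using loc by (simp add: local_ring_def)
  have "maximalideal \<mm> R" using loc by (simp add: local_ring_def)
  then interpret m: maximalideal \<mm> R .
  have xc: "x \<in> carrier R" using x m.a_subset by blast
  let ?e = "\<one>\<^bsub>R\<^esub> \<ominus>\<^bsub>R\<^esub> r \<otimes>\<^bsub>R\<^esub> x"
  have e: "?e \<in> carrier R" using r xc by simp
  have "PIdl\<^bsub>R\<^esub> ?e = carrier R"
  proof (rule ccontr)
    assume "PIdl\<^bsub>R\<^esub> ?e \<noteq> carrier R"
    then have "?e \<in> \<mm>"
      using proper_ideal_subset[OF noeth loc cgenideal_ideal[OF e]] cgenideal_self[OF e] by blast
    moreover have rx: "r \<otimes>\<^bsub>R\<^esub> x \<in> \<mm>" using m.I_l_closed[OF x r] .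
    ultimately have "?e \<oplus>\<^bsub>R\<^esub> r \<otimes>\<^bsub>R\<^esub> x \<in> \<mm>" by (rule m.a_closed)
    moreover have "?e \<oplus>\<^bsub>R\<^esub> r \<otimes>\<^bsub>R\<^esub> x = \<one>\<^bsub>R\<^esub>"
      using r xc by (simp add: minus_eq a_assoc l_neg)
    ultimately show False using m.one_imp_carrier m.I_notcarr by simp
  qed
  then have "\<one>\<^bsub>R\<^esub> \<in> PIdl\<^bsub>R\<^esub> ?e" by simp
  then show thesis using that by (auto simp: cgenideal_def)
qed

text \<open>The submodules \<open>R x\<^sup>k h\<close> decrease with \<open>k\<close>, so finite length forces \<open>x\<^sup>k h = r x\<^sup>k\<^sup>+\<^sup>1 h\<close> for some \<open>k\<close> and
  \<open>r\<close>. Then \<open>(1 - r x) x\<^sup>k h = 0\<close>, where \<open>1 - r x\<close> is a unit because \<open>x \<in> \<mm>\<close>. Nakayama's lemma for a cyclic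
  module is thus proved along the way.\<close>

lemma finite_length_imp_torsion:
  assumes noeth: "noetherian_ring R" and loc: "local_ring R \<mm>" and x: "x \<in> \<mm>"
    and fin: "finite_length R H" and h: "h \<in> carrier H"
  shows "\<exists>n. (x [^]\<^bsub>R\<^esub> (n::nat)) \<odot>\<^bsub>H\<^esub> h = \<zero>\<^bsub>H\<^esub>"
proof (rule ccontr)
  assume nz: "\<not> ?thesis"
  have H: "module R H" using fin by (simp add: finite_length_def)
  interpret H: module R H by fact
  have "\<mm> \<subseteq> carrier R"
    using loc by (auto simp: local_ring_def maximalideal_def dest: ideal.Icarr)
  then have xc: "x \<in> carrier R" using x by blast
  define h' where "h' k = (x [^]\<^bsub>R\<^esub> (k::nat)) \<odot>\<^bsub>H\<^esub> h" for k
  have h': "h' k \<in> carrier H" for k using xc h by (simp add: h'_def)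
  have h'_Suc: "h' (Suc k) = x \<odot>\<^bsub>H\<^esub> h' k" for k
    using xc h by (simp add: h'_def H.smult_assoc1[symmetric] H.m_comm)
  define S where "S k = {r \<odot>\<^bsub>H\<^esub> h' k | r. r \<in> carrier R}" for k
  have sub: "submodule (S k) R H" for k
  proof (rule H.submoduleI)
    show "S k \<subseteq> carrier H" using h' by (auto simp: S_def)
    have "\<zero>\<^bsub>H\<^esub> = \<zero>\<^bsub>R\<^esub> \<odot>\<^bsub>H\<^esub> h' k" using h'[of k] by simp
    then show "\<zero>\<^bsub>H\<^esub> \<in> S k" using H.R.zero_closed unfolding S_def by blast
  next
    fix a assume "a \<in> S k"
    then obtain r where "r \<in> carrier R" "a = r \<odot>\<^bsub>H\<^esub> h' k" by (auto simp: S_def)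
    then have "\<ominus>\<^bsub>H\<^esub> a = (\<ominus>\<^bsub>R\<^esub> r) \<odot>\<^bsub>H\<^esub> h' k" "\<ominus>\<^bsub>R\<^esub> r \<in> carrier R"
      using h'[of k] by (simp_all add: H.smult_l_minus)
    then show "\<ominus>\<^bsub>H\<^esub> a \<in> S k" unfolding S_def by blast
  next
    fix a b assume "a \<in> S k" "b \<in> S k"
    then obtain r s where "r \<in> carrier R" "a = r \<odot>\<^bsub>H\<^esub> h' k" "s \<in> carrier R" "b = s \<odot>\<^bsub>H\<^esub> h' k"
      by (auto simp: S_def)
    then have "a \<oplus>\<^bsub>H\<^esub> b = (r \<oplus>\<^bsub>R\<^esub> s) \<odot>\<^bsub>H\<^esub> h' k" "r \<oplus>\<^bsub>R\<^esub> s \<in> carrier R"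
      using h'[of k] by (simp_all add: H.smult_l_distr)
    then show "a \<oplus>\<^bsub>H\<^esub> b \<in> S k" unfolding S_def by blast
  next
    fix r b assume "r \<in> carrier R" "b \<in> S k"
    moreover then obtain s where "s \<in> carrier R" "b = s \<odot>\<^bsub>H\<^esub> h' k"
      by (auto simp: S_def)
    ultimately have "r \<odot>\<^bsub>H\<^esub> b = (r \<otimes>\<^bsub>R\<^esub> s) \<odot>\<^bsub>H\<^esub> h' k" "r \<otimes>\<^bsub>R\<^esub> s \<in> carrier R"
      using h'[of k] by (simp_all add: H.smult_assoc1)
    then show "r \<odot>\<^bsub>H\<^esub> b \<in> S k" unfolding S_def by blast
  qed
  have strict: "S (Suc k) \<subset> S k" for k
  proof
    show "S (Suc k) \<subseteq> S k"
    proof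
      fix a assume "a \<in> S (Suc k)"
      then obtain r where "r \<in> carrier R" "a = r \<odot>\<^bsub>H\<^esub> (x \<odot>\<^bsub>H\<^esub> h' k)"
        by (auto simp: S_def h'_Suc)
      then have "a = (r \<otimes>\<^bsub>R\<^esub> x) \<odot>\<^bsub>H\<^esub> h' k" "r \<otimes>\<^bsub>R\<^esub> x \<in> carrier R"
        using h'[of k] xc by (simp_all add: H.smult_assoc1)
      then show "a \<in> S k" unfolding S_def by blast
    qed
    show "S (Suc k) \<noteq> S k"
    proof
      assume eq: "S (Suc k) = S k"
      have "h' k = \<one>\<^bsub>R\<^esub> \<odot>\<^bsub>H\<^esub> h' k" using h'[of k] by simp
      then have "h' k \<in> S k" using H.R.one_closed unfolding S_def by blast
      then have "h' k \<in> S (Suc k)" by (simp only: eq)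
      then obtain r where r: "r \<in> carrier R" "h' k = r \<odot>\<^bsub>H\<^esub> h' (Suc k)"
        unfolding S_def by blast
      obtain u where u: "u \<in> carrier R" "u \<otimes>\<^bsub>R\<^esub> (\<one>\<^bsub>R\<^esub> \<ominus>\<^bsub>R\<^esub> r \<otimes>\<^bsub>R\<^esub> x) = \<one>\<^bsub>R\<^esub>"
        using local_ring_one_minus_unit[OF noeth loc x r(1)] .
      have "(\<one>\<^bsub>R\<^esub> \<ominus>\<^bsub>R\<^esub> r \<otimes>\<^bsub>R\<^esub> x) \<odot>\<^bsub>H\<^esub> h' k = h' k \<ominus>\<^bsub>H\<^esub> (r \<odot>\<^bsub>H\<^esub> h' (Suc k))"
        using r(1) xc h'[of k]
        by (simp add: H.R.minus_eq H.M.minus_eq H.smult_l_distr H.smult_l_minus H.smult_assoc1 h'_Suc)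
      also have "\<dots> = h' k \<ominus>\<^bsub>H\<^esub> h' k" by (rule arg_cong[OF r(2)[symmetric]])
      also have "\<dots> = \<zero>\<^bsub>H\<^esub>" using h'[of k] by (simp add: H.M.minus_eq H.M.r_neg)
      finally have "u \<odot>\<^bsub>H\<^esub> ((\<one>\<^bsub>R\<^esub> \<ominus>\<^bsub>R\<^esub> r \<otimes>\<^bsub>R\<^esub> x) \<odot>\<^bsub>H\<^esub> h' k) = \<zero>\<^bsub>H\<^esub>" using u by simp
      then have "h' k = \<zero>\<^bsub>H\<^esub>"
        using u r(1) xc h'[of k] by (simp add: H.smult_assoc1[symmetric])
      then show False using nz by (simp add: h'_def)
    qed
  qed
  have "enat n \<le> module_length R H" for n
  proof (rule chain_le_module_length[OF H, where N = "\<lambda>i. S (n - i)"])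
    show "submodule (S (n - i)) R H" for i by (rule sub)
    show "S (n - i) \<subset> S (n - Suc i)" if "i < n" for i
      using strict[of "n - Suc i"] that by (simp add: Suc_diff_Suc)
  qed
  moreover obtain m where "module_length R H = enat m"
    using fin by (auto simp: finite_length_def)
  ultimately have "enat (Suc m) \<le> enat m" by metis
  then show False by simp
qed

section \<open>The size of the universe of resolutions\<close>

lemma lepoll_imp_inj:
  assumes "(UNIV :: 'x set) \<lesssim> (UNIV :: 'y set)"
  obtains f :: "'x \<Rightarrow> 'y" where "inj f"
  using assms by (auto simp: lepoll_def)

lemma finitely_supported_lepoll:
  assumes "infinite (UNIV :: 'u set)"
  shows "(UNIV :: ('u \<Rightarrow>\<^sub>0 rat) set) \<lesssim> (UNIV :: 'u set)"
proof -
  let ?A = "UNIV :: 'u set"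
  have "(UNIV :: ('u \<Rightarrow>\<^sub>0 rat) set)
      \<lesssim> {f::'u\<Rightarrow>rat. f ` ?A \<subseteq> UNIV \<and> {x. f x \<noteq> 0} \<subseteq> ?A \<and> finite {x. f x \<noteq> 0}}"
    unfolding lepoll_def
  proof (intro exI conjI)
    show "inj (Poly_Mapping.lookup :: ('u \<Rightarrow>\<^sub>0 rat) \<Rightarrow> 'u \<Rightarrow> rat)"
      by (rule injI) (rule poly_mapping_eqI, metis)
    have "finite {x. Poly_Mapping.lookup f x \<noteq> 0}" for f :: "'u \<Rightarrow>\<^sub>0 rat"
      by (rule finite_lookup)
    then show "range Poly_Mapping.lookup
        \<subseteq> {f::'u\<Rightarrow>rat. f ` ?A \<subseteq> UNIV \<and> {x. f x \<noteq> 0} \<subseteq> ?A \<and> finite {x. f x \<noteq> 0}}"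
      by blast
  qed
  also have "\<dots> \<lesssim> Fpow (?A \<times> (UNIV::rat set))"
    by (rule lepoll_restricted_funspace)
  also have "\<dots> \<approx> ?A \<times> (UNIV::rat set)"
    by (rule eqpoll_Fpow) (metis assms finite_cartesian_productD1 UNIV_not_empty)
  also have "\<dots> \<lesssim> ?A"
  proof -
    have "infinite (UNIV :: rat set)" by (rule infinite_UNIV_char_0)
    then have "|UNIV :: rat set| \<le>o |?A|"
      using assms infinite_iff_card_of_countable[of "UNIV :: rat set" ?A] by auto
    then have "|?A \<times> (UNIV::rat set)| \<le>o |?A|"
      by (intro card_of_Times_ordLeq_infinite[OF assms]) auto
    then show ?thesis unfolding lepoll_def card_of_ordLeq .
  qed
  finally show ?thesis .
qed

text \<open>A family of subsets of \<open>'x\<close> indexed by \<open>'a\<close> is a subset of \<open>'x \<times> 'x\<close>, and an infinite type is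
  equipollent to its square.\<close>

lemma functions_lepoll_powerset:
  fixes e :: "'a \<Rightarrow> 'x"
  assumes inf: "infinite (UNIV :: 'x set)" and e: "inj e"
  shows "(UNIV :: ('a \<Rightarrow> 'x set) set) \<lesssim> (UNIV :: 'x set set)"
proof -
  have "|(UNIV :: 'x set) \<times> (UNIV :: 'x set)| \<le>o |UNIV :: 'x set|"
    using card_of_Times_same_infinite[OF inf] ordIso_iff_ordLeq by blast
  then obtain \<pi> :: "'x \<times> 'x \<Rightarrow> 'x" where \<pi>: "inj \<pi>"
    unfolding card_of_ordLeq[symmetric] by auto
  define enc :: "('a \<Rightarrow> 'x set) \<Rightarrow> 'x set" where "enc f = \<pi> ` {(e a, y) | a y. y \<in> f a}" for f
  have "inj enc"
  proof (rule injI)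
    fix f g assume "enc f = enc g"
    then have "{(e a, y) | a y. y \<in> f a} = {(e a, y) | a y. y \<in> g a}"
      unfolding enc_def using \<pi> by (simp add: inj_image_eq_iff)
    then have "y \<in> f a \<longleftrightarrow> y \<in> g a" for a y
      using e by (auto simp: set_eq_iff inj_eq dest: injD)
    then show "f = g" by auto
  qed
  then show ?thesis by (auto simp: lepoll_def)
qed

lemma functions_lepoll_mono:
  assumes "(UNIV :: 'x set) \<lesssim> (UNIV :: 'y set)"
  shows "(UNIV :: ('a \<Rightarrow> 'x) set) \<lesssim> (UNIV :: ('a \<Rightarrow> 'y) set)"
proof -
  obtain f :: "'x \<Rightarrow> 'y" where "inj f" using lepoll_imp_inj[OF assms] .
  then have "inj (\<lambda>h. f \<circ> h :: 'a \<Rightarrow> 'y)" by (auto simp: inj_def fun_eq_iff)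
  then show ?thesis by (auto simp: lepoll_def)
qed

text \<open>The embedding \<open>\<phi>\<close> is what allows one to iterate: injective modules that consist of functions
  \<open>R \<rightarrow> \<rat>\<^sup>(\<^sup>N\<^sup>)\<close> with \<open>N\<close> in the universe fit into the universe again.\<close>

lemma res_univ_embeddings:
  obtains \<alpha> :: "'a \<Rightarrow> ('a, 'b) res_univ" and \<beta> :: "'b \<Rightarrow> ('a, 'b) res_univ"
    and \<phi> :: "('a \<Rightarrow> (('a, 'b) res_univ \<Rightarrow>\<^sub>0 rat)) \<Rightarrow> ('a, 'b) res_univ"
  where "inj \<alpha>" and "inj \<beta>" and "inj \<phi>"
proof -
  have inf: "infinite (UNIV :: (nat + 'a + 'b) set)"
    by (simp add: UNIV_Plus_UNIV[symmetric] del: UNIV_Plus_UNIV)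
  then have inf': "infinite (UNIV :: ('a, 'b) res_univ set)"
    by (metis finite_Pow_iff Pow_UNIV)
  have "(UNIV :: ('a \<Rightarrow> (('a, 'b) res_univ \<Rightarrow>\<^sub>0 rat)) set) \<lesssim> (UNIV :: ('a \<Rightarrow> ('a, 'b) res_univ) set)"
    by (rule functions_lepoll_mono[OF finitely_supported_lepoll[OF inf']])
  also have "\<dots> \<lesssim> (UNIV :: ('a, 'b) res_univ set)"
    by (rule functions_lepoll_powerset[OF inf, of "\<lambda>a. Inr (Inl a)"]) (simp add: inj_def)
  finally obtain \<phi> :: "('a \<Rightarrow> (('a, 'b) res_univ \<Rightarrow>\<^sub>0 rat)) \<Rightarrow> ('a, 'b) res_univ" where \<phi>: "inj \<phi>"
    by (rule lepoll_imp_inj)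
  have "inj (\<lambda>a. {Inr (Inl a)} :: ('a, 'b) res_univ)" "inj (\<lambda>b. {Inr (Inr b)} :: ('a, 'b) res_univ)"
    by (auto simp: inj_def)
  then show thesis using that \<phi> by blast
qed

section \<open>Injective modules coinduced from divisible groups\<close>

text \<open>The divisible group \<open>V / K\<close>, where \<open>K\<close> is a subgroup of \<open>V\<close> and \<open>sc q v\<close> is the multiple of \<open>v\<close> by a rational
  number, so that \<open>sc (1 / n) v\<close> is an \<open>n\<close>-th part of \<open>v\<close>. Working with \<open>V\<close> modulo \<open>K\<close> keeps the elements of the
  quotient in the type of \<open>V\<close>.\<close>

locale divisible_quotient =
  fixes K :: "'v::ab_group_add set" and sc :: "rat \<Rightarrow> 'v \<Rightarrow> 'v"
  assumes K_zero: "0 \<in> K" and K_add: "\<lbrakk>u \<in> K; v \<in> K\<rbrakk> \<Longrightarrow> u + v \<in> K" and K_uminus: "u \<in> K \<Longrightarrow> - u \<in> K"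
    and sc_add: "sc (p + q) v = sc p v + sc q v" and sc_mult: "sc (p * q) v = sc p (sc q v)"
    and sc_one: "sc 1 v = v"
begin

lemma K_diff: "\<lbrakk>u \<in> K; v \<in> K\<rbrakk> \<Longrightarrow> u - v \<in> K"
  using K_add[of u "- v"] K_uminus[of v] by simp

lemma sc_zero: "sc 0 v = 0"
  using sc_add[of 0 0 v] by simp

lemma sc_minus: "sc (- q) v = - sc q v"
  using sc_add[of q "- q" v] sc_zero by (simp add: eq_neg_iff_add_eq_0 add.commute)

text \<open>The graph of an additive map from a subgroup of \<open>B\<close> to \<open>V / K\<close>, pulled back to \<open>B \<times> V\<close>. No
  representatives modulo \<open>K\<close> are chosen, so that such a graph is just a subgroup with prescribed fibre over \<open>0\<close>,
  and unions of chains are unproblematic.\<close>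

definition additive_relation :: "('b, 'm) ring_scheme \<Rightarrow> ('b \<times> 'v) set \<Rightarrow> bool" where
  "additive_relation B G \<longleftrightarrow> G \<subseteq> carrier B \<times> UNIV \<and>
     (\<forall>b v b' v'. (b, v) \<in> G \<longrightarrow> (b', v') \<in> G \<longrightarrow> (b \<oplus>\<^bsub>B\<^esub> b', v + v') \<in> G) \<and>
     (\<forall>b v. (b, v) \<in> G \<longrightarrow> (\<ominus>\<^bsub>B\<^esub> b, - v) \<in> G) \<and>
     (\<forall>v. (\<zero>\<^bsub>B\<^esub>, v) \<in> G \<longleftrightarrow> v \<in> K)"

lemma additive_relationD:
  assumes "additive_relation B G"
  shows "(b, v) \<in> G \<Longrightarrow> b \<in> carrier B"
    and "\<lbrakk>(b, v) \<in> G; (b', v') \<in> G\<rbrakk> \<Longrightarrow> (b \<oplus>\<^bsub>B\<^esub> b', v + v') \<in> G"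
    and "(b, v) \<in> G \<Longrightarrow> (\<ominus>\<^bsub>B\<^esub> b, - v) \<in> G"
    and "(\<zero>\<^bsub>B\<^esub>, v) \<in> G \<longleftrightarrow> v \<in> K"
  using assms by (auto simp: additive_relation_def)

lemma additive_relation_int_multiple:
  assumes B: "abelian_group B" and G: "additive_relation B G" and bv: "(b, v) \<in> G"
  shows "(b [^]\<^bsub>add_monoid B\<^esub> (n::int), sc (of_int n) v) \<in> G"
proof -
  interpret B: abelian_group B by fact
  have Bg: "group (add_monoid B)" by (rule B.a_group)
  note G = additive_relationD[OF G]
  have nat: "(b [^]\<^bsub>add_monoid B\<^esub> (n::nat), sc (of_nat n) v) \<in> G" for n
  proof (induction n)
    case 0
    then show ?case using G(4) K_zero by (simp add: sc_zero)
  next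
    case (Suc n)
    then show ?case using G(2)[OF Suc bv] by (simp add: sc_add sc_one add.commute)
  qed
  show ?thesis
  proof (cases n rule: int_cases2)
    case (nonneg m)
    then show ?thesis using nat[of m] by (simp add: int_pow_int)
  next
    case (nonpos m)
    then show ?thesis using G(3)[OF nat[of m]] G(1)[OF bv]
      by (simp add: sc_minus group.int_pow_neg[OF Bg] int_pow_int a_inv_def)
  qed
qed

text \<open>To extend an additive map to one more element \<open>b\<close>, let \<open>n\<close> be the least positive integer such that \<open>n b\<close> is
  in the domain. The value at \<open>b\<close> has to be an \<open>n\<close>-th part of the value at \<open>n b\<close>, and
  any such part will do. If there is no such \<open>n\<close>, the value is arbitrary.\<close>

lemma additive_relation_extend:
  assumes B: "abelian_group B" and G: "additive_relation B G" and b: "b \<in> carrier B"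
  obtains G' w where "additive_relation B G'" and "G \<subseteq> G'" and "(b, w) \<in> G'"
proof -
  interpret B: abelian_group B by fact
  have Bg: "group (add_monoid B)" by (rule B.a_group)
  note g = additive_relationD[OF G] and gi = additive_relation_int_multiple[OF B G]
  define bb where "bb n = b [^]\<^bsub>add_monoid B\<^esub> (n::int)" for n
  have bb_c: "bb n \<in> carrier B" for n
    using group.int_pow_closed[OF Bg, of b n] b by (simp add: bb_def)
  have bb_add: "bb (n + m) = bb n \<oplus>\<^bsub>B\<^esub> bb m" for n m
    using group.int_pow_mult[OF Bg, of b n m] b by (simp add: bb_def)
  have bb_0: "bb 0 = \<zero>\<^bsub>B\<^esub>" by (simp add: bb_def)
  have bb_1: "bb 1 = b" using group.int_pow_1[OF Bg, of b] b by (simp add: bb_def)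
  have bb_minus: "bb (- n) = \<ominus>\<^bsub>B\<^esub> bb n" for n
    using bb_add[of "- n" n] bb_0 bb_c B.minus_equality[of "bb (- n)" "bb n"] by simp
  have bb_mult: "bb (n * m) = bb n [^]\<^bsub>add_monoid B\<^esub> m" for n m
    using group.int_pow_pow[OF Bg, of b n m] b by (simp add: bb_def)
  \<comment> \<open>The value \<open>w\<close> at \<open>b\<close> has to be compatible with the values at the multiples of \<open>b\<close> in the domain.\<close>
  obtain w where w: "\<And>n v. (bb n, v) \<in> G \<Longrightarrow> v - sc (of_int n) w \<in> K"
  proof (cases "\<exists>n>0. \<exists>v. (bb (int n), v) \<in> G")
    case False
    have "n = 0" if "(bb n, v) \<in> G" for n v
    proof (rule ccontr)
      assume "n \<noteq> 0"
      then consider "n > 0" | "- n > 0" by linarith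
      then show False
      proof cases
        case 1
        then show False using False that by (metis pos_int_cases)
      next
        case 2
        have "(bb (- n), - v) \<in> G" using g(3)[OF that] by (simp add: bb_minus)
        then show False using 2 False by (metis pos_int_cases)
      qed
    qed
    then show thesis using that[of 0] g(4) bb_0 by (metis diff_zero of_int_0 sc_zero)
  next
    case True
    define n0 where "n0 = (LEAST n. n > 0 \<and> (\<exists>v. (bb (int n), v) \<in> G))"
    have n0: "n0 > 0" "\<exists>v. (bb (int n0), v) \<in> G"
      using LeastI_ex[of "\<lambda>n. n > 0 \<and> (\<exists>v. (bb (int n), v) \<in> G)"] True by (auto simp: n0_def)
    have least: "n0 \<le> n" if "n > 0" "(bb (int n), v) \<in> G" for n v
      unfolding n0_def by (rule Least_le) (use that in blast)
    obtain u where u: "(bb (int n0), u) \<in> G" using n0 by blast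
    show thesis
    proof (rule that[of "sc (1 / of_nat n0) u"])
      fix n v assume nv: "(bb n, v) \<in> G"
      define q where "q = n div int n0"
      have qu: "(bb (int n0 * q), sc (of_int q) u) \<in> G" using gi[OF u, of q] by (simp add: bb_mult)
      then have "(\<ominus>\<^bsub>B\<^esub> bb (int n0 * q), - sc (of_int q) u) \<in> G" by (rule g(3))
      then have "(bb n \<oplus>\<^bsub>B\<^esub> bb (- (int n0 * q)), v + - sc (of_int q) u) \<in> G"
        unfolding bb_minus by (rule g(2)[OF nv])
      moreover have "bb n \<oplus>\<^bsub>B\<^esub> bb (- (int n0 * q)) = bb (n mod int n0)"
        by (simp add: bb_add[symmetric] q_def minus_mult_div_eq_mod)
      ultimately have r: "(bb (n mod int n0), v - sc (of_int q) u) \<in> G" by simp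
      have "n mod int n0 = 0"
      proof (rule ccontr)
        assume "n mod int n0 \<noteq> 0"
        then have "n mod int n0 > 0" using n0 by (simp add: order.not_eq_order_implies_strict)
        then obtain k where k: "n mod int n0 = int k" "k > 0" by (metis pos_int_cases)
        have "k < n0" using k n0 by (metis of_nat_0_less_iff of_nat_less_iff pos_mod_bound)
        then show False using least[OF k(2), of "v - sc (of_int q) u"] r k by simp
      qed
      then have n: "n = q * int n0" and "v - sc (of_int q) u \<in> K"
        using r g(4) bb_0 by (auto simp: q_def)
      moreover have "of_int n * (1 / of_nat n0) = (of_int q :: rat)" using n n0 by simp
      then have "sc (of_int n) (sc (1 / of_nat n0) u) = sc (of_int q) u" by (simp flip: sc_mult)
      ultimately show "v - sc (of_int n) (sc (1 / of_nat n0) u) \<in> K" by simp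
    qed
  qed
  define G' where "G' = {(x \<oplus>\<^bsub>B\<^esub> bb n, v + sc (of_int n) w) | x v n. (x, v) \<in> G}"
  have "additive_relation B G'"
    unfolding additive_relation_def
  proof (intro conjI allI impI)
    show "G' \<subseteq> carrier B \<times> UNIV" using g(1) bb_c by (auto simp: G'_def)
  next
    fix c v c' v' assume "(c, v) \<in> G'" "(c', v') \<in> G'"
    then obtain x u n x' u' n' where *: "(x, u) \<in> G" "c = x \<oplus>\<^bsub>B\<^esub> bb n" "v = u + sc (of_int n) w"
      "(x', u') \<in> G" "c' = x' \<oplus>\<^bsub>B\<^esub> bb n'" "v' = u' + sc (of_int n') w" unfolding G'_def by blast
    have "c \<oplus>\<^bsub>B\<^esub> c' = (x \<oplus>\<^bsub>B\<^esub> x') \<oplus>\<^bsub>B\<^esub> bb (n + n')"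
      using * g(1)[OF *(1)] g(1)[OF *(4)] bb_c by (simp add: bb_add B.a_ac)
    moreover have "v + v' = (u + u') + sc (of_int (n + n')) w" using * by (simp add: sc_add)
    ultimately show "(c \<oplus>\<^bsub>B\<^esub> c', v + v') \<in> G'" unfolding G'_def using g(2)[OF *(1,4)] by blast
  next
    fix c v assume "(c, v) \<in> G'"
    then obtain x u n where *: "(x, u) \<in> G" "c = x \<oplus>\<^bsub>B\<^esub> bb n" "v = u + sc (of_int n) w"
      unfolding G'_def by blast
    have "\<ominus>\<^bsub>B\<^esub> c = \<ominus>\<^bsub>B\<^esub> x \<oplus>\<^bsub>B\<^esub> bb (- n)"
      using * g(1)[OF *(1)] bb_c by (simp add: bb_minus B.minus_add)
    moreover have "- v = - u + sc (of_int (- n)) w" using * by (simp add: sc_minus)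
    ultimately show "(\<ominus>\<^bsub>B\<^esub> c, - v) \<in> G'" unfolding G'_def using g(3)[OF *(1)] by blast
  next
    fix v
    show "(\<zero>\<^bsub>B\<^esub>, v) \<in> G' \<longleftrightarrow> v \<in> K"
    proof
      assume "(\<zero>\<^bsub>B\<^esub>, v) \<in> G'"
      then obtain x u n where *: "(x, u) \<in> G" "\<zero>\<^bsub>B\<^esub> = x \<oplus>\<^bsub>B\<^esub> bb n" "v = u + sc (of_int n) w"
        unfolding G'_def by blast
      have "x = bb (- n)"
        using B.minus_equality[of x "bb n"] *(2) g(1)[OF *(1)] bb_c by (simp add: bb_minus)
      then show "v \<in> K" using w[of "- n" u] *(1,3) by (simp add: sc_minus)
    next
      assume "v \<in> K"
      then have "(\<zero>\<^bsub>B\<^esub>, v) \<in> G" using g(4) by simp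
      moreover have "\<zero>\<^bsub>B\<^esub> = \<zero>\<^bsub>B\<^esub> \<oplus>\<^bsub>B\<^esub> bb 0" "v = v + sc (of_int 0) w" by (auto simp: bb_0 sc_zero)
      ultimately show "(\<zero>\<^bsub>B\<^esub>, v) \<in> G'" unfolding G'_def by blast
    qed
  qed
  moreover have "G \<subseteq> G'"
  proof
    fix y assume y: "y \<in> G"
    obtain x v where xv: "y = (x, v)" by (cases y)
    have "x = x \<oplus>\<^bsub>B\<^esub> bb 0" "v = v + sc (of_int 0) w" using y xv g(1) by (auto simp: bb_0 sc_zero)
    then show "y \<in> G'" using y xv unfolding G'_def by blast
  qed
  moreover have "(b, w) \<in> G'"
  proof -
    have "(\<zero>\<^bsub>B\<^esub>, 0) \<in> G" using g(4) K_zero by simp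
    moreover have "b = \<zero>\<^bsub>B\<^esub> \<oplus>\<^bsub>B\<^esub> bb 1" "w = 0 + sc (of_int 1) w" using b by (auto simp: bb_1 sc_one)
    ultimately show ?thesis unfolding G'_def by blast
  qed
  ultimately show thesis by (rule that)
qed

text \<open>Divisible groups are injective: Zorn's lemma gives a maximal extension, and the preceding lemma
  shows that its domain is all of \<open>B\<close>.\<close>

lemma extend_additive_mod:
  assumes B: "abelian_group B" and A: "A \<subseteq> carrier B" "\<zero>\<^bsub>B\<^esub> \<in> A"
      "\<And>a b. \<lbrakk>a \<in> A; b \<in> A\<rbrakk> \<Longrightarrow> a \<oplus>\<^bsub>B\<^esub> b \<in> A" "\<And>a. a \<in> A \<Longrightarrow> \<ominus>\<^bsub>B\<^esub> a \<in> A"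
    and l: "\<And>a b. \<lbrakk>a \<in> A; b \<in> A\<rbrakk> \<Longrightarrow> l (a \<oplus>\<^bsub>B\<^esub> b) - (l a + l b) \<in> K"
  obtains L where "\<And>a. a \<in> A \<Longrightarrow> L a - l a \<in> K"
    and "\<And>a b. \<lbrakk>a \<in> carrier B; b \<in> carrier B\<rbrakk> \<Longrightarrow> L (a \<oplus>\<^bsub>B\<^esub> b) - (L a + L b) \<in> K"
proof -
  interpret B: abelian_group B by fact
  define G0 where "G0 = {(a, v). a \<in> A \<and> v - l a \<in> K}"
  have l0: "l \<zero>\<^bsub>B\<^esub> \<in> K" using l[of "\<zero>\<^bsub>B\<^esub>" "\<zero>\<^bsub>B\<^esub>"] A(2) K_uminus by fastforce
  have lm: "- l a - l (\<ominus>\<^bsub>B\<^esub> a) \<in> K" if "a \<in> A" for a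
  proof -
    have "a \<oplus>\<^bsub>B\<^esub> \<ominus>\<^bsub>B\<^esub> a = \<zero>\<^bsub>B\<^esub>" using that A(1) by (auto simp: B.r_neg)
    then have "l \<zero>\<^bsub>B\<^esub> - (l a + l (\<ominus>\<^bsub>B\<^esub> a)) \<in> K" using l[OF that A(4)[OF that]] by simp
    then show ?thesis using K_diff[OF _ l0] by fastforce
  qed
  have G0: "additive_relation B G0"
    unfolding additive_relation_def
  proof (intro conjI allI impI)
    show "G0 \<subseteq> carrier B \<times> UNIV" using A(1) by (auto simp: G0_def)
    fix a v b w assume "(a, v) \<in> G0" "(b, w) \<in> G0"
    then have *: "a \<in> A" "b \<in> A" "v - l a \<in> K" "w - l b \<in> K" by (auto simp: G0_def)
    have "(v + w) - l (a \<oplus>\<^bsub>B\<^esub> b) = (v - l a) + (w - l b) - (l (a \<oplus>\<^bsub>B\<^esub> b) - (l a + l b))" by simp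
    then have "(v + w) - l (a \<oplus>\<^bsub>B\<^esub> b) \<in> K" using K_diff[OF K_add[OF *(3,4)] l[OF *(1,2)]] by simp
    then show "(a \<oplus>\<^bsub>B\<^esub> b, v + w) \<in> G0" using * A(3) by (simp add: G0_def)
  next
    fix a v assume "(a, v) \<in> G0"
    then have *: "a \<in> A" "v - l a \<in> K" by (auto simp: G0_def)
    have "- v - l (\<ominus>\<^bsub>B\<^esub> a) = (- l a - l (\<ominus>\<^bsub>B\<^esub> a)) - (v - l a)" by simp
    then have "- v - l (\<ominus>\<^bsub>B\<^esub> a) \<in> K" using K_diff[OF lm[OF *(1)] *(2)] by (simp only:)
    then show "(\<ominus>\<^bsub>B\<^esub> a, - v) \<in> G0" using * A(4) by (simp add: G0_def)
  next
    fix v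
    show "(\<zero>\<^bsub>B\<^esub>, v) \<in> G0 \<longleftrightarrow> v \<in> K"
      using A(2) K_diff[OF _ l0, of v] K_add[OF _ l0, of "v - l \<zero>\<^bsub>B\<^esub>"] by (auto simp: G0_def)
  qed
  define P where "P = {G. additive_relation B G \<and> G0 \<subseteq> G}"
  have "\<exists>M\<in>P. \<forall>X\<in>P. M \<subseteq> X \<longrightarrow> X = M"
  proof (rule subset_Zorn_nonempty)
    show "P \<noteq> {}" using G0 by (auto simp: P_def)
    fix C assume ne: "C \<noteq> {}" and C: "subset.chain P C"
    have CP: "additive_relation B G" "G0 \<subseteq> G" if "G \<in> C" for G
      using C that by (auto simp: subset_chain_def P_def)
    have two: "\<exists>G\<in>C. x \<in> G \<and> y \<in> G" if "x \<in> \<Union>C" "y \<in> \<Union>C" for x y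
      using that C unfolding subset_chain_def by blast
    have "additive_relation B (\<Union>C)"
      unfolding additive_relation_def
    proof (intro conjI allI impI)
      show "\<Union>C \<subseteq> carrier B \<times> UNIV" using additive_relationD(1)[OF CP(1)] by auto
      show "(b \<oplus>\<^bsub>B\<^esub> b', v + v') \<in> \<Union>C" if "(b, v) \<in> \<Union>C" "(b', v') \<in> \<Union>C" for b v b' v'
        using two[OF that] additive_relationD(2)[OF CP(1)] by blast
      show "(\<ominus>\<^bsub>B\<^esub> b, - v) \<in> \<Union>C" if "(b, v) \<in> \<Union>C" for b v
        using that additive_relationD(3)[OF CP(1)] by blast
      show "(\<zero>\<^bsub>B\<^esub>, v) \<in> \<Union>C \<longleftrightarrow> v \<in> K" for v
        using ne additive_relationD(4)[OF CP(1)] by blast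
    qed
    moreover have "G0 \<subseteq> \<Union>C" using ne CP(2) by blast
    ultimately show "\<Union>C \<in> P" by (simp add: P_def)
  qed
  then obtain G where G: "additive_relation B G" "G0 \<subseteq> G"
    and max: "\<And>X. \<lbrakk>additive_relation B X; G0 \<subseteq> X; G \<subseteq> X\<rbrakk> \<Longrightarrow> X = G"
    by (auto simp: P_def)
  note g = additive_relationD[OF G(1)]
  have "\<exists>v. (b, v) \<in> G" if "b \<in> carrier B" for b
  proof -
    obtain G' w where "additive_relation B G'" "G \<subseteq> G'" "(b, w) \<in> G'"
      using additive_relation_extend[OF B G(1) \<open>b \<in> carrier B\<close>] .
    then show ?thesis using max[of G'] G(2) by blast
  qed
  then obtain L where L: "\<And>b. b \<in> carrier B \<Longrightarrow> (b, L b) \<in> G" by metis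
  have diff: "v - w \<in> K" if "(b, v) \<in> G" "(b, w) \<in> G" for b v w
  proof -
    have "(b \<oplus>\<^bsub>B\<^esub> \<ominus>\<^bsub>B\<^esub> b, v + - w) \<in> G" by (rule g(2)[OF that(1) g(3)[OF that(2)]])
    then show ?thesis using g(1)[OF that(1)] g(4)[of "v - w"] by (simp add: B.r_neg)
  qed
  show thesis
  proof (rule that)
    show "L a - l a \<in> K" if "a \<in> A" for a
    proof (rule diff)
      show "(a, L a) \<in> G" using L A(1) that by blast
      show "(a, l a) \<in> G" using G(2) that K_zero by (auto simp: G0_def)
    qed
    show "L (a \<oplus>\<^bsub>B\<^esub> b) - (L a + L b) \<in> K" if "a \<in> carrier B" "b \<in> carrier B" for a b
      by (rule diff[OF L g(2)[OF L L]]) (use that in auto)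
  qed
qed

definition rep :: "'v \<Rightarrow> 'v" where
  "rep v = (SOME w. w - v \<in> K)"

lemma rep_diff: "rep v - v \<in> K"
  unfolding rep_def by (rule someI[of _ v]) (simp add: K_zero)

lemma rep_eq_iff: "rep u = rep v \<longleftrightarrow> u - v \<in> K"
proof
  assume "rep u = rep v"
  then have "u - v = (rep v - v) - (rep u - u)" by simp
  then show "u - v \<in> K" using K_diff rep_diff by metis
next
  assume uv: "u - v \<in> K"
  have "w - u \<in> K \<longleftrightarrow> w - v \<in> K" for w
    using K_add[OF _ uv, of "w - u"] K_diff[OF _ uv, of "w - v"] by auto
  then show "rep u = rep v" by (simp add: rep_def)
qed

lemma rep_rep [simp]: "rep (rep v) = rep v"
  by (simp add: rep_eq_iff rep_diff)

lemma rep_add_left [simp]: "rep (rep u + v) = rep (u + v)"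
  by (simp add: rep_eq_iff rep_diff)

lemma rep_add_right [simp]: "rep (u + rep v) = rep (u + v)"
  by (simp add: rep_eq_iff rep_diff)

lemma rep_add_right2 [simp]: "rep (u + (v + rep w)) = rep (u + (v + w))"
  using rep_add_right[of "u + v" w] by (simp add: add.assoc)

lemma rep_uminus [simp]: "rep (- rep v) = rep (- v)"
proof -
  have "- (rep v - v) \<in> K" by (rule K_uminus[OF rep_diff])
  then show ?thesis by (simp add: rep_eq_iff)
qed

lemma rep_diff_left [simp]: "rep (rep u - v) = rep (u - v)"
  using rep_add_left[of u "- v"] by simp

lemma rep_diff_right [simp]: "rep (u - rep v) = rep (u - v)"
proof -
  have "rep (u + rep (- rep v)) = rep (u + rep (- v))" by simp
  then show ?thesis unfolding rep_add_right by simp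
qed

text \<open>The module \<open>Hom\<^sub>\<int>(R, V / K)\<close>, with the values of homomorphisms given by their representatives in \<open>V\<close>.
  The ring acts through the argument. Outside of \<open>R\<close> the functions are \<open>0\<close>, so that equal homomorphisms are equal
  functions.\<close>

definition coinduced :: "('a, 'r) ring_scheme \<Rightarrow> ('a, 'a \<Rightarrow> 'v) module" where
  "coinduced R = \<lparr>carrier = {h. (\<forall>r. r \<notin> carrier R \<longrightarrow> h r = 0) \<and> (\<forall>r\<in>carrier R. rep (h r) = h r) \<and>
      (\<forall>r\<in>carrier R. \<forall>s\<in>carrier R. h (r \<oplus>\<^bsub>R\<^esub> s) = rep (h r + h s))},
     monoid.mult = undefined, one = undefined,
     ring.zero = (\<lambda>r. if r \<in> carrier R then rep 0 else 0),
     add = (\<lambda>f g r. if r \<in> carrier R then rep (f r + g r) else 0),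
     smult = (\<lambda>c h r. if r \<in> carrier R then h (r \<otimes>\<^bsub>R\<^esub> c) else 0)\<rparr>"

lemma module_coinduced:
  assumes "cring R"
  shows "module R (coinduced R)"
proof -
  interpret cring R by fact
  show ?thesis
  proof (rule moduleI)
    show "abelian_group (coinduced R)"
    proof (rule abelian_groupI)
      show "\<exists>g\<in>carrier (coinduced R). g \<oplus>\<^bsub>coinduced R\<^esub> h = \<zero>\<^bsub>coinduced R\<^esub>"
        if "h \<in> carrier (coinduced R)" for h
      proof (rule bexI)
        show "(\<lambda>r. if r \<in> carrier R then rep (- h r) else 0) \<in> carrier (coinduced R)"
          using that by (auto simp: coinduced_def)
      qed (use that in \<open>auto simp: coinduced_def fun_eq_iff\<close>)
    qed (auto simp: coinduced_def fun_eq_iff ac_simps)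
  qed (auto simp: coinduced_def fun_eq_iff l_distr r_distr m_assoc is_cring)
qed

text \<open>Coinduction is right adjoint to the restriction of scalars to \<open>\<int>\<close>: a module homomorphism \<open>g\<close> into
  \<open>Hom\<^sub>\<int>(R, V / K)\<close> is determined by the additive map \<open>a \<mapsto> g a 1\<close>, and an additive extension \<open>L\<close> of that map
  gives the module homomorphism \<open>b \<mapsto> (r \<mapsto> L (r b))\<close>.\<close>

lemma coinduced_injective:
  assumes A: "module R A" and B: "module R B" and f: "f \<in> mod_hom R A B" "inj_on f (carrier A)"
    and g: "g \<in> mod_hom R A (coinduced R)"
  shows "\<exists>h \<in> mod_hom R B (coinduced R). \<forall>x\<in>carrier A. h (f x) = g x"
proof -
  interpret A: module R A by fact
  interpret B: module R B by fact
  note hf = mod_homD[OF f(1)] and hg = mod_homD[OF g]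
  \<comment> \<open>The additive map on the image of \<open>f\<close> that corresponds to \<open>g\<close>.\<close>
  define l where "l b = g (inv_into (carrier A) f b) \<one>\<^bsub>R\<^esub>" for b
  have l: "l (f a) = g a \<one>\<^bsub>R\<^esub>" if "a \<in> carrier A" for a
    using that f(2) by (simp add: l_def)
  have fA: "submodule (f ` carrier A) R B"
    by (rule submodule_image[OF A B f(1) A.carrier_is_submodule])
  note s = submoduleD[OF B fA]
  have l_add: "l (a \<oplus>\<^bsub>B\<^esub> b) - (l a + l b) \<in> K" if ab: "a \<in> f ` carrier A" "b \<in> f ` carrier A" for a b
  proof -
    obtain x y where xy: "x \<in> carrier A" "a = f x" "y \<in> carrier A" "b = f y" using ab by blast
    have "l (a \<oplus>\<^bsub>B\<^esub> b) = rep (l a + l b)"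
      using xy l[of "x \<oplus>\<^bsub>A\<^esub> y"] hf(2)[of x y] hg(2)[of x y] by (simp add: l coinduced_def)
    then show ?thesis by (simp add: rep_diff)
  qed
  have "f ` carrier A \<subseteq> carrier B" using s(1) by blast
  then obtain L where L1: "\<And>b. b \<in> f ` carrier A \<Longrightarrow> L b - l b \<in> K"
    and L2: "\<And>a b. \<lbrakk>a \<in> carrier B; b \<in> carrier B\<rbrakk> \<Longrightarrow> L (a \<oplus>\<^bsub>B\<^esub> b) - (L a + L b) \<in> K"
    using extend_additive_mod[of B "f ` carrier A" l, OF B.M.abelian_group_axioms _ s(2,3,5) l_add]
    by blast
  have repL: "rep (L (a \<oplus>\<^bsub>B\<^esub> b)) = rep (L a + L b)" if "a \<in> carrier B" "b \<in> carrier B" for a b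
    using L2[OF that] by (simp add: rep_eq_iff)
  define h where "h b = (\<lambda>r. if r \<in> carrier R then rep (L (r \<odot>\<^bsub>B\<^esub> b)) else 0)" for b
  have "h \<in> mod_hom R B (coinduced R)"
    by (rule mod_homI)
      (auto simp: h_def coinduced_def fun_eq_iff repL B.smult_l_distr B.smult_r_distr B.smult_assoc1)
  moreover have "h (f a) = g a" if a: "a \<in> carrier A" for a
  proof
    fix r
    have ga: "g a \<in> carrier (coinduced R)" using hg(1) a by blast
    show "h (f a) r = g a r"
    proof (cases "r \<in> carrier R")
      case True
      have "h (f a) r = rep (L (f (r \<odot>\<^bsub>A\<^esub> a)))" using True a by (simp add: h_def hf(3))
      also have "\<dots> = rep (l (f (r \<odot>\<^bsub>A\<^esub> a)))" using L1[of "f (r \<odot>\<^bsub>A\<^esub> a)"] True a by (simp add: rep_eq_iff)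
      also have "\<dots> = rep (g a (\<one>\<^bsub>R\<^esub> \<otimes>\<^bsub>R\<^esub> r))" using l[of "r \<odot>\<^bsub>A\<^esub> a"] True a by (simp add: hg(3) coinduced_def)
      also have "\<dots> = g a r" using ga True by (simp add: coinduced_def)
      finally show ?thesis .
    next
      case False
      then show ?thesis using ga by (simp add: h_def coinduced_def)
    qed
  qed
  ultimately show ?thesis by blast
qed

end

text \<open>Let \<open>K\<close> be the kernel of the evaluation \<open>\<int>\<^sup>(\<^sup>N\<^sup>) \<rightarrow> N\<close>. Then \<open>N = \<int>\<^sup>(\<^sup>N\<^sup>) / K\<close> is a subgroup of the
  divisible group \<open>\<rat>\<^sup>(\<^sup>N\<^sup>) / K\<close>.\<close>

lemma divisible_group_containing_module:
  fixes N :: "('a, 'u, 'm) module_scheme"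
  assumes N: "module R N"
  obtains K :: "('u \<Rightarrow>\<^sub>0 rat) set" where "divisible_quotient K (\<lambda>q. Poly_Mapping.map ((*) q))"
    and "\<And>x y. \<lbrakk>x \<in> carrier N; y \<in> carrier N\<rbrakk> \<Longrightarrow> Poly_Mapping.single (x \<oplus>\<^bsub>N\<^esub> y) 1
        - (Poly_Mapping.single x 1 + Poly_Mapping.single y 1) \<in> K"
    and "\<And>x y. \<lbrakk>x \<in> carrier N; y \<in> carrier N; Poly_Mapping.single x 1 - Poly_Mapping.single y 1 \<in> K\<rbrakk>
        \<Longrightarrow> x = y"
proof -
  interpret N: module R N by fact
  let ?F = "free_Abelian_group (carrier N)"
  obtain ev where ev: "ev \<in> hom ?F (add_monoid N)" and ev_of: "\<And>x. x \<in> carrier N \<Longrightarrow> ev (frag_of x) = x"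
    using comm_group.free_Abelian_group_universal[OF N.a_comm_group, of "\<lambda>x. x" "carrier N"] by auto
  have ev_add: "ev (y + z) = ev y \<oplus>\<^bsub>N\<^esub> ev z"
    if "Poly_Mapping.keys y \<subseteq> carrier N" "Poly_Mapping.keys z \<subseteq> carrier N" for y z
    using hom_mult[OF ev, of y z] that by simp
  have ev_c: "ev y \<in> carrier N" if "Poly_Mapping.keys y \<subseteq> carrier N" for y
    using hom_in_carrier[OF ev, of y] that by simp
  \<comment> \<open>The difference of two integral combinations \<open>y\<close> and \<open>z\<close> lies in the kernel if and only if \<open>ev y = ev z\<close>.\<close>
  define K :: "('u \<Rightarrow>\<^sub>0 rat) set" where
    "K = {v. \<exists>y z. Poly_Mapping.keys y \<subseteq> carrier N \<and> Poly_Mapping.keys z \<subseteq> carrier N \<and> ev y = ev z \<and>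
       (\<forall>x. Poly_Mapping.lookup v x = of_int (Poly_Mapping.lookup y x - Poly_Mapping.lookup z x))}"
  have keys_add: "Poly_Mapping.keys (y + z) \<subseteq> carrier N"
    if "Poly_Mapping.keys y \<subseteq> carrier N" "Poly_Mapping.keys z \<subseteq> carrier N" for y z :: "'u \<Rightarrow>\<^sub>0 int"
    using that keys_add[of y z] by blast
  have map: "Poly_Mapping.lookup (Poly_Mapping.map ((*) q) v) x = q * Poly_Mapping.lookup v x"
    for q :: rat and v :: "'u \<Rightarrow>\<^sub>0 rat" and x
    by (simp add: Poly_Mapping.map.rep_eq when_def)
  have "divisible_quotient K (\<lambda>q. Poly_Mapping.map ((*) q))"
  proof
    show "0 \<in> K" unfolding K_def by (intro CollectI exI[of _ 0]) simp
    show "u + v \<in> K" if u: "u \<in> K" and v: "v \<in> K" for u v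
    proof -
      obtain y z y' z' where "Poly_Mapping.keys y \<subseteq> carrier N" "Poly_Mapping.keys z \<subseteq> carrier N"
        "ev y = ev z" "\<forall>x. Poly_Mapping.lookup u x = of_int (Poly_Mapping.lookup y x - Poly_Mapping.lookup z x)"
        "Poly_Mapping.keys y' \<subseteq> carrier N" "Poly_Mapping.keys z' \<subseteq> carrier N"
        "ev y' = ev z'" "\<forall>x. Poly_Mapping.lookup v x = of_int (Poly_Mapping.lookup y' x - Poly_Mapping.lookup z' x)"
        using u v unfolding K_def by blast
      then show ?thesis unfolding K_def
        by (intro CollectI exI[of _ "y + y'"] exI[of _ "z + z'"])
          (simp add: keys_add ev_add lookup_add)
    qed
    show "- u \<in> K" if u: "u \<in> K" for u
    proof -
      obtain y z where "Poly_Mapping.keys y \<subseteq> carrier N" "Poly_Mapping.keys z \<subseteq> carrier N"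
        "ev y = ev z" "\<forall>x. Poly_Mapping.lookup u x = of_int (Poly_Mapping.lookup y x - Poly_Mapping.lookup z x)"
        using u unfolding K_def by blast
      then show ?thesis unfolding K_def
        by (intro CollectI exI[of _ z] exI[of _ y]) simp
    qed
  qed (simp_all add: poly_mapping_eq_iff fun_eq_iff map lookup_add algebra_simps)
  moreover have "Poly_Mapping.single (x \<oplus>\<^bsub>N\<^esub> y) 1
        - (Poly_Mapping.single x 1 + Poly_Mapping.single y 1) \<in> K"
    if "x \<in> carrier N" "y \<in> carrier N" for x y
    unfolding K_def using that
    by (intro CollectI exI[of _ "frag_of (x \<oplus>\<^bsub>N\<^esub> y)"] exI[of _ "frag_of x + frag_of y"])
      (simp add: keys_add ev_add ev_of lookup_add lookup_minus lookup_single when_def)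
  moreover have "x = y"
    if x: "x \<in> carrier N" and y: "y \<in> carrier N"
      and K: "Poly_Mapping.single x 1 - Poly_Mapping.single y 1 \<in> K" for x y
  proof -
    obtain p q where pq: "Poly_Mapping.keys p \<subseteq> carrier N" "Poly_Mapping.keys q \<subseteq> carrier N" "ev p = ev q"
      and eq: "\<And>z. Poly_Mapping.lookup (Poly_Mapping.single x 1 - Poly_Mapping.single y 1 :: 'u \<Rightarrow>\<^sub>0 rat) z
        = of_int (Poly_Mapping.lookup p z - Poly_Mapping.lookup q z)"
      using K unfolding K_def by blast
    have "frag_of x + q = frag_of y + p"
    proof (rule poly_mapping_eqI)
      fix z
      have "rat_of_int (Poly_Mapping.lookup (frag_of x + q) z) = rat_of_int (Poly_Mapping.lookup (frag_of y + p) z)"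
        using eq[of z] by (simp add: lookup_add lookup_minus lookup_single when_def split: if_splits)
      then show "Poly_Mapping.lookup (frag_of x + q) z = Poly_Mapping.lookup (frag_of y + p) z"
        by (simp only: of_int_eq_iff)
    qed
    then have "ev (frag_of x + q) = ev (frag_of y + p)" by simp
    then have "x \<oplus>\<^bsub>N\<^esub> ev q = y \<oplus>\<^bsub>N\<^esub> ev q" using x y pq by (simp add: ev_add ev_of)
    then show "x = y" using x y ev_c[OF pq(2)] by simp
  qed
  ultimately show thesis by (rule that)
qed

text \<open>An element \<open>x\<close> of \<open>N\<close> is sent to the homomorphism \<open>r \<mapsto> r x\<close> from \<open>R\<close> to the divisible group that contains
  \<open>N\<close>. The value at \<open>1\<close> shows that this is injective.\<close>

lemma embeds_in_injective_module:
  fixes N :: "('a, 'u) module" and \<phi> :: "('a \<Rightarrow> ('u \<Rightarrow>\<^sub>0 rat)) \<Rightarrow> 'u"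
  assumes N: "module R N" and \<phi>: "inj \<phi>"
  obtains E :: "('a, 'u) module" and \<iota> where "injective_module R E" and "\<iota> \<in> mod_hom R N E"
    and "inj_on \<iota> (carrier N)"
proof -
  interpret N: module R N by fact
  obtain K :: "('u \<Rightarrow>\<^sub>0 rat) set" where K: "divisible_quotient K (\<lambda>q. Poly_Mapping.map ((*) q))"
    and hull_add: "\<And>x y. \<lbrakk>x \<in> carrier N; y \<in> carrier N\<rbrakk> \<Longrightarrow> Poly_Mapping.single (x \<oplus>\<^bsub>N\<^esub> y) 1
        - (Poly_Mapping.single x 1 + Poly_Mapping.single y 1) \<in> K"
    and hull_inj: "\<And>x y. \<lbrakk>x \<in> carrier N; y \<in> carrier N; Poly_Mapping.single x 1 - Poly_Mapping.single y 1 \<in> K\<rbrakk>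
        \<Longrightarrow> x = y"
    using divisible_group_containing_module[OF N] by blast
  interpret divisible_quotient K "\<lambda>q. Poly_Mapping.map ((*) q)" by (rule K)
  let ?C = "coinduced R"
  have C: "module R ?C" by (rule module_coinduced[OF N.R.is_cring])
  define j where "j x = (\<lambda>r. if r \<in> carrier R then rep (Poly_Mapping.single (r \<odot>\<^bsub>N\<^esub> x) 1) else 0)" for x
  have rep_single: "rep (Poly_Mapping.single (x \<oplus>\<^bsub>N\<^esub> y) 1)
      = rep (Poly_Mapping.single x 1 + Poly_Mapping.single y 1)" if "x \<in> carrier N" "y \<in> carrier N" for x y
    using hull_add[OF that] by (simp add: rep_eq_iff)
  have j: "j \<in> mod_hom R N ?C"
    by (rule mod_homI)
      (auto simp: j_def coinduced_def fun_eq_iff rep_single N.smult_l_distr N.smult_r_distr N.smult_assoc1)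
  have j_inj: "inj_on j (carrier N)"
  proof (rule inj_onI)
    fix x y assume x: "x \<in> carrier N" and y: "y \<in> carrier N" and "j x = j y"
    then have "j x \<one>\<^bsub>R\<^esub> = j y \<one>\<^bsub>R\<^esub>" by simp
    then show "x = y" using hull_inj[OF x y] x y by (simp add: j_def rep_eq_iff)
  qed
  obtain E :: "('a, 'u) module" and p where E: "module R E" and p: "p \<in> mod_hom R ?C E"
    and surj: "p ` carrier ?C = carrier E" and p_inj: "inj_on p (carrier ?C)"
    using copy_in_type[OF C inj_on_subset[OF \<phi>]] by blast
  note hp = mod_homD[OF p]
  define q where "q = inv_into (carrier ?C) p"
  have qp: "q (p c) = c" if "c \<in> carrier ?C" for c using p_inj that by (simp add: q_def)
  have pq: "p (q e) = e" if "e \<in> carrier E" for e using that surj by (simp add: q_def f_inv_into_f)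
  have q: "q \<in> mod_hom R E ?C"
  proof (rule mod_homI)
    interpret C: module R ?C by (rule C)
    have ex: "\<exists>c\<in>carrier ?C. e = p c" if "e \<in> carrier E" for e using that surj by blast
    show "q x \<in> carrier ?C" if "x \<in> carrier E" for x using ex[OF that] qp by auto
    show "q (x \<oplus>\<^bsub>E\<^esub> y) = q x \<oplus>\<^bsub>?C\<^esub> q y" if x: "x \<in> carrier E" and y: "y \<in> carrier E" for x y
    proof -
      obtain c c' where "c \<in> carrier ?C" "x = p c" "c' \<in> carrier ?C" "y = p c'" using ex x y by metis
      then show ?thesis using qp by (simp flip: hp(2))
    qed
    show "q (r \<odot>\<^bsub>E\<^esub> x) = r \<odot>\<^bsub>?C\<^esub> q x" if r: "r \<in> carrier R" and x: "x \<in> carrier E" for r x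
    proof -
      obtain c where "c \<in> carrier ?C" "x = p c" using ex x by metis
      then show ?thesis using qp r by (simp flip: hp(3))
    qed
  qed
  have "injective_module R E"
    unfolding injective_module_def
  proof (intro conjI allI impI E)
    fix A B :: "('a, 'u) module" and f g
    assume "module R A \<and> module R B \<and> f \<in> mod_hom R A B \<and> inj_on f (carrier A) \<and> g \<in> mod_hom R A E"
    then have A: "module R A" and B: "module R B" and f: "f \<in> mod_hom R A B" "inj_on f (carrier A)"
      and g: "g \<in> mod_hom R A E" by auto
    have "(\<lambda>x. q (g x)) \<in> mod_hom R A ?C" using g q by (auto simp: mod_hom_def Pi_iff)
    then obtain h where h: "h \<in> mod_hom R B ?C" "\<forall>x\<in>carrier A. h (f x) = q (g x)"
      using coinduced_injective[OF A B f] by blast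
    have "(\<lambda>x. p (h x)) \<in> mod_hom R B E" using h(1) p by (auto simp: mod_hom_def Pi_iff)
    moreover have "\<forall>x\<in>carrier A. p (h (f x)) = g x" using h(2) pq mod_homD(1)[OF g] by simp
    ultimately show "\<exists>h\<in>mod_hom R B E. \<forall>x\<in>carrier A. h (f x) = g x"
      by (intro bexI[of _ "\<lambda>x. p (h x)"])
  qed
  moreover have "(\<lambda>x. p (j x)) \<in> mod_hom R N E" using j p by (auto simp: mod_hom_def Pi_iff)
  moreover have "inj_on (\<lambda>x. p (j x)) (carrier N)"
    using j_inj p_inj mod_homD(1)[OF j] by (auto simp: inj_on_def)
  ultimately show thesis by (rule that)
qed

section \<open>Injective resolutions\<close>

text \<open>Embed \<open>M\<close> in an injective module, then the cokernel in another one, and so on. Once \<open>M\<close> has been moved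
  into \<open>'u\<close>, all injective modules and cokernels have their elements in \<open>'u\<close>, so that the same step can be iterated.\<close>

lemma injective_resolution_exists:
  fixes M :: "('a, 'b, 'm) module_scheme" and \<beta> :: "'b \<Rightarrow> 'u"
    and \<phi> :: "('a \<Rightarrow> ('u \<Rightarrow>\<^sub>0 rat)) \<Rightarrow> 'u"
  assumes M: "module R M" and \<beta>: "inj \<beta>" and \<phi>: "inj \<phi>"
  shows "\<exists>E d \<epsilon>. injective_resolution R M (E :: nat \<Rightarrow> ('a, 'u) module) d \<epsilon>"
proof -
  \<comment> \<open>One step of the construction: an embedding \<open>\<iota>\<close> of \<open>N\<close> in an injective \<open>E\<close>, and its cokernel \<open>p\<close>.\<close>
  define good where "good N x \<longleftrightarrow> (case x of (E, \<iota>, N', p) \<Rightarrow>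
      injective_module R E \<and> \<iota> \<in> mod_hom R N E \<and> inj_on \<iota> (carrier N) \<and> module R N' \<and>
      p \<in> mod_hom R E N' \<and> p ` carrier E = carrier N' \<and> hom_ker E N' p = \<iota> ` carrier N)"
    for N :: "('a, 'u) module"
      and x :: "('a, 'u) module \<times> ('u \<Rightarrow> 'u) \<times> ('a, 'u) module \<times> ('u \<Rightarrow> 'u)"
  have ex: "\<exists>x. good N x" if N: "module R N" for N
  proof -
    obtain E :: "('a, 'u) module" and \<iota> where E: "injective_module R E" and \<iota>: "\<iota> \<in> mod_hom R N E"
      and inj: "inj_on \<iota> (carrier N)"
      using embeds_in_injective_module[OF N \<phi>] .
    have mE: "module R E" using E by (simp add: injective_module_def)
    have sub: "submodule (\<iota> ` carrier N) R E"
      by (rule submodule_image[OF N mE \<iota> module.carrier_is_submodule[OF N]])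
    obtain N' :: "('a, 'u) module" and p where "module R N'" "p \<in> mod_hom R E N'"
      "p ` carrier E = carrier N'" "hom_ker E N' p = \<iota> ` carrier N"
      using quotient_in_type[OF mE sub inj_on_id2] .
    then show ?thesis using E \<iota> inj by (intro exI[of _ "(E, \<iota>, N', p)"]) (simp add: good_def)
  qed
  define F where "F N = (SOME x. good N x)" for N
  have F: "good N (F N)" if "module R N" for N
    unfolding F_def using ex[OF that] by (rule someI_ex)
  define Ef where "Ef N = fst (F N)" for N
  define \<iota> where "\<iota> N = fst (snd (F N))" for N
  define C where "C N = fst (snd (snd (F N)))" for N
  define p where "p N = snd (snd (snd (F N)))" for N
  have step: "injective_module R (Ef N)" "\<iota> N \<in> mod_hom R N (Ef N)" "inj_on (\<iota> N) (carrier N)"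
      "module R (C N)" "p N \<in> mod_hom R (Ef N) (C N)" "p N ` carrier (Ef N) = carrier (C N)"
      "hom_ker (Ef N) (C N) (p N) = \<iota> N ` carrier N" if "module R N" for N
    using F[OF that] by (auto simp: good_def Ef_def \<iota>_def C_def p_def case_prod_beta)
  obtain M0 :: "('a, 'u) module" and p0 where M0: "module R M0" and p0: "p0 \<in> mod_hom R M M0"
    and p0_surj: "p0 ` carrier M = carrier M0" and p0_inj: "inj_on p0 (carrier M)"
    using copy_in_type[OF M inj_on_subset[OF \<beta>]] by blast
  define N where "N i = (C ^^ i) M0" for i
  have N: "module R (N i)" for i
    by (induction i) (simp_all add: N_def M0 step(4))
  have N_Suc: "N (Suc i) = C (N i)" for i by (simp add: N_def)
  define E where "E i = Ef (N i)" for i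
  define d where "d i x = \<iota> (N (Suc i)) (p (N i) x)" for i x
  define \<epsilon> where "\<epsilon> x = \<iota> M0 (p0 x)" for x
  have zero: "\<iota> (N i) x = \<zero>\<^bsub>E i\<^esub> \<longleftrightarrow> x = \<zero>\<^bsub>N i\<^esub>" if "x \<in> carrier (N i)" for i x
  proof -
    interpret Ni: module R "N i" by (rule N)
    have "module R (E i)" using step(1)[OF N] by (simp add: E_def injective_module_def)
    then have "\<iota> (N i) \<zero>\<^bsub>N i\<^esub> = \<zero>\<^bsub>E i\<^esub>"
      using mod_hom_zero[OF N _ step(2)[OF N]] by (simp add: E_def)
    then show ?thesis using inj_on_eq_iff[OF step(3)[OF N[of i]], of x "\<zero>\<^bsub>N i\<^esub>"] that by auto
  qed
  have pN: "p (N i) x \<in> carrier (N (Suc i))" if "x \<in> carrier (E i)" for i x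
    using mod_homD(1)[OF step(5)[OF N]] that by (simp add: E_def N_Suc)
  have ker: "hom_ker (E i) (E (Suc i)) (d i) = \<iota> (N i) ` carrier (N i)" for i
  proof -
    have "hom_ker (E i) (E (Suc i)) (d i) = hom_ker (Ef (N i)) (C (N i)) (p (N i))"
      using zero[OF pN] by (auto simp: hom_ker_def d_def E_def N_Suc)
    then show ?thesis by (simp add: step(7)[OF N])
  qed
  have im: "d i ` carrier (E i) = \<iota> (N (Suc i)) ` carrier (N (Suc i))" for i
  proof -
    have "d i ` carrier (E i) = \<iota> (N (Suc i)) ` p (N i) ` carrier (E i)" by (auto simp: d_def)
    then show ?thesis using step(6)[OF N, of i] by (simp add: E_def N_Suc)
  qed
  have "injective_resolution R M E d \<epsilon>"
    unfolding injective_resolution_def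
  proof (intro conjI allI)
    show "injective_module R (E i)" for i by (simp add: E_def step(1)[OF N])
    show "d i \<in> mod_hom R (E i) (E (Suc i))" for i
      using step(5)[OF N, of i] step(2)[OF N, of "Suc i"]
      by (auto simp: mod_hom_def Pi_iff d_def E_def N_Suc)
    have N0: "N 0 = M0" by (simp add: N_def)
    show "\<epsilon> \<in> mod_hom R M (E 0)"
      using step(2)[OF M0] p0 by (auto simp: mod_hom_def Pi_iff \<epsilon>_def E_def N0)
    show "inj_on \<epsilon> (carrier M)"
      using step(3)[OF M0] p0_inj mod_homD(1)[OF p0] by (auto simp: inj_on_def \<epsilon>_def)
    show "\<epsilon> ` carrier M = hom_ker (E 0) (E 1) (d 0)"
    proof -
      have "\<epsilon> ` carrier M = \<iota> M0 ` p0 ` carrier M" by (auto simp: \<epsilon>_def)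
      then show ?thesis using ker[of 0] p0_surj by (simp add: N0)
    qed
    show "d i ` carrier (E i) = hom_ker (E (Suc i)) (E (Suc (Suc i))) (d (Suc i))" for i
      by (simp add: im ker)
  qed
  then show ?thesis by blast
qed

lemma chosen_resolution:
  fixes M :: "('a, 'b, 'm) module_scheme"
  assumes "module R M"
  obtains E :: "nat \<Rightarrow> ('a, ('a, 'b) res_univ) module" and d \<epsilon>
  where "chosen_resolution R M = (E, d)" and "injective_resolution R M E d \<epsilon>"
proof -
  obtain \<alpha> :: "'a \<Rightarrow> ('a, 'b) res_univ" and \<beta> :: "'b \<Rightarrow> ('a, 'b) res_univ"
    and \<phi> :: "('a \<Rightarrow> (('a, 'b) res_univ \<Rightarrow>\<^sub>0 rat)) \<Rightarrow> ('a, 'b) res_univ"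
    where "inj \<alpha>" "inj \<beta>" "inj \<phi>"
    by (rule res_univ_embeddings)
  then have "\<exists>x. case x of (E :: nat \<Rightarrow> ('a, ('a, 'b) res_univ) module, d) \<Rightarrow>
      \<exists>\<epsilon>. injective_resolution R M E d \<epsilon>"
    using injective_resolution_exists[OF assms] by auto
  then have "case chosen_resolution R M of (E, d) \<Rightarrow> \<exists>\<epsilon>. injective_resolution R M E d \<epsilon>"
    unfolding chosen_resolution_def by (rule someI_ex)
  then show thesis using that by (auto split: prod.splits)
qed

section \<open>Division in injective modules over noetherian rings\<close>

definition self_module :: "('a, 'r) ring_scheme \<Rightarrow> ('a, 'a) module" where
  "self_module R = \<lparr>carrier = carrier R, monoid.mult = undefined, one = undefined,
     ring.zero = \<zero>\<^bsub>R\<^esub>, add = add R, smult = monoid.mult R\<rparr>"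

lemma self_module:
  assumes "cring R"
  shows "module R (self_module R)"
    and "ideal A R \<Longrightarrow> submodule A R (self_module R)"
proof -
  interpret cring R by fact
  show S: "module R (self_module R)"
  proof (rule moduleI)
    show "abelian_group (self_module R)"
    proof (rule abelian_groupI)
      show "\<exists>y\<in>carrier (self_module R). y \<oplus>\<^bsub>self_module R\<^esub> x = \<zero>\<^bsub>self_module R\<^esub>"
        if "x \<in> carrier (self_module R)" for x
        using that by (intro bexI[of _ "\<ominus>\<^bsub>R\<^esub> x"]) (auto simp: self_module_def l_neg)
    qed (auto simp: self_module_def a_ac)
  qed (auto simp: self_module_def l_distr r_distr m_assoc is_cring)
  then interpret S: module R "self_module R" .
  have minus: "\<ominus>\<^bsub>self_module R\<^esub> a = \<ominus>\<^bsub>R\<^esub> a" for a by (simp add: a_inv_def m_inv_def self_module_def)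
  assume A: "ideal A R"
  interpret A: ideal A R by fact
  show "submodule A R (self_module R)"
  proof (rule S.submoduleI)
    show "A \<subseteq> carrier (self_module R)" using A.a_subset by (simp add: self_module_def)
    show "\<zero>\<^bsub>self_module R\<^esub> \<in> A" using A.zero_closed by (simp add: self_module_def)
    show "\<ominus>\<^bsub>self_module R\<^esub> a \<in> A" if "a \<in> A" for a using that by (simp add: minus)
  qed (auto simp: self_module_def A.I_l_closed)
qed

lemma injective_moduleD:
  fixes A B E :: "('a, 'u) module"
  assumes "injective_module R E" and "module R A" and "module R B"
    and "f \<in> mod_hom R A B" and "inj_on f (carrier A)" and "g \<in> mod_hom R A E"
  shows "\<exists>h \<in> mod_hom R B E. \<forall>x\<in>carrier A. h (f x) = g x"
  using assms unfolding injective_module_def by simp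

text \<open>The easy half of Baer's criterion. Injectivity is defined for modules with elements in \<open>'u\<close>, so it is applied to a copy of \<open>R\<close> in \<open>'u\<close>.\<close>

lemma injective_extends_from_ideal:
  fixes E :: "('a, 'u) module" and \<alpha> :: "'a \<Rightarrow> 'u"
  assumes R: "cring R" and inj: "injective_module R E" and \<alpha>: "inj_on \<alpha> (carrier R)"
    and A: "ideal A R"
    and g: "\<And>a. a \<in> A \<Longrightarrow> g a \<in> carrier E"
      "\<And>a b. \<lbrakk>a \<in> A; b \<in> A\<rbrakk> \<Longrightarrow> g (a \<oplus>\<^bsub>R\<^esub> b) = g a \<oplus>\<^bsub>E\<^esub> g b"
      "\<And>r a. \<lbrakk>r \<in> carrier R; a \<in> A\<rbrakk> \<Longrightarrow> g (r \<otimes>\<^bsub>R\<^esub> a) = r \<odot>\<^bsub>E\<^esub> g a"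
  obtains z where "z \<in> carrier E" and "\<And>a. a \<in> A \<Longrightarrow> g a = a \<odot>\<^bsub>E\<^esub> z"
proof -
  interpret cring R by fact
  interpret A: ideal A R by fact
  let ?S = "self_module R"
  have S: "module R ?S" and AS: "submodule A R ?S" using self_module[OF R] A by auto
  have cS: "carrier ?S = carrier R" by (simp add: self_module_def)
  obtain Q :: "('a, 'u) module" and p where Q: "module R Q" and p: "p \<in> mod_hom R ?S Q"
    and surj: "p ` carrier ?S = carrier Q" and pinj: "inj_on p (carrier ?S)"
    using copy_in_type[OF S, of \<alpha>] \<alpha> cS by metis
  note hp = mod_homD[OF p, unfolded cS]
  define q where "q = inv_into (carrier R) p"
  have q: "q (p a) = a" if "a \<in> carrier R" for a
    using pinj that by (simp add: q_def cS)
  define A' where "A' = Q\<lparr>carrier := p ` A\<rparr>"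
  have A': "module R A'"
    unfolding A'_def by (rule submodule.submodule_is_module[OF submodule_image[OF S Q p AS] Q])
  have incl: "(\<lambda>x. x) \<in> mod_hom R A' Q"
    using A.Icarr hp(1) by (auto simp: mod_hom_def A'_def)
  have gq: "(\<lambda>x. g (q x)) \<in> mod_hom R A' E"
  proof (rule mod_homI)
    show "g (q x) \<in> carrier E" if "x \<in> carrier A'" for x
      using that g(1) q A.Icarr by (auto simp: A'_def)
    show "g (q (x \<oplus>\<^bsub>A'\<^esub> y)) = g (q x) \<oplus>\<^bsub>E\<^esub> g (q y)" if "x \<in> carrier A'" "y \<in> carrier A'" for x y
    proof -
      obtain a b where ab: "a \<in> A" "x = p a" "b \<in> A" "y = p b" using \<open>x \<in> carrier A'\<close> \<open>y \<in> carrier A'\<close>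
        by (auto simp: A'_def)
      have "x \<oplus>\<^bsub>A'\<^esub> y = p (a \<oplus>\<^bsub>R\<^esub> b)"
        using hp(2)[of a b] ab A.Icarr by (simp add: A'_def self_module_def)
      then show ?thesis using ab A.Icarr q g(2) by simp
    qed
    show "g (q (r \<odot>\<^bsub>A'\<^esub> x)) = r \<odot>\<^bsub>E\<^esub> g (q x)" if "r \<in> carrier R" "x \<in> carrier A'" for r x
    proof -
      obtain a where a: "a \<in> A" "x = p a" using \<open>x \<in> carrier A'\<close> by (auto simp: A'_def)
      have "r \<odot>\<^bsub>A'\<^esub> x = p (r \<otimes>\<^bsub>R\<^esub> a)"
        using hp(3)[of r a] a A.Icarr \<open>r \<in> carrier R\<close> by (simp add: A'_def self_module_def)
      then show ?thesis using a A.Icarr q g(3) \<open>r \<in> carrier R\<close> by simp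
    qed
  qed
  obtain h where h: "h \<in> mod_hom R Q E" "\<forall>x\<in>carrier A'. h x = g (q x)"
    using injective_moduleD[OF inj A' Q incl _ gq] by auto
  have "g a = a \<odot>\<^bsub>E\<^esub> h (p \<one>\<^bsub>R\<^esub>)" if a: "a \<in> A" for a
  proof -
    have ac: "a \<in> carrier R" using a A.Icarr by blast
    have "p a = a \<odot>\<^bsub>Q\<^esub> p \<one>\<^bsub>R\<^esub>" using hp(3)[OF ac, of "\<one>\<^bsub>R\<^esub>"] ac by (simp add: self_module_def)
    then have "h (p a) = a \<odot>\<^bsub>E\<^esub> h (p \<one>\<^bsub>R\<^esub>)" using mod_homD(3)[OF h(1) ac] hp(1) by simp
    moreover have "h (p a) = g a" using h(2) a ac q by (simp add: A'_def)
    ultimately show ?thesis by simp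
  qed
  moreover have "h (p \<one>\<^bsub>R\<^esub>) \<in> carrier E" using mod_homD(1)[OF h(1)] hp(1) by simp
  ultimately show thesis using that by blast
qed

lemma ideal_annihilator_of_element:
  assumes M: "module R M" and y: "y \<in> carrier M"
  shows "ideal {r \<in> carrier R. r \<odot>\<^bsub>M\<^esub> y = \<zero>\<^bsub>M\<^esub>} R"
proof -
  interpret M: module R M by fact
  have m0: "\<ominus>\<^bsub>M\<^esub> \<zero>\<^bsub>M\<^esub> = \<zero>\<^bsub>M\<^esub>" using M.M.diff_zero[of "\<zero>\<^bsub>M\<^esub>"] by (simp add: M.M.minus_eq)
  show ?thesis
  proof (rule idealI)
    show "ring R" by (rule M.R.ring_axioms)
    show "subgroup {r \<in> carrier R. r \<odot>\<^bsub>M\<^esub> y = \<zero>\<^bsub>M\<^esub>} (add_monoid R)"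
    proof (rule M.R.add.subgroupI)
      show "{r \<in> carrier R. r \<odot>\<^bsub>M\<^esub> y = \<zero>\<^bsub>M\<^esub>} \<noteq> {}" using y M.R.zero_closed M.smult_l_null by blast
    qed (use y m0 in \<open>auto simp: M.smult_l_minus M.smult_l_distr simp flip: a_inv_def\<close>)
  next
    fix a x assume "a \<in> {r \<in> carrier R. r \<odot>\<^bsub>M\<^esub> y = \<zero>\<^bsub>M\<^esub>}" "x \<in> carrier R"
    then show "x \<otimes>\<^bsub>R\<^esub> a \<in> {r \<in> carrier R. r \<odot>\<^bsub>M\<^esub> y = \<zero>\<^bsub>M\<^esub>}" "a \<otimes>\<^bsub>R\<^esub> x \<in> {r \<in> carrier R. r \<odot>\<^bsub>M\<^esub> y = \<zero>\<^bsub>M\<^esub>}"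
      using y M.R.m_comm[of a x] by (auto simp: M.smult_assoc1)
  qed
qed

text \<open>Let \<open>n\<close> be such that \<open>ann (x\<^sup>n y) = ann (x\<^sup>n\<^sup>+\<^sup>1 y)\<close>, which exists since \<open>R\<close> is noetherian. Then \<open>r x\<^sup>n\<^sup>+\<^sup>1 + s \<mapsto> r x\<^sup>n y\<close> is
  well defined on the ideal \<open>(x\<^sup>n\<^sup>+\<^sup>1) + ann y\<close>: if \<open>r x\<^sup>n\<^sup>+\<^sup>1\<close> kills \<open>y\<close>, so does \<open>r x\<^sup>n\<close>. Injectivity makes the map
  multiplication by some \<open>z\<close>; its value at \<open>x\<^sup>n\<^sup>+\<^sup>1\<close> is \<open>x\<^sup>n y\<close>, and it vanishes on \<open>ann y\<close>.\<close>

lemma injective_division: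
  fixes E :: "('a, 'u) module" and \<alpha> :: "'a \<Rightarrow> 'u"
  assumes R: "cring R" and noeth: "noetherian_ring R" and inj: "injective_module R E"
    and \<alpha>: "inj_on \<alpha> (carrier R)" and x: "x \<in> carrier R" and y: "y \<in> carrier E"
  shows "\<exists>n. \<exists>z \<in> carrier E. (x [^]\<^bsub>R\<^esub> Suc n) \<odot>\<^bsub>E\<^esub> z = (x [^]\<^bsub>R\<^esub> n) \<odot>\<^bsub>E\<^esub> y \<and>
      (\<forall>r \<in> carrier R. r \<odot>\<^bsub>E\<^esub> y = \<zero>\<^bsub>E\<^esub> \<longrightarrow> r \<odot>\<^bsub>E\<^esub> z = \<zero>\<^bsub>E\<^esub>)"
proof -
  have E: "module R E" using inj by (simp add: injective_module_def)
  interpret E: module R E by fact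
  interpret noetherian_ring R by fact
  define ann where "ann v = {r \<in> carrier R. r \<odot>\<^bsub>E\<^esub> v = \<zero>\<^bsub>E\<^esub>}" for v
  have ann: "ideal (ann v) R" if "v \<in> carrier E" for v
    unfolding ann_def by (rule ideal_annihilator_of_element[OF E that])
  define y' where "y' n = (x [^]\<^bsub>R\<^esub> (n::nat)) \<odot>\<^bsub>E\<^esub> y" for n
  have y': "y' n \<in> carrier E" for n using x y by (simp add: y'_def)
  have y'_Suc: "y' (Suc n) = x \<odot>\<^bsub>E\<^esub> y' n" for n
    using x y by (simp add: y'_def E.smult_assoc1[symmetric] E.R.m_comm)
  have mono: "ann (y' m) \<subseteq> ann (y' n)" if "m \<le> n" for m n
    using that
  proof (rule lift_Suc_mono_le[of "\<lambda>n. ann (y' n)", rotated])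
    fix n
    show "ann (y' n) \<subseteq> ann (y' (Suc n))"
    proof
      fix r assume r: "r \<in> ann (y' n)"
      then have "r \<in> carrier R" by (simp add: ann_def)
      then have "r \<odot>\<^bsub>E\<^esub> (x \<odot>\<^bsub>E\<^esub> y' n) = x \<odot>\<^bsub>E\<^esub> (r \<odot>\<^bsub>E\<^esub> y' n)"
        using x y'[of n] by (simp add: E.smult_assoc1[symmetric] E.R.m_comm)
      then show "r \<in> ann (y' (Suc n))" using r x by (simp add: ann_def y'_Suc)
    qed
  qed
  have "subset.chain {I. ideal I R} (range (\<lambda>n. ann (y' n)))"
    unfolding subset_chain_def using ann y' mono by (auto, meson nle_le subsetD)
  then have "(\<Union>n. ann (y' n)) \<in> range (\<lambda>n. ann (y' n))"
    by (intro ideal_chain_is_trivial) auto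
  then obtain n where "(\<Union>n. ann (y' n)) = ann (y' n)" by blast
  then have stable: "r \<in> ann (y' n)" if "r \<in> ann (y' (Suc n))" for r using that by blast
  define X where "X = x [^]\<^bsub>R\<^esub> Suc n"
  have xc: "X \<in> carrier R" and Xy: "X \<odot>\<^bsub>E\<^esub> y = y' (Suc n)" using x by (simp_all add: X_def y'_def)
  define A where "A = (PIdl\<^bsub>R\<^esub> X) <+>\<^bsub>R\<^esub> ann y"
  have A: "ideal A R" unfolding A_def by (rule E.R.add_ideals[OF E.R.cgenideal_ideal[OF xc] ann[OF y]])
  have A_iff: "a \<in> A \<longleftrightarrow> (\<exists>r\<in>carrier R. \<exists>s\<in>ann y. a = r \<otimes>\<^bsub>R\<^esub> X \<oplus>\<^bsub>R\<^esub> s)" for a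
  proof -
    have "a \<in> A \<longleftrightarrow> (\<exists>h\<in>PIdl\<^bsub>R\<^esub> X. \<exists>s\<in>ann y. a = h \<oplus>\<^bsub>R\<^esub> s)"
      unfolding A_def set_add_def' by blast
    also have "\<dots> \<longleftrightarrow> (\<exists>r\<in>carrier R. \<exists>s\<in>ann y. a = r \<otimes>\<^bsub>R\<^esub> X \<oplus>\<^bsub>R\<^esub> s)"
    proof -
      have "PIdl\<^bsub>R\<^esub> X = (\<lambda>r. r \<otimes>\<^bsub>R\<^esub> X) ` carrier R" by (auto simp: cgenideal_def)
      then show ?thesis by (simp only: bex_simps)
    qed
    finally show ?thesis .
  qed
  define g where "g a = (SOME e. \<exists>r\<in>carrier R. \<exists>s\<in>ann y. a = r \<otimes>\<^bsub>R\<^esub> X \<oplus>\<^bsub>R\<^esub> s \<and> e = r \<odot>\<^bsub>E\<^esub> y' n)" for a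
  have g_eq: "g (r \<otimes>\<^bsub>R\<^esub> X \<oplus>\<^bsub>R\<^esub> s) = r \<odot>\<^bsub>E\<^esub> y' n" if r: "r \<in> carrier R" and s: "s \<in> ann y" for r s
  proof -
    have uniq: "e = r \<odot>\<^bsub>E\<^esub> y' n"
      if r': "r' \<in> carrier R" and s': "s' \<in> ann y" and eq: "r \<otimes>\<^bsub>R\<^esub> X \<oplus>\<^bsub>R\<^esub> s = r' \<otimes>\<^bsub>R\<^esub> X \<oplus>\<^bsub>R\<^esub> s'"
        and e: "e = r' \<odot>\<^bsub>E\<^esub> y' n" for e r' s'
    proof -
      have sc: "s \<in> carrier R" "s' \<in> carrier R" using s s' by (auto simp: ann_def)
      have *: "(t \<otimes>\<^bsub>R\<^esub> X \<oplus>\<^bsub>R\<^esub> w) \<odot>\<^bsub>E\<^esub> y = t \<odot>\<^bsub>E\<^esub> y' (Suc n)" if "t \<in> carrier R" "w \<in> ann y" for t w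
      proof -
        have w: "w \<in> carrier R" "w \<odot>\<^bsub>E\<^esub> y = \<zero>\<^bsub>E\<^esub>" using that(2) by (auto simp: ann_def)
        show ?thesis using that(1) w xc y
          by (simp add: Xy[symmetric] E.smult_l_distr E.smult_assoc1)
      qed
      have "r \<odot>\<^bsub>E\<^esub> y' (Suc n) = r' \<odot>\<^bsub>E\<^esub> y' (Suc n)"
        using *[OF r s] *[OF r' s'] eq by simp
      then have "(r \<ominus>\<^bsub>R\<^esub> r') \<odot>\<^bsub>E\<^esub> y' (Suc n) = \<zero>\<^bsub>E\<^esub>"
        using r r' y'[of "Suc n"] by (simp add: E.R.minus_eq E.smult_l_distr E.smult_l_minus E.M.r_neg)
      then have "(r \<ominus>\<^bsub>R\<^esub> r') \<odot>\<^bsub>E\<^esub> y' n = \<zero>\<^bsub>E\<^esub>"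
        using stable[of "r \<ominus>\<^bsub>R\<^esub> r'"] r r' by (simp add: ann_def)
      then have "r \<odot>\<^bsub>E\<^esub> y' n \<ominus>\<^bsub>E\<^esub> r' \<odot>\<^bsub>E\<^esub> y' n = \<zero>\<^bsub>E\<^esub>"
        using r r' y'[of n] by (simp add: E.R.minus_eq E.M.minus_eq E.smult_l_distr E.smult_l_minus)
      then show ?thesis using e r r' y'[of n] E.M.eq_if_diff_zero[of "r \<odot>\<^bsub>E\<^esub> y' n" "r' \<odot>\<^bsub>E\<^esub> y' n"] by simp
    qed
    show ?thesis
      unfolding g_def
    proof (rule some_equality)
      show "\<exists>r'\<in>carrier R. \<exists>s'\<in>ann y. r \<otimes>\<^bsub>R\<^esub> X \<oplus>\<^bsub>R\<^esub> s = r' \<otimes>\<^bsub>R\<^esub> X \<oplus>\<^bsub>R\<^esub> s' \<and> r \<odot>\<^bsub>E\<^esub> y' n = r' \<odot>\<^bsub>E\<^esub> y' n"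
        by (rule bexI[OF bexI[OF _ s] r]) simp
      fix e
      assume "\<exists>r'\<in>carrier R. \<exists>s'\<in>ann y. r \<otimes>\<^bsub>R\<^esub> X \<oplus>\<^bsub>R\<^esub> s = r' \<otimes>\<^bsub>R\<^esub> X \<oplus>\<^bsub>R\<^esub> s' \<and> e = r' \<odot>\<^bsub>E\<^esub> y' n"
      then show "e = r \<odot>\<^bsub>E\<^esub> y' n" by (elim bexE conjE) (rule uniq)
    qed
  qed
  interpret annI: ideal "ann y" R by (rule ann[OF y])
  have anncar: "s \<in> carrier R" if "s \<in> ann y" for s by (rule annI.Icarr[OF that])
  have g1: "g a \<in> carrier E" if "a \<in> A" for a
    using that y'[of n] unfolding A_iff by (auto simp: g_eq)
  have g2: "g (a \<oplus>\<^bsub>R\<^esub> b) = g a \<oplus>\<^bsub>E\<^esub> g b" if "a \<in> A" "b \<in> A" for a b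
  proof -
    obtain r s r' s' where *: "r \<in> carrier R" "s \<in> ann y" "a = r \<otimes>\<^bsub>R\<^esub> X \<oplus>\<^bsub>R\<^esub> s"
      "r' \<in> carrier R" "s' \<in> ann y" "b = r' \<otimes>\<^bsub>R\<^esub> X \<oplus>\<^bsub>R\<^esub> s'"
      using \<open>a \<in> A\<close> \<open>b \<in> A\<close> unfolding A_iff by blast
    have "a \<oplus>\<^bsub>R\<^esub> b = (r \<oplus>\<^bsub>R\<^esub> r') \<otimes>\<^bsub>R\<^esub> X \<oplus>\<^bsub>R\<^esub> (s \<oplus>\<^bsub>R\<^esub> s')"
      unfolding *(3,6) using * xc anncar[of s] anncar[of s']
      by (simp add: E.R.l_distr E.R.a_ac)
    then show ?thesis
      using * y'[of n] annI.a_closed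
      by (simp add: g_eq E.smult_l_distr)
  qed
  have g3: "g (t \<otimes>\<^bsub>R\<^esub> a) = t \<odot>\<^bsub>E\<^esub> g a" if t: "t \<in> carrier R" and "a \<in> A" for t a
  proof -
    obtain r s where *: "r \<in> carrier R" "s \<in> ann y" "a = r \<otimes>\<^bsub>R\<^esub> X \<oplus>\<^bsub>R\<^esub> s"
      using \<open>a \<in> A\<close> unfolding A_iff by blast
    have "t \<otimes>\<^bsub>R\<^esub> a = (t \<otimes>\<^bsub>R\<^esub> r) \<otimes>\<^bsub>R\<^esub> X \<oplus>\<^bsub>R\<^esub> t \<otimes>\<^bsub>R\<^esub> s"
      unfolding *(3) using * xc t anncar[of s] by (simp add: E.R.r_distr E.R.m_assoc)
    then show ?thesis
      using * y'[of n] t annI.I_l_closed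
      by (simp add: g_eq E.smult_assoc1)
  qed
  obtain z where z: "z \<in> carrier E" "\<And>a. a \<in> A \<Longrightarrow> g a = a \<odot>\<^bsub>E\<^esub> z"
    using injective_extends_from_ideal[OF R inj \<alpha> A g1 g2 g3] by blast
  have "(x [^]\<^bsub>R\<^esub> Suc n) \<odot>\<^bsub>E\<^esub> z = (x [^]\<^bsub>R\<^esub> n) \<odot>\<^bsub>E\<^esub> y"
  proof -
    have "\<one>\<^bsub>R\<^esub> \<otimes>\<^bsub>R\<^esub> X \<oplus>\<^bsub>R\<^esub> \<zero>\<^bsub>R\<^esub> \<in> A"
      unfolding A_iff using E.R.one_closed annI.zero_closed by blast
    moreover have "g (\<one>\<^bsub>R\<^esub> \<otimes>\<^bsub>R\<^esub> X \<oplus>\<^bsub>R\<^esub> \<zero>\<^bsub>R\<^esub>) = \<one>\<^bsub>R\<^esub> \<odot>\<^bsub>E\<^esub> y' n"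
      by (rule g_eq[OF E.R.one_closed annI.zero_closed])
    ultimately have "X \<in> A" "g X = y' n" using xc y'[of n] by simp_all
    then show ?thesis using z(2)[of X] by (simp only: y'_def X_def)
  qed
  moreover have "r \<odot>\<^bsub>E\<^esub> z = \<zero>\<^bsub>E\<^esub>" if r: "r \<in> carrier R" "r \<odot>\<^bsub>E\<^esub> y = \<zero>\<^bsub>E\<^esub>" for r
  proof -
    have ra: "r \<in> ann y" unfolding ann_def using r by blast
    then have "\<zero>\<^bsub>R\<^esub> \<otimes>\<^bsub>R\<^esub> X \<oplus>\<^bsub>R\<^esub> r \<in> A" unfolding A_iff using E.R.zero_closed by blast
    moreover have "g (\<zero>\<^bsub>R\<^esub> \<otimes>\<^bsub>R\<^esub> X \<oplus>\<^bsub>R\<^esub> r) = \<zero>\<^bsub>R\<^esub> \<odot>\<^bsub>E\<^esub> y' n" by (rule g_eq[OF E.R.zero_closed ra])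
    ultimately have "r \<in> A" "g r = \<zero>\<^bsub>E\<^esub>" using xc r(1) y'[of n] by simp_all
    then show ?thesis using z(2)[of r] by simp
  qed
  ultimately show ?thesis using z(1) by blast
qed

section \<open>Torsion subcomplexes\<close>

text \<open>The two features of an injective resolution over a noetherian ring that the comparison uses: it is a
  complex, and its elements can be divided by ring elements \<open>x\<close> up to \<open>x\<close>-torsion without making annihilators
  smaller.\<close>

locale divisible_complex =
  fixes R :: "('a, 'r) ring_scheme" and E :: "nat \<Rightarrow> ('a, 'u, 'm) module_scheme"
    and d :: "nat \<Rightarrow> 'u \<Rightarrow> 'u"
  assumes module: "module R (E i)"
    and hom: "d i \<in> mod_hom R (E i) (E (Suc i))"
    and dd: "y \<in> carrier (E i) \<Longrightarrow> d (Suc i) (d i y) = \<zero>\<^bsub>E (Suc (Suc i))\<^esub>"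
    and division: "\<lbrakk>x \<in> carrier R; y \<in> carrier (E i)\<rbrakk> \<Longrightarrow> \<exists>n. \<exists>z \<in> carrier (E i).
      (x [^]\<^bsub>R\<^esub> Suc n) \<odot>\<^bsub>E i\<^esub> z = (x [^]\<^bsub>R\<^esub> n) \<odot>\<^bsub>E i\<^esub> y \<and>
      (\<forall>r \<in> carrier R. r \<odot>\<^bsub>E i\<^esub> y = \<zero>\<^bsub>E i\<^esub> \<longrightarrow> r \<odot>\<^bsub>E i\<^esub> z = \<zero>\<^bsub>E i\<^esub>)"
begin

text \<open>Closure under passing to elements with a larger annihilator holds for every subcomplex that
  is defined by torsion conditions; it keeps the results of divisions inside the subcomplex.\<close>

definition ann_closed_subcomplex :: "(nat \<Rightarrow> 'u set) \<Rightarrow> bool" where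
  "ann_closed_subcomplex C \<longleftrightarrow>
     (\<forall>i. submodule (C i) R (E i) \<and> d i ` C i \<subseteq> C (Suc i) \<and>
       (\<forall>y \<in> C i. \<forall>z \<in> carrier (E i).
          (\<forall>r \<in> carrier R. r \<odot>\<^bsub>E i\<^esub> y = \<zero>\<^bsub>E i\<^esub> \<longrightarrow> r \<odot>\<^bsub>E i\<^esub> z = \<zero>\<^bsub>E i\<^esub>) \<longrightarrow> z \<in> C i))"

definition boundaries :: "(nat \<Rightarrow> 'u set) \<Rightarrow> nat \<Rightarrow> 'u set" where
  "boundaries C i = (case i of 0 \<Rightarrow> {\<zero>\<^bsub>E 0\<^esub>} | Suc j \<Rightarrow> d j ` C j)"

definition power_torsion :: "'a set \<Rightarrow> (nat \<Rightarrow> 'u set) \<Rightarrow> nat \<Rightarrow> 'u set" where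
  "power_torsion S C i = {y \<in> C i. \<forall>x \<in> S. \<exists>n. (x [^]\<^bsub>R\<^esub> (n::nat)) \<odot>\<^bsub>E i\<^esub> y = \<zero>\<^bsub>E i\<^esub>}"

lemma power_kill_mono:
  assumes x: "x \<in> carrier R" and y: "y \<in> carrier (E i)" and le: "n \<le> m"
    and n: "(x [^]\<^bsub>R\<^esub> (n::nat)) \<odot>\<^bsub>E i\<^esub> y = \<zero>\<^bsub>E i\<^esub>"
  shows "(x [^]\<^bsub>R\<^esub> (m::nat)) \<odot>\<^bsub>E i\<^esub> y = \<zero>\<^bsub>E i\<^esub>"
proof -
  interpret Ei: module R "E i" by (rule module)
  have "x [^]\<^bsub>R\<^esub> m = x [^]\<^bsub>R\<^esub> (m - n) \<otimes>\<^bsub>R\<^esub> x [^]\<^bsub>R\<^esub> n"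
    using le x by (simp add: Ei.R.nat_pow_mult)
  then show ?thesis using n x y by (simp add: Ei.smult_assoc1)
qed

lemma power_torsion_insert:
  "power_torsion (insert x S) C = power_torsion {x} (power_torsion S C)"
  by (auto simp: power_torsion_def)

lemma ann_closed_subcomplex_power_torsion:
  assumes C: "ann_closed_subcomplex C" and S: "S \<subseteq> carrier R"
  shows "ann_closed_subcomplex (power_torsion S C)"
  unfolding ann_closed_subcomplex_def
proof (intro allI conjI ballI impI)
  fix i
  interpret Ei: module R "E i" by (rule module)
  interpret Es: module R "E (Suc i)" by (rule module)
  note h = mod_homD[OF hom[of i]]
  have Ci: "submodule (C i) R (E i)" and dC: "d i ` C i \<subseteq> C (Suc i)"
    using C by (auto simp: ann_closed_subcomplex_def)
  note c = submoduleD[OF module Ci]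
  show "submodule (power_torsion S C i) R (E i)"
  proof (rule Ei.submoduleI)
    show "power_torsion S C i \<subseteq> carrier (E i)" using c(1) by (auto simp: power_torsion_def)
    show "\<zero>\<^bsub>E i\<^esub> \<in> power_torsion S C i" using c(2) S by (auto simp: power_torsion_def)
    show "\<ominus>\<^bsub>E i\<^esub> a \<in> power_torsion S C i" if a: "a \<in> power_torsion S C i" for a
      unfolding power_torsion_def
    proof (intro CollectI conjI ballI)
      show "\<ominus>\<^bsub>E i\<^esub> a \<in> C i" using a c(5) by (auto simp: power_torsion_def)
      fix x assume x: "x \<in> S"
      then obtain n where n: "(x [^]\<^bsub>R\<^esub> (n::nat)) \<odot>\<^bsub>E i\<^esub> a = \<zero>\<^bsub>E i\<^esub>"
        using a by (auto simp: power_torsion_def)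
      have "x \<in> carrier R" "a \<in> carrier (E i)"
        using x S a c(1) by (auto simp: power_torsion_def)
      then have "(x [^]\<^bsub>R\<^esub> n) \<odot>\<^bsub>E i\<^esub> (\<ominus>\<^bsub>E i\<^esub> a) = \<ominus>\<^bsub>E i\<^esub> \<zero>\<^bsub>E i\<^esub>"
        using n by (simp add: Ei.smult_r_minus)
      also have "\<dots> = \<zero>\<^bsub>E i\<^esub>" using Ei.M.diff_zero[of "\<zero>\<^bsub>E i\<^esub>"] by (simp add: Ei.M.minus_eq)
      finally show "\<exists>n. (x [^]\<^bsub>R\<^esub> (n::nat)) \<odot>\<^bsub>E i\<^esub> (\<ominus>\<^bsub>E i\<^esub> a) = \<zero>\<^bsub>E i\<^esub>" by blast
    qed
    show "a \<oplus>\<^bsub>E i\<^esub> b \<in> power_torsion S C i"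
      if a: "a \<in> power_torsion S C i" and b: "b \<in> power_torsion S C i" for a b
      unfolding power_torsion_def
    proof (intro CollectI conjI ballI)
      show "a \<oplus>\<^bsub>E i\<^esub> b \<in> C i" using a b c(3) by (auto simp: power_torsion_def)
      fix x assume x: "x \<in> S"
      obtain n where n: "(x [^]\<^bsub>R\<^esub> (n::nat)) \<odot>\<^bsub>E i\<^esub> a = \<zero>\<^bsub>E i\<^esub>"
        using a x by (auto simp: power_torsion_def)
      obtain m where m: "(x [^]\<^bsub>R\<^esub> (m::nat)) \<odot>\<^bsub>E i\<^esub> b = \<zero>\<^bsub>E i\<^esub>"
        using b x by (auto simp: power_torsion_def)
      have cx: "x \<in> carrier R" "a \<in> carrier (E i)" "b \<in> carrier (E i)"
        using x S a b c(1) by (auto simp: power_torsion_def)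
      have "(x [^]\<^bsub>R\<^esub> (n + m)) \<odot>\<^bsub>E i\<^esub> a = \<zero>\<^bsub>E i\<^esub>" "(x [^]\<^bsub>R\<^esub> (n + m)) \<odot>\<^bsub>E i\<^esub> b = \<zero>\<^bsub>E i\<^esub>"
        using power_kill_mono[OF cx(1,2) _ n] power_kill_mono[OF cx(1,3) _ m] by auto
      then have "(x [^]\<^bsub>R\<^esub> (n + m)) \<odot>\<^bsub>E i\<^esub> (a \<oplus>\<^bsub>E i\<^esub> b) = \<zero>\<^bsub>E i\<^esub>"
        using cx by (simp add: Ei.smult_r_distr)
      then show "\<exists>n. (x [^]\<^bsub>R\<^esub> (n::nat)) \<odot>\<^bsub>E i\<^esub> (a \<oplus>\<^bsub>E i\<^esub> b) = \<zero>\<^bsub>E i\<^esub>" by blast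
    qed
    show "r \<odot>\<^bsub>E i\<^esub> a \<in> power_torsion S C i"
      if r: "r \<in> carrier R" and a: "a \<in> power_torsion S C i" for r a
      unfolding power_torsion_def
    proof (intro CollectI conjI ballI)
      show "r \<odot>\<^bsub>E i\<^esub> a \<in> C i" using r a c(6) by (auto simp: power_torsion_def)
      fix x assume x: "x \<in> S"
      obtain n where n: "(x [^]\<^bsub>R\<^esub> (n::nat)) \<odot>\<^bsub>E i\<^esub> a = \<zero>\<^bsub>E i\<^esub>"
        using a x by (auto simp: power_torsion_def)
      have cx: "x \<in> carrier R" "a \<in> carrier (E i)"
        using x S a c(1) by (auto simp: power_torsion_def)
      have "(x [^]\<^bsub>R\<^esub> n) \<odot>\<^bsub>E i\<^esub> (r \<odot>\<^bsub>E i\<^esub> a) = r \<odot>\<^bsub>E i\<^esub> ((x [^]\<^bsub>R\<^esub> n) \<odot>\<^bsub>E i\<^esub> a)"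
        using cx r by (simp add: Ei.smult_assoc1[symmetric] Ei.R.m_comm)
      then show "\<exists>n. (x [^]\<^bsub>R\<^esub> (n::nat)) \<odot>\<^bsub>E i\<^esub> (r \<odot>\<^bsub>E i\<^esub> a) = \<zero>\<^bsub>E i\<^esub>"
        using n r by auto
    qed
  qed
  show "d i ` power_torsion S C i \<subseteq> power_torsion S C (Suc i)"
  proof clarify
    fix y assume y: "y \<in> power_torsion S C i"
    show "d i y \<in> power_torsion S C (Suc i)"
      unfolding power_torsion_def
    proof (intro CollectI conjI ballI)
      show "d i y \<in> C (Suc i)" using y dC by (auto simp: power_torsion_def)
      fix x assume x: "x \<in> S"
      obtain n where n: "(x [^]\<^bsub>R\<^esub> (n::nat)) \<odot>\<^bsub>E i\<^esub> y = \<zero>\<^bsub>E i\<^esub>"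
        using y x by (auto simp: power_torsion_def)
      have "x \<in> carrier R" "y \<in> carrier (E i)"
        using x S y c(1) by (auto simp: power_torsion_def)
      then have "(x [^]\<^bsub>R\<^esub> n) \<odot>\<^bsub>E (Suc i)\<^esub> d i y = d i \<zero>\<^bsub>E i\<^esub>"
        using n by (simp add: h(3)[symmetric])
      then show "\<exists>n. (x [^]\<^bsub>R\<^esub> (n::nat)) \<odot>\<^bsub>E (Suc i)\<^esub> d i y = \<zero>\<^bsub>E (Suc i)\<^esub>"
        using mod_hom_zero[OF module module hom] by auto
    qed
  qed
  fix y z
  assume y: "y \<in> power_torsion S C i" and z: "z \<in> carrier (E i)"
    and ann: "\<forall>r\<in>carrier R. r \<odot>\<^bsub>E i\<^esub> y = \<zero>\<^bsub>E i\<^esub> \<longrightarrow> r \<odot>\<^bsub>E i\<^esub> z = \<zero>\<^bsub>E i\<^esub>"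
  have "z \<in> C i" using C y z ann by (auto simp: ann_closed_subcomplex_def power_torsion_def)
  moreover have "\<exists>n. (x [^]\<^bsub>R\<^esub> (n::nat)) \<odot>\<^bsub>E i\<^esub> z = \<zero>\<^bsub>E i\<^esub>" if x: "x \<in> S" for x
  proof -
    obtain n where "(x [^]\<^bsub>R\<^esub> (n::nat)) \<odot>\<^bsub>E i\<^esub> y = \<zero>\<^bsub>E i\<^esub>"
      using y x by (auto simp: power_torsion_def)
    moreover have "x [^]\<^bsub>R\<^esub> n \<in> carrier R" using x S by auto
    ultimately show ?thesis using ann by blast
  qed
  ultimately show "z \<in> power_torsion S C i" by (auto simp: power_torsion_def)
qed

text \<open>This is the single step of the comparison: \<open>x\<^sup>m y = d u\<close> for some \<open>m\<close>, and if \<open>t = x\<^sup>m z - u\<close> is \<open>x\<close>-torsion,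
  then so is \<open>y' = y - d z\<close>, because \<open>x\<^sup>m y' = - d t\<close>. In degree \<open>0\<close> there
  are no boundaries but \<open>0\<close>, and \<open>y\<close> itself is \<open>x\<close>-torsion.\<close>

lemma torsion_boundary_has_torsion_preimage:
  assumes C: "ann_closed_subcomplex C" and x: "x \<in> carrier R"
    and tors: "\<And>z. \<lbrakk>z \<in> C j; d j z = \<zero>\<^bsub>E (Suc j)\<^esub>\<rbrakk> \<Longrightarrow> \<exists>n. (x [^]\<^bsub>R\<^esub> (n::nat)) \<odot>\<^bsub>E j\<^esub> z \<in> boundaries C j"
    and y: "y \<in> C j" and dy: "d j y \<in> power_torsion {x} C (Suc j)"
  shows "\<exists>y' \<in> power_torsion {x} C j. d j y' = d j y"
proof -
  have Cs: "submodule (C i) R (E i)" and dC: "d i ` C i \<subseteq> C (Suc i)" for i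
    using C by (auto simp: ann_closed_subcomplex_def)
  note c = submoduleD[OF module Cs]
  interpret Ej: module R "E j" by (rule module)
  have yc: "y \<in> carrier (E j)" using y c(1) by blast
  obtain n where n: "(x [^]\<^bsub>R\<^esub> (n::nat)) \<odot>\<^bsub>E (Suc j)\<^esub> d j y = \<zero>\<^bsub>E (Suc j)\<^esub>"
    using dy by (auto simp: power_torsion_def)
  have "d j ((x [^]\<^bsub>R\<^esub> n) \<odot>\<^bsub>E j\<^esub> y) = \<zero>\<^bsub>E (Suc j)\<^esub>"
    using n mod_homD(3)[OF hom] yc x by simp
  then obtain k where k: "(x [^]\<^bsub>R\<^esub> (k::nat)) \<odot>\<^bsub>E j\<^esub> ((x [^]\<^bsub>R\<^esub> n) \<odot>\<^bsub>E j\<^esub> y) \<in> boundaries C j"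
    using tors[of "(x [^]\<^bsub>R\<^esub> n) \<odot>\<^bsub>E j\<^esub> y"] c(6)[of "x [^]\<^bsub>R\<^esub> n" y] y x by auto
  define m where "m = k + n"
  have m: "(x [^]\<^bsub>R\<^esub> m) \<odot>\<^bsub>E j\<^esub> y \<in> boundaries C j"
    using k x yc by (simp add: m_def Ej.R.nat_pow_mult[symmetric] Ej.smult_assoc1)
  show ?thesis
  proof (cases j)
    case 0
    then have "(x [^]\<^bsub>R\<^esub> m) \<odot>\<^bsub>E j\<^esub> y = \<zero>\<^bsub>E j\<^esub>" using m by (simp add: boundaries_def)
    then show ?thesis using y by (auto simp: power_torsion_def)
  next
    case (Suc i)
    interpret Ei: module R "E i" by (rule module)
    obtain u where u: "u \<in> C i" "(x [^]\<^bsub>R\<^esub> m) \<odot>\<^bsub>E j\<^esub> y = d i u"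
      using m Suc by (auto simp: boundaries_def)
    have uc: "u \<in> carrier (E i)" using u c(1) by blast
    have xm: "x [^]\<^bsub>R\<^esub> m \<in> carrier R" using x by simp
    \<comment> \<open>Division is applied to \<open>x\<^sup>m\<close> in place of \<open>x\<close>, so that all \<open>m\<close> factors are split off at once.\<close>
    obtain q z where z: "z \<in> carrier (E i)"
        "((x [^]\<^bsub>R\<^esub> m) [^]\<^bsub>R\<^esub> Suc q) \<odot>\<^bsub>E i\<^esub> z = ((x [^]\<^bsub>R\<^esub> m) [^]\<^bsub>R\<^esub> (q::nat)) \<odot>\<^bsub>E i\<^esub> u"
        "\<forall>r \<in> carrier R. r \<odot>\<^bsub>E i\<^esub> u = \<zero>\<^bsub>E i\<^esub> \<longrightarrow> r \<odot>\<^bsub>E i\<^esub> z = \<zero>\<^bsub>E i\<^esub>"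
      using division[OF xm uc] by blast
    have zC: "z \<in> C i" using C z u by (auto simp: ann_closed_subcomplex_def)
    define t where "t = (x [^]\<^bsub>R\<^esub> m) \<odot>\<^bsub>E i\<^esub> z \<ominus>\<^bsub>E i\<^esub> u"
    have tc: "t \<in> carrier (E i)" unfolding t_def using xm z(1) uc by simp
    have "(x [^]\<^bsub>R\<^esub> (m * q)) \<odot>\<^bsub>E i\<^esub> t
        = ((x [^]\<^bsub>R\<^esub> m) [^]\<^bsub>R\<^esub> Suc q) \<odot>\<^bsub>E i\<^esub> z \<ominus>\<^bsub>E i\<^esub> ((x [^]\<^bsub>R\<^esub> m) [^]\<^bsub>R\<^esub> q) \<odot>\<^bsub>E i\<^esub> u"
      unfolding t_def using x z(1) uc
      by (simp add: Ej.R.nat_pow_pow Ei.M.minus_eq Ei.smult_r_distr Ei.smult_r_minus Ei.smult_assoc1)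
    also have "\<dots> = \<zero>\<^bsub>E i\<^esub>" unfolding z(2) using x uc by (simp add: Ei.M.minus_eq Ei.M.r_neg)
    finally have t0: "(x [^]\<^bsub>R\<^esub> (m * q)) \<odot>\<^bsub>E i\<^esub> t = \<zero>\<^bsub>E i\<^esub>" .
    have hi: "d i \<in> mod_hom R (E i) (E j)" using hom[of i] Suc by simp
    note hh = mod_homD[OF hi]
    define y' where "y' = y \<ominus>\<^bsub>E j\<^esub> d i z"
    have dz: "d i z \<in> C j" using zC dC[of i] Suc by auto
    then have dzc: "d i z \<in> carrier (E j)" using c(1) by blast
    have y'C: "y' \<in> C j" unfolding y'_def using c(4) y dz by simp
    have "(x [^]\<^bsub>R\<^esub> m) \<odot>\<^bsub>E j\<^esub> y' = d i u \<ominus>\<^bsub>E j\<^esub> d i ((x [^]\<^bsub>R\<^esub> m) \<odot>\<^bsub>E i\<^esub> z)"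
      unfolding y'_def u(2)[symmetric] using hh(3)[OF xm z(1)] xm yc dzc
      by (simp add: Ej.M.minus_eq Ej.smult_r_distr Ej.smult_r_minus)
    also have "\<dots> = \<ominus>\<^bsub>E j\<^esub> d i t"
      unfolding t_def using mod_hom_minus[OF module module hi] hh(1) uc z(1) xm
      by (simp add: Ej.M.minus_eq Ej.M.minus_add Ej.M.a_comm)
    finally have "(x [^]\<^bsub>R\<^esub> (m * q)) \<odot>\<^bsub>E j\<^esub> ((x [^]\<^bsub>R\<^esub> m) \<odot>\<^bsub>E j\<^esub> y')
        = \<ominus>\<^bsub>E j\<^esub> d i ((x [^]\<^bsub>R\<^esub> (m * q)) \<odot>\<^bsub>E i\<^esub> t)"
      using hh(1,3) tc x by (simp add: Ej.smult_r_minus)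
    also have "\<dots> = \<zero>\<^bsub>E j\<^esub>"
      using t0 mod_hom_zero[OF module module hi] Ej.M.diff_zero[of "\<zero>\<^bsub>E j\<^esub>"]
      by (simp add: Ej.M.minus_eq)
    finally have "(x [^]\<^bsub>R\<^esub> (m * q + m)) \<odot>\<^bsub>E j\<^esub> y' = \<zero>\<^bsub>E j\<^esub>"
      using x c(1)[OF y'C] by (simp add: Ej.R.nat_pow_mult[symmetric] Ej.smult_assoc1)
    then have "y' \<in> power_torsion {x} C j" using y'C by (auto simp: power_torsion_def)
    moreover have "d j y' = d j y"
    proof -
      interpret Es: module R "E (Suc j)" by (rule module)
      have "d j y' = d j y \<ominus>\<^bsub>E (Suc j)\<^esub> d j (d i z)"
        unfolding y'_def by (rule mod_hom_minus[OF module module hom yc dzc])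
      also have "d j (d i z) = \<zero>\<^bsub>E (Suc j)\<^esub>" using dd[OF z(1)] Suc by simp
      finally show ?thesis using mod_homD(1)[OF hom yc] by (simp add: Es.M.diff_zero)
    qed
    ultimately show ?thesis by blast
  qed
qed

text \<open>Induction over \<open>S\<close>. The conclusion for \<open>S\<close> itself shows that the cohomology of the subcomplex obtained so far is still
  torsion for the next \<open>x\<close>, in the same range of degrees: a multiple of a cycle that is a boundary
  in \<open>C\<close> is a boundary in the subcomplex.\<close>

lemma power_torsion_boundaries:
  assumes "finite S" and "S \<subseteq> carrier R" and C: "ann_closed_subcomplex C"
    and tors: "\<And>x j z. \<lbrakk>x \<in> S; j < t; z \<in> C j; d j z = \<zero>\<^bsub>E (Suc j)\<^esub>\<rbrakk>
      \<Longrightarrow> \<exists>n. (x [^]\<^bsub>R\<^esub> (n::nat)) \<odot>\<^bsub>E j\<^esub> z \<in> boundaries C j"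
    and "i < t"
  shows "power_torsion S C i \<inter> boundaries C i \<subseteq> boundaries (power_torsion S C) i"
  using assms(1,2,4,5)
proof (induction S arbitrary: i rule: finite_induct)
  case empty
  have "power_torsion {} C = C" by (auto simp: power_torsion_def)
  then show ?case by simp
next
  case (insert x S)
  define T where "T = power_torsion S C"
  have S: "S \<subseteq> carrier R" and x: "x \<in> carrier R" using insert.prems(1) by auto
  have T: "ann_closed_subcomplex T"
    unfolding T_def by (rule ann_closed_subcomplex_power_torsion[OF C S])
  have IH: "T i \<inter> boundaries C i \<subseteq> boundaries T i" if "i < t" for i
    unfolding T_def using insert.IH[OF S _ that] insert.prems(2) by blast
  have torsT: "\<exists>n. (x [^]\<^bsub>R\<^esub> (n::nat)) \<odot>\<^bsub>E j\<^esub> z \<in> boundaries T j"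
    if jz: "j < t" "z \<in> T j" "d j z = \<zero>\<^bsub>E (Suc j)\<^esub>" for j z
  proof -
    obtain n where "(x [^]\<^bsub>R\<^esub> (n::nat)) \<odot>\<^bsub>E j\<^esub> z \<in> boundaries C j"
      using insert.prems(2)[of x j z] jz by (auto simp: T_def power_torsion_def)
    moreover have "(x [^]\<^bsub>R\<^esub> n) \<odot>\<^bsub>E j\<^esub> z \<in> T j"
    proof -
      have "submodule (T j) R (E j)" using T by (auto simp: ann_closed_subcomplex_def)
      moreover interpret Ej: module R "E j" by (rule module)
      have "x [^]\<^bsub>R\<^esub> n \<in> carrier R" using x by simp
      ultimately show ?thesis using submoduleD(6)[OF module] jz(2) by blast
    qed
    ultimately show ?thesis using IH jz(1) by blast
  qed
  show ?case
  proof
    fix w assume "w \<in> power_torsion (insert x S) C i \<inter> boundaries C i"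
    then have w: "w \<in> power_torsion {x} T i" "w \<in> T i" "w \<in> boundaries C i"
      unfolding T_def by (auto simp: power_torsion_def)
    then have wT: "w \<in> boundaries T i" using IH insert.prems(3) by blast
    show "w \<in> boundaries (power_torsion (insert x S) C) i"
    proof (cases i)
      case 0
      then show ?thesis using wT by (simp add: boundaries_def)
    next
      case (Suc j)
      then obtain y where y: "y \<in> T j" "w = d j y" using wT by (auto simp: boundaries_def)
      have "j < t" using insert.prems(3) Suc by simp
      then obtain y' where "y' \<in> power_torsion {x} T j" "d j y' = d j y"
        using torsion_boundary_has_torsion_preimage[OF T x torsT y(1)] w(1) y(2) Suc by blast
      then have "w \<in> d j ` power_torsion {x} T j" using y(2) by (metis imageI)
      then show ?thesis by (simp add: Suc boundaries_def power_torsion_insert[of x S] T_def)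
    qed
  qed
qed

end

section \<open>Cohomology of torsion subcomplexes\<close>

context divisible_complex
begin

definition cycles :: "(nat \<Rightarrow> 'u set) \<Rightarrow> nat \<Rightarrow> 'u set" where
  "cycles C i = {y \<in> C i. d i y = \<zero>\<^bsub>E (Suc i)\<^esub>}"

lemma subcomplexD:
  assumes "ann_closed_subcomplex C"
  shows "submodule (C i) R (E i)" and "y \<in> C i \<Longrightarrow> d i y \<in> C (Suc i)"
  using assms by (auto simp: ann_closed_subcomplex_def)

lemma submodule_cycles:
  assumes "ann_closed_subcomplex C"
  shows "submodule (cycles C i) R (E i)"
proof -
  interpret Ei: module R "E i" by (rule module)
  interpret Es: module R "E (Suc i)" by (rule module)
  note c = submoduleD[OF module subcomplexD(1)[OF assms]] and h = mod_homD[OF hom[of i]]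
  show ?thesis
  proof (rule Ei.submoduleI)
    show "cycles C i \<subseteq> carrier (E i)" using c(1) by (auto simp: cycles_def)
    show "\<zero>\<^bsub>E i\<^esub> \<in> cycles C i" using c(2) mod_hom_zero[OF module module hom] by (simp add: cycles_def)
    show "\<ominus>\<^bsub>E i\<^esub> a \<in> cycles C i" if a: "a \<in> cycles C i" for a
    proof -
      have "a \<in> C i" "a \<in> carrier (E i)" "d i a = \<zero>\<^bsub>E (Suc i)\<^esub>"
        using a c(1) by (auto simp: cycles_def)
      moreover have "\<zero>\<^bsub>E i\<^esub> \<ominus>\<^bsub>E i\<^esub> a = \<ominus>\<^bsub>E i\<^esub> a" using calculation by (simp add: Ei.M.minus_eq)
      moreover have "d i (\<zero>\<^bsub>E i\<^esub> \<ominus>\<^bsub>E i\<^esub> a) = \<zero>\<^bsub>E (Suc i)\<^esub>"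
        using mod_hom_minus[OF module module hom, of "\<zero>\<^bsub>E i\<^esub>" i a] mod_hom_zero[OF module module hom] calculation
        by (simp add: Es.M.diff_zero)
      ultimately show ?thesis using c(5) by (simp add: cycles_def)
    qed
    show "a \<oplus>\<^bsub>E i\<^esub> b \<in> cycles C i" if "a \<in> cycles C i" "b \<in> cycles C i" for a b
      using that c(1,3) h(2) by (simp add: cycles_def)
    show "r \<odot>\<^bsub>E i\<^esub> a \<in> cycles C i" if "r \<in> carrier R" "a \<in> cycles C i" for r a
      using that c(1,6) h(3) by (simp add: cycles_def)
  qed
qed

lemma submodule_boundaries:
  assumes C: "ann_closed_subcomplex C"
  shows "submodule (boundaries C i) R (E i)" and "boundaries C i \<subseteq> cycles C i"
proof -
  interpret Ei: module R "E i" by (rule module)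
  show "submodule (boundaries C i) R (E i)"
  proof (cases i)
    case 0
    have "submodule {\<zero>\<^bsub>E i\<^esub>} R (E i)" by (rule Ei.submoduleI) auto
    then show ?thesis using 0 by (simp add: boundaries_def)
  next
    case (Suc j)
    then show ?thesis
      using submodule_image[OF module module hom subcomplexD(1)[OF C], of j] by (simp add: boundaries_def)
  qed
  show "boundaries C i \<subseteq> cycles C i"
  proof (cases i)
    case 0
    then show ?thesis
      using submoduleD(2)[OF module submodule_cycles[OF C, of 0]] by (simp add: boundaries_def)
  next
    case (Suc j)
    then show ?thesis
      using subcomplexD(2)[OF C] submoduleD(1)[OF module subcomplexD(1)[OF C]] dd
      by (auto simp: boundaries_def cycles_def)
  qed
qed

definition cohomology_of :: "(nat \<Rightarrow> 'u set) \<Rightarrow> nat \<Rightarrow> ('a, 'u set) module" where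
  "cohomology_of C i = quot_module ((E i)\<lparr>carrier := cycles C i\<rparr>) (boundaries C i)"

lemma cohomology_of:
  assumes C: "ann_closed_subcomplex C"
  obtains p where "module R (cohomology_of C i)"
    and "module R ((E i)\<lparr>carrier := cycles C i\<rparr>)"
    and "p \<in> mod_hom R ((E i)\<lparr>carrier := cycles C i\<rparr>) (cohomology_of C i)"
    and "p ` cycles C i = carrier (cohomology_of C i)"
    and "\<forall>z \<in> cycles C i. p z = \<zero>\<^bsub>cohomology_of C i\<^esub> \<longleftrightarrow> z \<in> boundaries C i"
proof -
  let ?Z = "(E i)\<lparr>carrier := cycles C i\<rparr>"
  have Z: "module R ?Z"
    by (rule submodule.submodule_is_module[OF submodule_cycles[OF C] module])
  have B: "submodule (boundaries C i) R ?Z"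
    by (rule submodule_restrict[OF module submodule_cycles[OF C] submodule_boundaries[OF C]])
  note q = quot_module[OF Z B, folded cohomology_of_def]
  show thesis
  proof (rule that[OF q(1) Z q(2)])
    show "(\<lambda>z. boundaries C i +>\<^bsub>?Z\<^esub> z) ` cycles C i = carrier (cohomology_of C i)"
      using q(3) by simp
    show "\<forall>z \<in> cycles C i. boundaries C i +>\<^bsub>?Z\<^esub> z = \<zero>\<^bsub>cohomology_of C i\<^esub> \<longleftrightarrow> z \<in> boundaries C i"
      using q(4) unfolding hom_ker_def by auto
  qed
qed

lemma finite_length_imp_torsion_modulo_boundaries:
  assumes noeth: "noetherian_ring R" and loc: "local_ring R \<mm>" and x: "x \<in> \<mm>"
    and C: "ann_closed_subcomplex C" and fin: "finite_length R (cohomology_of C i)"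
    and z: "z \<in> C i" "d i z = \<zero>\<^bsub>E (Suc i)\<^esub>"
  shows "\<exists>n. (x [^]\<^bsub>R\<^esub> (n::nat)) \<odot>\<^bsub>E i\<^esub> z \<in> boundaries C i"
proof -
  interpret Ei: module R "E i" by (rule module)
  have zc: "z \<in> cycles C i" using z by (simp add: cycles_def)
  have "\<mm> \<subseteq> carrier R"
    using loc by (auto simp: local_ring_def maximalideal_def dest: ideal.Icarr)
  then have xc: "x \<in> carrier R" using x by blast
  obtain p where p: "p \<in> mod_hom R ((E i)\<lparr>carrier := cycles C i\<rparr>) (cohomology_of C i)"
    and ker: "\<forall>z \<in> cycles C i. p z = \<zero>\<^bsub>cohomology_of C i\<^esub> \<longleftrightarrow> z \<in> boundaries C i"
    using cohomology_of[OF C] by metis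
  have "p z \<in> carrier (cohomology_of C i)" using mod_homD(1)[OF p] zc by simp
  then obtain n where n: "(x [^]\<^bsub>R\<^esub> (n::nat)) \<odot>\<^bsub>cohomology_of C i\<^esub> p z = \<zero>\<^bsub>cohomology_of C i\<^esub>"
    using finite_length_imp_torsion[OF noeth loc x fin] by blast
  have xn: "x [^]\<^bsub>R\<^esub> n \<in> carrier R" using xc by simp
  have "p ((x [^]\<^bsub>R\<^esub> n) \<odot>\<^bsub>E i\<^esub> z) = \<zero>\<^bsub>cohomology_of C i\<^esub>"
    using mod_homD(3)[OF p xn, of z] zc n by simp
  moreover have "(x [^]\<^bsub>R\<^esub> n) \<odot>\<^bsub>E i\<^esub> z \<in> cycles C i"
    by (rule submoduleD(6)[OF module submodule_cycles[OF C] xn zc])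
  ultimately show ?thesis using ker by blast
qed

text \<open>The hypothesis \<open>inj\<close> says that the map on cohomology induced by the inclusion of \<open>T\<close> in \<open>C\<close> is
  injective in degree \<open>i\<close>.\<close>

lemma finite_length_subcomplex:
  assumes T: "ann_closed_subcomplex T" and C: "ann_closed_subcomplex C" and sub: "\<And>j. T j \<subseteq> C j"
    and inj: "T i \<inter> boundaries C i \<subseteq> boundaries T i"
    and fin: "finite_length R (cohomology_of C i)"
  shows "finite_length R (cohomology_of T i)"
proof -
  obtain p where p: "module R (cohomology_of T i)" "module R ((E i)\<lparr>carrier := cycles T i\<rparr>)"
      "p \<in> mod_hom R ((E i)\<lparr>carrier := cycles T i\<rparr>) (cohomology_of T i)"
      "p ` cycles T i = carrier (cohomology_of T i)"
      "\<forall>z \<in> cycles T i. p z = \<zero>\<^bsub>cohomology_of T i\<^esub> \<longleftrightarrow> z \<in> boundaries T i"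
    by (rule cohomology_of[OF T, of i])
  obtain q where q: "module R (cohomology_of C i)" "module R ((E i)\<lparr>carrier := cycles C i\<rparr>)"
      "q \<in> mod_hom R ((E i)\<lparr>carrier := cycles C i\<rparr>) (cohomology_of C i)"
      "q ` cycles C i = carrier (cohomology_of C i)"
      "\<forall>z \<in> cycles C i. q z = \<zero>\<^bsub>cohomology_of C i\<^esub> \<longleftrightarrow> z \<in> boundaries C i"
    by (rule cohomology_of[OF C, of i])
  have cyc: "cycles T i \<subseteq> cycles C i" using sub by (auto simp: cycles_def)
  have "boundaries T i \<subseteq> boundaries C i"
    using sub by (auto simp: boundaries_def split: nat.splits)
  then have bd: "z \<in> boundaries C i \<longleftrightarrow> z \<in> boundaries T i" if "z \<in> cycles T i" for z
    using inj that by (auto simp: cycles_def)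
  have g: "q \<in> mod_hom R ((E i)\<lparr>carrier := cycles T i\<rparr>) (cohomology_of C i)"
    by (rule mod_homI) (use mod_homD[OF q(3)] cyc in \<open>simp_all add: subset_iff\<close>)
  have "hom_ker ((E i)\<lparr>carrier := cycles T i\<rparr>) (cohomology_of C i) q
      = hom_ker ((E i)\<lparr>carrier := cycles T i\<rparr>) (cohomology_of T i) p"
  proof -
    have "q z = \<zero>\<^bsub>cohomology_of C i\<^esub> \<longleftrightarrow> p z = \<zero>\<^bsub>cohomology_of T i\<^esub>" if "z \<in> cycles T i" for z
      using p(5) q(5) cyc bd[OF that] that by blast
    then show ?thesis by (simp add: hom_ker_def cong: conj_cong)
  qed
  then obtain f where "f \<in> mod_hom R (cohomology_of T i) (cohomology_of C i)"
      "inj_on f (carrier (cohomology_of T i))"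
    using injective_factorization[OF p(2,1) q(1) p(3) _ g] p(4) by auto
  then show ?thesis using finite_length_inj[OF p(1)] fin by blast
qed

end

section \<open>Torsion with respect to powers of an ideal\<close>

lemma ideal_ideal_power:
  assumes "cring R" and "ideal I R"
  shows "ideal (ideal_power R I n) R"
proof -
  interpret cring R by fact
  show ?thesis
    by (induction n) (simp_all add: oneideal ideal_prod_is_ideal assms(2))
qed

lemma power_in_ideal_power:
  assumes "cring R" and "ideal I R" and "x \<in> I"
  shows "x [^]\<^bsub>R\<^esub> n \<in> ideal_power R I n"
proof -
  interpret cring R by fact
  have x: "x \<in> carrier R" using assms(2,3) by (rule ideal.Icarr)
  show ?thesis
  proof (induction n)
    case (Suc n)
    have "x [^]\<^bsub>R\<^esub> Suc n = x \<otimes>\<^bsub>R\<^esub> x [^]\<^bsub>R\<^esub> n" using x by (simp add: m_comm)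
    then show ?case using ideal_prod.prod[OF assms(3) Suc] by simp
  qed simp
qed

lemma ideal_prod_mono:
  assumes "I \<subseteq> I'" and "J \<subseteq> J'"
  shows "ideal_prod R I J \<subseteq> ideal_prod R I' J'"
proof
  fix x assume "x \<in> ideal_prod R I J"
  then show "x \<in> ideal_prod R I' J'"
    by induction (use assms in \<open>auto intro: ideal_prod.intros\<close>)
qed

lemma ideal_power_mono_base:
  assumes "I \<subseteq> J"
  shows "ideal_power R I n \<subseteq> ideal_power R J n"
  by (induction n) (simp_all add: ideal_prod_mono assms)

fun word_prod :: "('a, 'r) ring_scheme \<Rightarrow> 'a list \<Rightarrow> 'a" where
  "word_prod R [] = \<one>\<^bsub>R\<^esub>"
| "word_prod R (x # xs) = x \<otimes>\<^bsub>R\<^esub> word_prod R xs"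

lemma word_prod_closed:
  assumes "cring R" and "set w \<subseteq> carrier R"
  shows "word_prod R w \<in> carrier R"
proof -
  interpret cring R by fact
  show ?thesis using assms(2) by (induction w) auto
qed

lemma word_prod_split:
  assumes "cring R" and "set w \<subseteq> carrier R" and "x \<in> carrier R"
  shows "word_prod R w = x [^]\<^bsub>R\<^esub> count_list w x \<otimes>\<^bsub>R\<^esub> word_prod R (filter (\<lambda>y. y \<noteq> x) w)"
proof -
  interpret cring R by fact
  show ?thesis
    using assms(2)
  proof (induction w)
    case (Cons y w)
    have c: "word_prod R (filter (\<lambda>y. y \<noteq> x) w) \<in> carrier R"
      using Cons.prems by (intro word_prod_closed[OF assms(1)]) auto
    show ?case
    proof (cases "y = x")
      case True
      then show ?thesis using Cons c assms(3) by (simp add: m_ac)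
    next
      case False
      then show ?thesis using Cons c assms(3) m_lcomm[of y] by simp
    qed
  qed simp
qed

text \<open>Pigeonhole principle: a long word in the generators contains one of them many times.\<close>

lemma long_words_in_ideal:
  assumes R: "cring R" and J: "ideal J R" and "finite S" and "S \<subseteq> carrier R"
    and "\<And>x. x \<in> S \<Longrightarrow> \<exists>n. x [^]\<^bsub>R\<^esub> (n::nat) \<in> J"
  shows "\<exists>N. \<forall>w. set w \<subseteq> S \<longrightarrow> N \<le> length w \<longrightarrow> word_prod R w \<in> J"
  using assms(3-5)
proof (induction S rule: finite_induct)
  case empty
  show ?case by (rule exI[of _ 1]) auto
next
  case (insert x S)
  interpret cring R by fact
  interpret J: ideal J R by fact
  obtain N where N: "\<And>w. \<lbrakk>set w \<subseteq> S; N \<le> length w\<rbrakk> \<Longrightarrow> word_prod R w \<in> J"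
    using insert.IH insert.prems by auto
  obtain n where n: "x [^]\<^bsub>R\<^esub> (n::nat) \<in> J" using insert.prems(2) by blast
  have x: "x \<in> carrier R" using insert.prems(1) by blast
  have "word_prod R w \<in> J" if w: "set w \<subseteq> insert x S" and len: "N + n \<le> length w" for w
  proof -
    let ?w' = "filter (\<lambda>y. y \<noteq> x) w" and ?k = "count_list w x"
    have wc: "set w \<subseteq> carrier R" using w insert.prems(1) by blast
    then have w'c: "word_prod R ?w' \<in> carrier R" by (intro word_prod_closed[OF R]) auto
    have "length w = ?k + length ?w'" by (induction w) auto
    then consider "N \<le> length ?w'" | "n \<le> ?k" using len by linarith
    then have "x [^]\<^bsub>R\<^esub> ?k \<otimes>\<^bsub>R\<^esub> word_prod R ?w' \<in> J"
    proof cases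
      case 1
      have "set ?w' \<subseteq> S" using w by auto
      then show ?thesis using N[OF _ 1] J.I_l_closed x by simp
    next
      case 2
      then have "x [^]\<^bsub>R\<^esub> ?k = x [^]\<^bsub>R\<^esub> n \<otimes>\<^bsub>R\<^esub> x [^]\<^bsub>R\<^esub> (?k - n)" using x by (simp add: nat_pow_mult)
      then show ?thesis using J.I_r_closed n x w'c by simp
    qed
    then show ?thesis using word_prod_split[OF R wc x] by simp
  qed
  then show ?case by blast
qed

text \<open>The words of length \<open>n\<close> generate the \<open>n\<close>-th power. In the induction step one divides \<open>J\<close> by
  a generator \<open>s\<close>: the ideal \<open>J : s\<close> contains all words that are shorter by one letter.\<close>

lemma ideal_power_subset_if_words:
  assumes R: "cring R" and S: "S \<subseteq> carrier R" and J: "ideal J R"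
    and words: "\<And>w. \<lbrakk>set w \<subseteq> S; length w = n\<rbrakk> \<Longrightarrow> word_prod R w \<in> J"
  shows "ideal_power R (Idl\<^bsub>R\<^esub> S) n \<subseteq> J"
  using J words
proof (induction n arbitrary: J)
  case 0
  interpret J: ideal J R by fact
  have "\<one>\<^bsub>R\<^esub> \<in> J" using "0.prems"(2)[of "[]"] by simp
  then show ?case using J.one_imp_carrier by simp
next
  case (Suc n)
  interpret cring R by fact
  interpret J: ideal J R by fact
  let ?P = "ideal_power R (Idl\<^bsub>R\<^esub> S) n"
  interpret P: ideal ?P R by (rule ideal_ideal_power[OF R genideal_ideal[OF S]])
  have colon: "ideal {b \<in> carrier R. \<forall>a\<in>T. a \<otimes>\<^bsub>R\<^esub> b \<in> J} R" if T: "T \<subseteq> carrier R" for T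
  proof (rule idealI)
    show "ring R" by (rule ring_axioms)
    let ?H = "{b \<in> carrier R. \<forall>a\<in>T. a \<otimes>\<^bsub>R\<^esub> b \<in> J}"
    have Tc: "a \<in> carrier R" if "a \<in> T" for a using T that by blast
    show "subgroup ?H (add_monoid R)"
    proof (rule add.subgroupI)
      have "\<zero>\<^bsub>R\<^esub> \<in> ?H" using Tc J.zero_closed by simp
      then show "?H \<noteq> {}" by blast
      show "\<ominus>\<^bsub>R\<^esub> b \<in> ?H" if "b \<in> ?H" for b
        using that Tc J.a_inv_closed by (simp add: r_minus)
      show "b \<oplus>\<^bsub>R\<^esub> c \<in> ?H" if "b \<in> ?H" "c \<in> ?H" for b c
        using that Tc J.a_closed by (simp add: r_distr)
    qed blast
  next
    fix b x assume b: "b \<in> {b \<in> carrier R. \<forall>a\<in>T. a \<otimes>\<^bsub>R\<^esub> b \<in> J}" and x: "x \<in> carrier R"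
    have "a \<otimes>\<^bsub>R\<^esub> (b \<otimes>\<^bsub>R\<^esub> x) \<in> J" if a: "a \<in> T" for a
    proof -
      have "a \<otimes>\<^bsub>R\<^esub> (b \<otimes>\<^bsub>R\<^esub> x) = (a \<otimes>\<^bsub>R\<^esub> b) \<otimes>\<^bsub>R\<^esub> x" using a b x T by (auto simp: m_assoc)
      then show ?thesis using J.I_r_closed a b x by simp
    qed
    then show "b \<otimes>\<^bsub>R\<^esub> x \<in> {b \<in> carrier R. \<forall>a\<in>T. a \<otimes>\<^bsub>R\<^esub> b \<in> J}" using b x by simp
    then show "x \<otimes>\<^bsub>R\<^esub> b \<in> {b \<in> carrier R. \<forall>a\<in>T. a \<otimes>\<^bsub>R\<^esub> b \<in> J}" using b x m_comm[of x b] by simp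
  qed
  have gen: "s \<otimes>\<^bsub>R\<^esub> b \<in> J" if s: "s \<in> S" and b: "b \<in> ?P" for s b
  proof -
    have "?P \<subseteq> {b \<in> carrier R. \<forall>a\<in>{s}. a \<otimes>\<^bsub>R\<^esub> b \<in> J}"
    proof (rule Suc.IH)
      show "ideal {b \<in> carrier R. \<forall>a\<in>{s}. a \<otimes>\<^bsub>R\<^esub> b \<in> J} R" using colon s S by blast
      fix w assume w: "set w \<subseteq> S" "length w = n"
      then have "word_prod R (s # w) \<in> J" using Suc.prems(2)[of "s # w"] s by simp
      then show "word_prod R w \<in> {b \<in> carrier R. \<forall>a\<in>{s}. a \<otimes>\<^bsub>R\<^esub> b \<in> J}"
        using word_prod_closed[OF R] w S by auto
    qed
    then show ?thesis using b by blast
  qed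
  have "Idl\<^bsub>R\<^esub> S \<subseteq> {b \<in> carrier R. \<forall>a\<in>?P. a \<otimes>\<^bsub>R\<^esub> b \<in> J}"
  proof (rule genideal_minimal)
    show "ideal {b \<in> carrier R. \<forall>a\<in>?P. a \<otimes>\<^bsub>R\<^esub> b \<in> J} R" by (rule colon) (rule P.a_subset)
    show "S \<subseteq> {b \<in> carrier R. \<forall>a\<in>?P. a \<otimes>\<^bsub>R\<^esub> b \<in> J}"
    proof (intro subsetI CollectI conjI ballI)
      fix s a assume "s \<in> S" and "a \<in> ?P"
      then show "a \<otimes>\<^bsub>R\<^esub> s \<in> J" using gen m_comm[of a s] S P.Icarr by auto
    qed (use S in blast)
  qed
  then have mult: "i \<otimes>\<^bsub>R\<^esub> j \<in> J" if "i \<in> Idl\<^bsub>R\<^esub> S" "j \<in> ?P" for i j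
  proof -
    have "i \<in> carrier R" "j \<otimes>\<^bsub>R\<^esub> i \<in> J" "j \<in> carrier R"
      using \<open>Idl\<^bsub>R\<^esub> S \<subseteq> _\<close> that P.Icarr by auto
    then show ?thesis using m_comm by simp
  qed
  show ?case
  proof
    fix x assume "x \<in> ideal_power R (Idl\<^bsub>R\<^esub> S) (Suc n)"
    then have "x \<in> ideal_prod R (Idl\<^bsub>R\<^esub> S) ?P" by simp
    then show "x \<in> J" by induction (use mult J.a_closed in auto)
  qed
qed

text \<open>If powers of the generators lie in the ideal \<open>ann y\<close>, then so do all long words in them, and hence a power of
  the ideal.\<close>

lemma ideal_power_kills_iff:
  assumes M: "module R M" and S: "finite S" "S \<subseteq> carrier R" and y: "y \<in> carrier M"
  shows "(\<exists>n. \<forall>r \<in> ideal_power R (Idl\<^bsub>R\<^esub> S) n. r \<odot>\<^bsub>M\<^esub> y = \<zero>\<^bsub>M\<^esub>) \<longleftrightarrow>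
    (\<forall>x \<in> S. \<exists>n. (x [^]\<^bsub>R\<^esub> (n::nat)) \<odot>\<^bsub>M\<^esub> y = \<zero>\<^bsub>M\<^esub>)" (is "?L \<longleftrightarrow> ?R")
proof
  interpret M: module R M by fact
  have I: "ideal (Idl\<^bsub>R\<^esub> S) R" by (rule M.R.genideal_ideal[OF S(2)])
  {
    assume ?L
    then obtain n where n: "\<And>r. r \<in> ideal_power R (Idl\<^bsub>R\<^esub> S) n \<Longrightarrow> r \<odot>\<^bsub>M\<^esub> y = \<zero>\<^bsub>M\<^esub>" by blast
    show ?R
      using n[OF power_in_ideal_power[OF M.R.is_cring I]] M.R.genideal_self[OF S(2)] by blast
  next
    assume R: ?R
    let ?J = "{r \<in> carrier R. r \<odot>\<^bsub>M\<^esub> y = \<zero>\<^bsub>M\<^esub>}"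
    have J: "ideal ?J R" by (rule ideal_annihilator_of_element[OF M y])
    have "\<exists>n. x [^]\<^bsub>R\<^esub> (n::nat) \<in> ?J" if "x \<in> S" for x using R that S(2) by auto
    then obtain N where N: "\<And>w. \<lbrakk>set w \<subseteq> S; N \<le> length w\<rbrakk> \<Longrightarrow> word_prod R w \<in> ?J"
      using long_words_in_ideal[OF M.R.is_cring J S] by blast
    have "ideal_power R (Idl\<^bsub>R\<^esub> S) N \<subseteq> ?J"
      by (rule ideal_power_subset_if_words[OF M.R.is_cring S(2) J]) (use N in auto)
    then show ?L by blast
  }
qed

section \<open>Comparison of local cohomology modules\<close>

text \<open>Both local cohomology modules come from the same chosen resolution, and \<open>\<Gamma>\<^sub>\<mm>\<close> of it consists of the elements
  of \<open>\<Gamma>\<^sub>\<aa>\<close> that are torsion for each of finitely many generators of \<open>\<mm>\<close>.\<close>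

lemma local_cohomology_finite_length_transfer:
  fixes R :: "('a, 'r) ring_scheme" and M :: "('a, 'b, 'm) module_scheme"
  assumes noeth: "noetherian_ring R" and loc: "local_ring R \<mm>" and M: "module R M"
    and \<aa>: "ideal \<aa> R" "\<aa> \<noteq> carrier R"
    and fin: "\<And>j. j \<le> i \<Longrightarrow> finite_length R (local_cohomology R \<aa> M j)"
  shows "finite_length R (local_cohomology R \<mm> M i)"
proof -
  interpret noetherian_ring R by fact
  have cring: "cring R" using loc by (simp add: local_ring_def)
  have max: "maximalideal \<mm> R" using loc by (simp add: local_ring_def)
  then have \<mm>: "ideal \<mm> R" by (rule maximalideal.axioms)
  have \<aa>\<mm>: "\<aa> \<subseteq> \<mm>" by (rule proper_ideal_subset[OF noeth loc \<aa>])
  obtain E :: "nat \<Rightarrow> ('a, ('a, 'b) res_univ) module" and d \<epsilon>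
    where ch: "chosen_resolution R M = (E, d)" and res: "injective_resolution R M E d \<epsilon>"
    using chosen_resolution[OF M] .
  obtain \<alpha> :: "'a \<Rightarrow> ('a, 'b) res_univ" where \<alpha>: "inj \<alpha>"
    using res_univ_embeddings by metis
  have inj: "injective_module R (E i)" for i using res by (simp add: injective_resolution_def)
  have exact: "d i ` carrier (E i) = hom_ker (E (Suc i)) (E (Suc (Suc i))) (d (Suc i))" for i
    using res by (simp add: injective_resolution_def)
  have "divisible_complex R E d"
  proof (rule divisible_complex.intro)
    show mE: "module R (E i)" for i using inj[of i] by (simp add: injective_module_def)
    show "d i \<in> mod_hom R (E i) (E (Suc i))" for i using res by (simp add: injective_resolution_def)
    show "d (Suc i) (d i y) = \<zero>\<^bsub>E (Suc (Suc i))\<^esub>" if "y \<in> carrier (E i)" for y i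
      using exact[of i] that by (auto simp: hom_ker_def)
    show "\<exists>n. \<exists>z \<in> carrier (E i).
        (x [^]\<^bsub>R\<^esub> Suc n) \<odot>\<^bsub>E i\<^esub> z = (x [^]\<^bsub>R\<^esub> n) \<odot>\<^bsub>E i\<^esub> y \<and>
        (\<forall>r \<in> carrier R. r \<odot>\<^bsub>E i\<^esub> y = \<zero>\<^bsub>E i\<^esub> \<longrightarrow> r \<odot>\<^bsub>E i\<^esub> z = \<zero>\<^bsub>E i\<^esub>)"
      if "x \<in> carrier R" "y \<in> carrier (E i)" for x y i
      by (rule injective_division[OF cring noeth inj inj_on_subset[OF \<alpha> subset_UNIV] that])
  qed
  then interpret divisible_complex R E d .
  define \<Gamma> where "\<Gamma> I j = carrier (torsion_module R I (E j))" for I j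
  have lc: "local_cohomology R I M j = cohomology_of (\<Gamma> I) j" for I j
  proof -
    have zero: "\<zero>\<^bsub>torsion_module R I (E k)\<^esub> = \<zero>\<^bsub>E k\<^esub>" for k by (simp add: torsion_module_def)
    have Z: "hom_ker (torsion_module R I (E j)) (torsion_module R I (E (Suc j)))
        (torsion_map R I (E j) (E (Suc j)) (d j)) = cycles (\<Gamma> I) j"
      by (simp add: hom_ker_def cycles_def torsion_map_def zero \<Gamma>_def[symmetric] cong: conj_cong)
    have B: "(case j of 0 \<Rightarrow> {\<zero>\<^bsub>torsion_module R I (E 0)\<^esub>}
        | Suc k \<Rightarrow> torsion_map R I (E k) (E (Suc k)) (d k) ` carrier (torsion_module R I (E k)))
        = boundaries (\<Gamma> I) j"
      by (simp add: boundaries_def torsion_map_def zero \<Gamma>_def[symmetric] split: nat.split)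
    show ?thesis
      unfolding local_cohomology_def right_derived_def ch prod.case cohomology_def Z B cohomology_of_def
      by (simp add: torsion_module_def)
  qed
  have whole: "ann_closed_subcomplex (\<lambda>j. carrier (E j))"
    unfolding ann_closed_subcomplex_def
    using module.carrier_is_submodule[OF module] mod_homD(1)[OF hom] by auto
  have \<Gamma>_powers: "\<Gamma> (Idl\<^bsub>R\<^esub> S) = power_torsion S (\<lambda>j. carrier (E j))"
    if "finite S" "S \<subseteq> carrier R" for S
  proof -
    have "y \<in> \<Gamma> (Idl\<^bsub>R\<^esub> S) j \<longleftrightarrow> y \<in> power_torsion S (\<lambda>j. carrier (E j)) j" for j y
      using ideal_power_kills_iff[OF module that, of y j]
      by (simp add: \<Gamma>_def torsion_module_def power_torsion_def cong: conj_cong)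
    then have "\<Gamma> (Idl\<^bsub>R\<^esub> S) j = power_torsion S (\<lambda>j. carrier (E j)) j" for j
      by blast
    then show ?thesis ..
  qed
  obtain A where A: "A \<subseteq> carrier R" "finite A" "\<aa> = Idl\<^bsub>R\<^esub> A" using finetely_gen[OF \<aa>(1)] by blast
  obtain S where S: "S \<subseteq> carrier R" "finite S" "\<mm> = Idl\<^bsub>R\<^esub> S" using finetely_gen[OF \<mm>] by blast
  have \<Gamma>\<aa>: "ann_closed_subcomplex (\<Gamma> \<aa>)"
    unfolding A(3) \<Gamma>_powers[OF A(2,1)] by (rule ann_closed_subcomplex_power_torsion[OF whole A(1)])
  have \<Gamma>\<mm>: "ann_closed_subcomplex (\<Gamma> \<mm>)"
    unfolding S(3) \<Gamma>_powers[OF S(2,1)] by (rule ann_closed_subcomplex_power_torsion[OF whole S(1)])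
  have mono: "\<Gamma> \<mm> j \<subseteq> \<Gamma> \<aa> j" for j
    using ideal_power_mono_base[OF \<aa>\<mm>, of R] by (fastforce simp: \<Gamma>_def torsion_module_def)
  have eq: "\<Gamma> \<mm> j = power_torsion S (\<Gamma> \<aa>) j" for j
  proof -
    have "\<Gamma> \<mm> j = power_torsion S (\<lambda>j. carrier (E j)) j" using \<Gamma>_powers[OF S(2,1)] S(3) by simp
    moreover have "\<Gamma> \<aa> j \<subseteq> carrier (E j)" by (auto simp: \<Gamma>_def torsion_module_def)
    ultimately show ?thesis using mono[of j] by (auto simp: power_torsion_def)
  qed
  have tors: "\<exists>n. (x [^]\<^bsub>R\<^esub> (n::nat)) \<odot>\<^bsub>E j\<^esub> z \<in> boundaries (\<Gamma> \<aa>) j"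
    if "x \<in> S" "j < Suc i" "z \<in> \<Gamma> \<aa> j" "d j z = \<zero>\<^bsub>E (Suc j)\<^esub>" for x j z
  proof (rule finite_length_imp_torsion_modulo_boundaries[OF noeth loc _ \<Gamma>\<aa> _ that(3,4)])
    show "x \<in> \<mm>" using genideal_self[OF S(1)] S(3) that(1) by blast
    show "finite_length R (cohomology_of (\<Gamma> \<aa>) j)" using fin[of j] that(2) lc by simp
  qed
  have "power_torsion S (\<Gamma> \<aa>) i \<inter> boundaries (\<Gamma> \<aa>) i \<subseteq> boundaries (power_torsion S (\<Gamma> \<aa>)) i"
    by (rule power_torsion_boundaries[OF S(2,1) \<Gamma>\<aa> tors lessI])
  moreover have "power_torsion S (\<Gamma> \<aa>) = \<Gamma> \<mm>" using eq by (simp add: fun_eq_iff)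
  ultimately have "\<Gamma> \<mm> i \<inter> boundaries (\<Gamma> \<aa>) i \<subseteq> boundaries (\<Gamma> \<mm>) i" by simp
  then show ?thesis
    unfolding lc using finite_length_subcomplex[OF \<Gamma>\<mm> \<Gamma>\<aa> mono] fin[of i] lc by simp
qed

theorem corollary3p4:
  fixes R :: "('a, 'r) ring_scheme" and \<mm> :: "'a set" and M :: "('a, 'b, 'm) module_scheme"
  assumes "noetherian_ring R" and "local_ring R \<mm>"
    and "finitely_generated_module R M" and "carrier M \<noteq> {\<zero>\<^bsub>M\<^esub>}"
  shows "generalized_Cohen_Macaulay R \<mm> M \<longleftrightarrow>
    (\<exists>\<aa>. ideal \<aa> R \<and> \<aa> \<noteq> carrier R \<and>
       (\<forall>i. enat i < module_dim R M \<longrightarrow> finite_length R (local_cohomology R \<aa> M i)))"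
proof
  assume gcm: "generalized_Cohen_Macaulay R \<mm> M"
  have max: "maximalideal \<mm> R" using assms(2) by (simp add: local_ring_def)
  then have "ideal \<mm> R" "\<mm> \<noteq> carrier R"
    using maximalideal.axioms maximalideal.I_notcarr by blast+
  then show "\<exists>\<aa>. ideal \<aa> R \<and> \<aa> \<noteq> carrier R \<and>
      (\<forall>i. enat i < module_dim R M \<longrightarrow> finite_length R (local_cohomology R \<aa> M i))"
    using gcm unfolding generalized_Cohen_Macaulay_def by blast
next
  assume "\<exists>\<aa>. ideal \<aa> R \<and> \<aa> \<noteq> carrier R \<and>
      (\<forall>i. enat i < module_dim R M \<longrightarrow> finite_length R (local_cohomology R \<aa> M i))"
  then obtain \<aa> where \<aa>: "ideal \<aa> R" "\<aa> \<noteq> carrier R"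
    and fin: "\<And>i. enat i < module_dim R M \<Longrightarrow> finite_length R (local_cohomology R \<aa> M i)"
    by blast
  have M: "module R M" using assms(3) by (simp add: finitely_generated_module_def)
  have "finite_length R (local_cohomology R \<mm> M i)" if "enat i < module_dim R M" for i
  proof (rule local_cohomology_finite_length_transfer[OF assms(1,2) M \<aa>])
    show "finite_length R (local_cohomology R \<aa> M j)" if "j \<le> i" for j
    proof (rule fin)
      have "enat j \<le> enat i" using that by simp
      then show "enat j < module_dim R M" using \<open>enat i < module_dim R M\<close> by (rule order.strict_trans1)
    qed
  qed
  then show "generalized_Cohen_Macaulay R \<mm> M"
    using assms(3) by (simp add: generalized_Cohen_Macaulay_def)
qed

end
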